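(* Let $\Bbbk$ be a field, $V$ a finite-dimensional $\Bbbk$-vector space and $R$ a Hecke symmetry on $V$ with parameter $q$. Let $n>0$. If $\dim\Upsilon^{(n)}=1$ and $\Upsilon^{(n+1)}=0$, then the algebras $\Upsilon(V,R)$ and $\mathbb{S}(V,R)^!$ are Frobenius. Moreover, if $\dim V>1$, then $\dim\Upsilon^{(n)}=1$ already implies $\Upsilon^{(n+1)}=0$.
   Context: A Hecke symmetry on $V$ with parameter $0\neq q\in\Bbbk$ is a linear map $R:V\otimes V\to V\otimes V$ satisfying $(R\otimes\mathrm{Id}_V)(\mathrm{Id}_V\otimes R)(R\otimes\mathrm{Id}_V)=(\mathrm{Id}_V\otimes R)(R\otimes\mathrm{Id}_V)(\mathrm{Id}_V\otimes R)$ and $(R-q\,\mathrm{Id})(R+\mathrm{Id})=0$ ($q=-1$ allowed). In $\mathbb{T}(V)$ products of homogeneous elements are written $ab=a\otimes b$. For $p\ge2$, $1\le i\le p-1$, $R_i^{(p)}=\mathrm{Id}_V^{\otimes(i-1)}\otimes R\otimes\mathrm{Id}_V^{\otimes(p-i-1)}$ on $V^{\otimes p}$. $\Upsilon^{(0)}=\Bbbk$, $\Upsilon^{(1)}=V$, $\Upsilon^{(p)}=\bigcap_{i=1}^{p-1}(R_i^{(p)}-q\,\mathrm{Id})V^{\otimes p}$ for $p\ge 2$. Hecke algebra ${\cal H}_m$: generators $T_1,\dots,T_{m-1}$, relations $T_iT_jT_i=T_jT_iT_j$ ($|i-j|=1$), $T_iT_j=T_jT_i$ ($|i-j|>1$),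 $(T_i-q)(T_i+1)=0$; basis $T_\sigma$, $\sigma\in S_m$, $T_\sigma=T_{i_1}\cdots T_{i_r}$ for a reduced expression $\sigma=\tau_{i_1}\cdots\tau_{i_r}$, $\tau_i=(i,i+1)$, $\ell$ the length function. ${\cal H}_m$ acts on $V^{\otimes p}$, $p\ge m$, with $T_i\mapsto R_i^{(p)}$. For $0\le k\le m$, $D_{k,m-k}$ is the set of $\sigma\in S_m$ increasing on $\{1,\dots,k\}$ and on $\{k+1,\dots,m\}$, and $y_{m/k,m-k}=\sum_{d\in D_{k,m-k}}(-1)^{\ell(d)}q^{k(m-k)-\ell(d)}T_d$. $\Upsilon(V,R)=\bigoplus_{k\ge0}\Upsilon^{(k)}$ is the graded associative unital algebra with product $a\star b=y_{k+l/k,l}(ab)$ for $a\in\Upsilon^{(k)},b\in\Upsilon^{(l)}$. $\mathbb{S}(V,R)^!$ is the quotient of $\mathbb{T}(V^* )$ by the ideal generated by $(\Upsilon^{(2)})^\perp\subset V^*\otimes V^*$, with respect to the pairing $\langle f\otimes g,v\otimes w\rangle=f(v)g(w)$. *)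

theory Defs
  imports Complex_Main "HOL-Library.Function_Algebras" "HOL-Combinatorics.Permutations"
begin

text \<open>Coordinates: V has basis e_0,...,e_(d-1) (d = dim V). A tensor in T(V) is a function
  on words (nat lists) with letters < d, finitely supported; the value at w = [i1,...,ip]
  is the coefficient of e_i1 (x) ... (x) e_ip. The same model is used for T(V*) w.r.t. the
  dual basis.\<close>

type_synonym 'k tensor = "nat list \<Rightarrow> 'k"

definition fscale :: "'k::field \<Rightarrow> 'k tensor \<Rightarrow> 'k tensor" where
  "fscale c x = (\<lambda>w. c * x w)"

definition TV :: "nat \<Rightarrow> ('k::field) tensor set" where
  "TV d = {x. finite {w. x w \<noteq> 0} \<and> (\<forall>w. x w \<noteq> 0 \<longrightarrow> set w \<subseteq> {..<d})}"

definition Tp :: "nat \<Rightarrow> nat \<Rightarrow> ('k::field) tensor set" where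
  "Tp d p = {x. \<forall>w. x w \<noteq> 0 \<longrightarrow> length w = p \<and> set w \<subseteq> {..<d}}"

definition hom :: "nat \<Rightarrow> ('k::field) tensor \<Rightarrow> 'k tensor" where
  "hom p x = (\<lambda>w. if length w = p then x w else 0)"

definition tmul :: "('k::field) tensor \<Rightarrow> 'k tensor \<Rightarrow> 'k tensor" where
  "tmul x y = (\<lambda>w. \<Sum>k\<le>length w. x (take k w) * y (drop k w))"

definition tone :: "('k::field) tensor" where
  "tone = (\<lambda>w. if w = [] then 1 else 0)"

text \<open>R is given by its matrix: R(e_a (x) e_b) = sum_{c,e} r a b c e * e_c (x) e_e.
  Rop d r i is R_i^(p) = Id^(i-1) (x) R (x) Id^(p-i-1) (1 <= i <= p-1), acting on each
  homogeneous component of degree p > i.\<close>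
definition Rop :: "nat \<Rightarrow> (nat \<Rightarrow> nat \<Rightarrow> nat \<Rightarrow> nat \<Rightarrow> 'k::field) \<Rightarrow> nat \<Rightarrow> 'k tensor \<Rightarrow> 'k tensor" where
  "Rop d r i x = (\<lambda>w. if 1 \<le> i \<and> i < length w \<and> set w \<subseteq> {..<d} then
       (\<Sum>a<d. \<Sum>b<d. r a b (w ! (i - 1)) (w ! i) * x (w[i - 1 := a, i := b])) else 0)"

definition hecke :: "nat \<Rightarrow> (nat \<Rightarrow> nat \<Rightarrow> nat \<Rightarrow> nat \<Rightarrow> 'k::field) \<Rightarrow> 'k \<Rightarrow> bool" where
  "hecke d r q \<longleftrightarrow> q \<noteq> 0 \<and>
     (\<forall>x\<in>Tp d 3. Rop d r 1 (Rop d r 2 (Rop d r 1 x)) = Rop d r 2 (Rop d r 1 (Rop d r 2 x))) \<and>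
     (\<forall>x\<in>Tp d 2. let y = (\<lambda>w. Rop d r 1 x w + x w) in (\<lambda>w. Rop d r 1 y w - q * y w) = 0)"

definition Ups :: "nat \<Rightarrow> (nat \<Rightarrow> nat \<Rightarrow> nat \<Rightarrow> nat \<Rightarrow> 'k::field) \<Rightarrow> 'k \<Rightarrow> nat \<Rightarrow> 'k tensor set" where
  "Ups d r q p = {x \<in> Tp d p. \<forall>i. 1 \<le> i \<and> i < p \<longrightarrow>
       (\<exists>y\<in>Tp d p. x = (\<lambda>w. Rop d r i y w - q * y w))}"

definition tau :: "nat \<Rightarrow> nat \<Rightarrow> nat" where
  "tau i = (\<lambda>x. if x = i then Suc i else if x = Suc i then i else x)"

definition perm_of_word :: "nat list \<Rightarrow> nat \<Rightarrow> nat" where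
  "perm_of_word ws = foldr (\<lambda>i f. tau i \<circ> f) ws id"

definition plen :: "nat \<Rightarrow> (nat \<Rightarrow> nat) \<Rightarrow> nat" where
  "plen m \<sigma> = (LEAST l. \<exists>ws. set ws \<subseteq> {1..<m} \<and> perm_of_word ws = \<sigma> \<and> length ws = l)"

definition Tperm :: "nat \<Rightarrow> (nat \<Rightarrow> nat \<Rightarrow> nat \<Rightarrow> nat \<Rightarrow> 'k::field) \<Rightarrow> nat \<Rightarrow> (nat \<Rightarrow> nat) \<Rightarrow> 'k tensor \<Rightarrow> 'k tensor" where
  "Tperm d r m \<sigma> x = (let ws = (SOME ws. set ws \<subseteq> {1..<m} \<and> perm_of_word ws = \<sigma> \<and> length ws = plen m \<sigma>)
     in foldr (Rop d r) ws x)"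

definition Dset :: "nat \<Rightarrow> nat \<Rightarrow> (nat \<Rightarrow> nat) set" where
  "Dset k m = {\<sigma>. \<sigma> permutes {1..m} \<and>
      (\<forall>a b. 1 \<le> a \<and> a < b \<and> b \<le> k \<longrightarrow> \<sigma> a < \<sigma> b) \<and>
      (\<forall>a b. k + 1 \<le> a \<and> a < b \<and> b \<le> m \<longrightarrow> \<sigma> a < \<sigma> b)}"

definition yop :: "nat \<Rightarrow> (nat \<Rightarrow> nat \<Rightarrow> nat \<Rightarrow> nat \<Rightarrow> 'k::field) \<Rightarrow> 'k \<Rightarrow> nat \<Rightarrow> nat \<Rightarrow> 'k tensor \<Rightarrow> 'k tensor" where
  "yop d r q m k x = (\<lambda>w. \<Sum>\<sigma>\<in>Dset k m.
      (-1) ^ plen m \<sigma> * q ^ (k * (m - k) - plen m \<sigma>) * Tperm d r m \<sigma> x w)"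

definition degs :: "('k::field) tensor \<Rightarrow> nat set" where
  "degs x = length ` {w. x w \<noteq> 0}"

definition star :: "nat \<Rightarrow> (nat \<Rightarrow> nat \<Rightarrow> nat \<Rightarrow> nat \<Rightarrow> 'k::field) \<Rightarrow> 'k \<Rightarrow> 'k tensor \<Rightarrow> 'k tensor \<Rightarrow> 'k tensor" where
  "star d r q a b = (\<Sum>k\<in>degs a. \<Sum>l\<in>degs b. yop d r q (k + l) k (tmul (hom k a) (hom l b)))"

definition UpsAlg :: "nat \<Rightarrow> (nat \<Rightarrow> nat \<Rightarrow> nat \<Rightarrow> nat \<Rightarrow> 'k::field) \<Rightarrow> 'k \<Rightarrow> 'k tensor set" where
  "UpsAlg d r q = {x \<in> TV d. \<forall>p. hom p x \<in> Ups d r q p}"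

text \<open>(Upsilon^(2))^perp in V* (x) V*, via the pairing <f(x)g, v(x)w> = f(v) g(w)
  (in dual-basis coordinates: sum of products of coefficients).\<close>
definition Ups2perp :: "nat \<Rightarrow> (nat \<Rightarrow> nat \<Rightarrow> nat \<Rightarrow> nat \<Rightarrow> 'k::field) \<Rightarrow> 'k \<Rightarrow> 'k tensor set" where
  "Ups2perp d r q = {\<xi> \<in> Tp d 2. \<forall>x\<in>Ups d r q 2. (\<Sum>i<d. \<Sum>j<d. \<xi> [i, j] * x [i, j]) = 0}"

definition Sdual_ideal :: "nat \<Rightarrow> (nat \<Rightarrow> nat \<Rightarrow> nat \<Rightarrow> nat \<Rightarrow> 'k::field) \<Rightarrow> 'k \<Rightarrow> 'k tensor set" where
  "Sdual_ideal d r q = Modules.module.span fscale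
     {tmul (tmul u \<xi>) v | u \<xi> v. u \<in> TV d \<and> v \<in> TV d \<and> \<xi> \<in> Ups2perp d r q}"

text \<open>Frobenius algebra A/I (A a unital associative algebra of coefficient functions with
  product mul and unit one, I a two-sided ideal): A/I is finite dimensional and there is a
  linear form on A/I whose associated bilinear form (a,b) |-> eps(ab) is nondegenerate.\<close>
definition frobenius_quot :: "('k::field) tensor set \<Rightarrow> 'k tensor set \<Rightarrow>
    ('k tensor \<Rightarrow> 'k tensor \<Rightarrow> 'k tensor) \<Rightarrow> 'k tensor \<Rightarrow> bool" where
  "frobenius_quot A I mul one \<longleftrightarrow>
     0 \<in> A \<and> (\<forall>a\<in>A. \<forall>b\<in>A. a + b \<in> A) \<and> (\<forall>c. \<forall>a\<in>A. fscale c a \<in> A) \<and>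
     one \<in> A \<and> (\<forall>a\<in>A. \<forall>b\<in>A. mul a b \<in> A) \<and>
     (\<forall>a\<in>A. \<forall>b\<in>A. \<forall>c\<in>A. mul (a + b) c = mul a c + mul b c \<and> mul a (b + c) = mul a b + mul a c) \<and>
     (\<forall>s. \<forall>a\<in>A. \<forall>b\<in>A. mul (fscale s a) b = fscale s (mul a b) \<and> mul a (fscale s b) = fscale s (mul a b)) \<and>
     (\<forall>a\<in>A. \<forall>b\<in>A. \<forall>c\<in>A. mul (mul a b) c = mul a (mul b c)) \<and>
     (\<forall>a\<in>A. mul one a = a \<and> mul a one = a) \<and>
     I \<subseteq> A \<and> 0 \<in> I \<and> (\<forall>a\<in>I. \<forall>b\<in>I. a + b \<in> I) \<and> (\<forall>c. \<forall>a\<in>I. fscale c a \<in> I) \<and>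
     (\<forall>a\<in>A. \<forall>x\<in>I. mul a x \<in> I \<and> mul x a \<in> I) \<and>
     (\<exists>B. finite B \<and> B \<subseteq> A \<and> (\<forall>a\<in>A. \<exists>b\<in>Modules.module.span fscale B. a - b \<in> I)) \<and>
     (\<exists>\<epsilon> :: 'k tensor \<Rightarrow> 'k.
        (\<forall>a\<in>A. \<forall>b\<in>A. \<epsilon> (a + b) = \<epsilon> a + \<epsilon> b) \<and> (\<forall>c. \<forall>a\<in>A. \<epsilon> (fscale c a) = c * \<epsilon> a) \<and>
        (\<forall>x\<in>I. \<epsilon> x = 0) \<and>
        (\<forall>a\<in>A. (\<forall>b\<in>A. \<epsilon> (mul a b) = 0) \<longrightarrow> a \<in> I) \<and>
        (\<forall>a\<in>A. (\<forall>b\<in>A. \<epsilon> (mul b a) = 0) \<longrightarrow> a \<in> I))"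

abbreviation vdim :: "('k::field) tensor set \<Rightarrow> nat" where
  "vdim S \<equiv> Vector_Spaces.vector_space.dim fscale S"

end

theory Submission
  imports Defs
begin

text \<open>Let \<open>\<omega>\<close> span \<open>\<Upsilon>\<close> in degree \<open>n\<close>. Moving a vector \<open>v\<close> past \<open>\<omega>\<close> with the braiding gives
  \<open>v \<omega> \<mapsto> \<omega> \<phi>(v)\<close> for an injective linear map \<open>\<phi>\<close>. If \<open>\<Upsilon>\<close> vanishes in degree \<open>n + 1\<close>, then all products
  of that degree vanish, and peeling off the letters of \<open>a \<in> \<Upsilon>\<close> one at a time with \<open>\<phi>\<close> shows that
  \<open>a \<star> b = 0\<close> for all \<open>b\<close> of complementary degree (indeed for all left factors \<open>b\<close> of \<open>\<omega>\<close>) forces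
  \<open>a = 0\<close>. Counting dimensions in degrees \<open>k\<close> and \<open>n - k\<close> then gives at once nondegeneracy of \<open>\<star>\<close> on both
  sides and the fact that the left and the right factors of \<open>\<omega>\<close> fill \<open>\<Upsilon>\<close> in every degree, which is
  nondegeneracy of the quadratic dual. For the last claim, a nonzero \<open>v \<omega> = \<omega> w\<close> in degree \<open>n + 1\<close>
  forces \<open>\<omega> = \<omega>' w\<close> and makes degree \<open>n + 1\<close> the line spanned by \<open>\<omega> w\<close>; the elements \<open>u \<star> \<omega>\<close> then show
  that \<open>\<phi>\<close> maps \<open>V\<close> into the line spanned by \<open>w\<close>.\<close>

section \<open>Tensors and the operators \<open>T\<^sub>i\<close>\<close>

text \<open>Since q = -1 is allowed, the image of \<open>T\<^sub>i - q\<close> can be smaller than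
  the kernel of \<open>T\<^sub>i + 1\<close>, and without division by quantum integers there is no
  idempotent projecting onto \<open>\<Upsilon>\<close>. Membership in \<open>\<Upsilon>\<close> is
  therefore proved by carrying preimages along, which works because crossings and shuffles
  intertwine the various \<open>T\<^sub>i\<close>. The operators y are given by arbitrarily chosen
  reduced words; a recursion replaces them, at the price of proving that all reduced words of a
  permutation act alike. Nondegeneracy is tested against \<open>\<omega>\<close> itself rather than
  against its left factors one by one: the single equation
  \<open>Y 0 k (n - k) (tmul a \<omega>) = 0\<close> contains them all, and the unshuffled tail of
  \<open>\<omega>\<close> leaves room for completing a crossing through the whole of
  \<open>\<omega>\<close>, as \<open>\<phi>\<close> requires. The last claim does need dim V > 1:
  for dim V = 1, R = -Id and q \<noteq> -1 every component of \<open>\<Upsilon>\<close> is a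
  line.\<close>

lemma vector_space_fscale: "vector_space (fscale :: 'k::field \<Rightarrow> 'k tensor \<Rightarrow> 'k tensor)"
  by unfold_locales (auto simp: fscale_def fun_eq_iff algebra_simps)

interpretation fs: vector_space "fscale :: 'k::field \<Rightarrow> 'k tensor \<Rightarrow> 'k tensor"
  by (rule vector_space_fscale)

lemma fscale_apply [simp]: "fscale c x w = c * x w"
  by (simp add: fscale_def)

lemma sum_tensor_apply: "(\<Sum>i\<in>A. f i) w = (\<Sum>i\<in>A. f i w)" for f :: "'i \<Rightarrow> 'b \<Rightarrow> 'k::comm_monoid_add"
  by (induction A rule: infinite_finite_induct) auto

definition words :: "nat \<Rightarrow> nat \<Rightarrow> nat list set" where
  "words d p = {w. length w = p \<and> set w \<subseteq> {..<d}}"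

lemma finite_words [simp]: "finite (words d p)"
  using finite_lists_length_eq[of "{..<d}" p] by (simp add: words_def conj_commute)

lemma words_append_iff: "length u = k \<Longrightarrow> u @ v \<in> words d (k + l) \<longleftrightarrow> u \<in> words d k \<and> v \<in> words d l"
  by (auto simp: words_def)

lemma in_Tp_iff: "x \<in> Tp d p \<longleftrightarrow> (\<forall>w. w \<notin> words d p \<longrightarrow> x w = 0)"
  by (auto simp: Tp_def words_def)

lemma Tp_outside: "x \<in> Tp d p \<Longrightarrow> w \<notin> words d p \<Longrightarrow> x w = 0"
  by (simp add: in_Tp_iff)

lemma Tp_eqI:
  assumes "x \<in> Tp d p" "y \<in> Tp d p" "\<And>w. w \<in> words d p \<Longrightarrow> x w = y w"
  shows "x = y"
  using assms by (metis (no_types, opaque_lifting) ext in_Tp_iff)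

lemma subspace_Tp: "fs.subspace (Tp d p)"
  by (auto simp: fs.subspace_def in_Tp_iff)

lemma Tp_0: "0 \<in> Tp d p"
  and Tp_add: "x \<in> Tp d p \<Longrightarrow> y \<in> Tp d p \<Longrightarrow> x + y \<in> Tp d p"
  and Tp_scale: "x \<in> Tp d p \<Longrightarrow> fscale c x \<in> Tp d p"
  and Tp_sum: "(\<And>i. i \<in> A \<Longrightarrow> f i \<in> Tp d p) \<Longrightarrow> sum f A \<in> Tp d p"
  using subspace_Tp fs.subspace_0 fs.subspace_add fs.subspace_scale fs.subspace_sum
  by metis+

definition unit_tensor :: "nat list \<Rightarrow> ('k::field) tensor" where
  "unit_tensor u = (\<lambda>w. if w = u then 1 else 0)"

lemma unit_tensor_in_Tp: "u \<in> words d p \<Longrightarrow> unit_tensor u \<in> Tp d p"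
  by (auto simp: unit_tensor_def in_Tp_iff)

lemma Tp_expand:
  assumes "x \<in> Tp d p"
  shows "x = (\<Sum>w\<in>words d p. fscale (x w) (unit_tensor w))"
proof
  fix v
  have "(\<Sum>w\<in>words d p. x w * (if v = w then 1 else 0)) = (if v \<in> words d p then x v else 0)"
    by (simp add: if_distrib sum.delta cong: if_cong)
  then show "x v = (\<Sum>w\<in>words d p. fscale (x w) (unit_tensor w)) v"
    using assms by (auto simp: sum_tensor_apply unit_tensor_def in_Tp_iff)
qed

text \<open>Locality: the value at a word depends only on words of the same length over the
  alphabet, so an identity known on one slice or one length can be fed into the next
  operator.\<close>

lemma Rop_cong:
  assumes "\<And>w'. length w' = length w \<Longrightarrow> set w' \<subseteq> {..<d} \<Longrightarrow> x w' = y w'"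
  shows "Rop d r i x w = Rop d r i y w"
proof -
  have "set (w[i - 1 := a, i := b]) \<subseteq> {..<d}" if "set w \<subseteq> {..<d}" "a < d" "b < d" for a b
    using that by (meson insert_subset lessThan_iff order_trans set_update_subset_insert set_update_subsetI)
  then show ?thesis
    unfolding Rop_def using assms by (auto intro!: sum.cong)
qed

lemma Rop_add: "Rop d r i (x + y) = Rop d r i x + Rop d r i y"
  by (auto simp: Rop_def fun_eq_iff algebra_simps sum.distrib)

lemma Rop_scale: "Rop d r i (fscale c x) = fscale c (Rop d r i x)"
  by (auto simp: Rop_def fun_eq_iff algebra_simps sum_distrib_left)

lemma Rop_0_left [simp]: "Rop d r 0 x = 0"
  by (auto simp: Rop_def)

lemma Rop_zero [simp]: "Rop d r i 0 = 0"
  by (auto simp: Rop_def)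

lemma Rop_diff: "Rop d r i (x - y) = Rop d r i x - Rop d r i y"
  by (auto simp: Rop_def fun_eq_iff algebra_simps sum_subtractf)

lemma Rop_outside: "\<not> (i < length w \<and> set w \<subseteq> {..<d}) \<Longrightarrow> Rop d r i x w = 0"
  by (auto simp: Rop_def)

lemma Rop_in_Tp: "x \<in> Tp d p \<Longrightarrow> Rop d r i x \<in> Tp d p"
  unfolding in_Tp_iff words_def by (auto simp: Rop_def intro!: sum.neutral)

text \<open>With prefix and suffix frozen, \<open>R\<close> acts on the window alone. The relations
  given in degrees 2 and 3 reach arbitrary positions through this identity.\<close>

lemma Rop_sandwich:
  assumes "set u \<subseteq> {..<d}" "set v \<subseteq> {..<d}" "1 \<le> i" "i < length z"
  shows "Rop d r (length u + i) x (u @ z @ v) = Rop d r i (\<lambda>z. x (u @ z @ v)) z"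
proof -
  have 1: "(u @ z @ v) ! (length u + i - 1) = z ! (i - 1)" "(u @ z @ v) ! (length u + i) = z ! i"
    using assms by (auto simp: nth_append)
  have 2: "(u @ z @ v)[length u + i - 1 := a, length u + i := b] = u @ z[i - 1 := a, i := b] @ v" for a b
    using assms by (cases i) (auto simp: list_update_append)
  show ?thesis unfolding Rop_def 1 2 using assms by auto
qed

lemma Rop_commute:
  assumes "i + 1 < j"
  shows "Rop d r i (Rop d r j x) = Rop d r j (Rop d r i x)"
proof (cases "i = 0")
  case False
  show ?thesis
  proof
    fix w
    show "Rop d r i (Rop d r j x) w = Rop d r j (Rop d r i x) w"
    proof (cases "j < length w \<and> set w \<subseteq> {..<d}")
      case True
      let ?U = "{..<d} \<times> {..<d}"
      have upd: "set (w[k - 1 := a, k := b]) \<subseteq> {..<d}" if "a < d" "b < d" for a b k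
        using that True
        by (meson insert_subset lessThan_iff order_trans set_update_subset_insert set_update_subsetI)
      have swap: "w[i - 1 := a, i := b, j - 1 := a', j := b'] = w[j - 1 := a', j := b', i - 1 := a, i := b]"
        for a b a' b'
        using assms False by (simp add: list_update_swap)
      have "Rop d r i (Rop d r j x) w =
        (\<Sum>(a, b)\<in>?U. \<Sum>(a', b')\<in>?U. r a b (w ! (i - 1)) (w ! i) * (r a' b' (w ! (j - 1)) (w ! j) *
          x (w[i - 1 := a, i := b, j - 1 := a', j := b'])))"
        unfolding sum.cartesian_product [symmetric] sum_distrib_left [symmetric] Rop_def
        using assms False True upd by (auto intro!: sum.cong simp: nth_list_update)
      also have "\<dots> = (\<Sum>(a', b')\<in>?U. \<Sum>(a, b)\<in>?U. r a' b' (w ! (j - 1)) (w ! j) * (r a b (w ! (i - 1)) (w ! i) *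
          x (w[j - 1 := a', j := b', i - 1 := a, i := b])))"
        unfolding case_prod_beta swap
        by (subst sum.swap) (simp add: mult.left_commute)
      also have "\<dots> = Rop d r j (Rop d r i x) w"
        unfolding sum.cartesian_product [symmetric] sum_distrib_left [symmetric] Rop_def
        using assms False True upd by (auto intro!: sum.cong simp: nth_list_update)
      finally show ?thesis .
    next
      case False
      then have *: "Rop d r j y w' = 0" if "length w' = length w" "set w' \<subseteq> {..<d} \<longrightarrow> set w \<subseteq> {..<d}" for w' and y :: "'a tensor"
        using that by (auto intro!: Rop_outside)
      show ?thesis
      proof (cases "set w \<subseteq> {..<d}")
        case True
        have "Rop d r i (Rop d r j x) w = Rop d r i 0 w"
          by (rule Rop_cong) (use * True in auto)
        then show ?thesis using * by simp
      qed (auto intro!: trans[OF Rop_outside] Rop_outside[symmetric])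
    qed
  qed
qed auto

section \<open>The Hecke relations in every position\<close>

locale hecke_symmetry =
  fixes d :: nat and r :: "nat \<Rightarrow> nat \<Rightarrow> nat \<Rightarrow> nat \<Rightarrow> 'k::field" and q :: 'k
  assumes hecke: "hecke d r q"
begin

abbreviation T :: "nat \<Rightarrow> 'k tensor \<Rightarrow> 'k tensor" where
  "T \<equiv> Rop d r"

lemma q_nonzero: "q \<noteq> 0"
  using hecke by (simp add: hecke_def)

text \<open>Stated for every tensor and every index, because an operator without room for its two
  letters is zero. This keeps degree conditions out of the braid calculus up to
  \<open>Y_assoc\<close>.\<close>

lemma T_braid: "T i (T (Suc i) (T i x)) = T (Suc i) (T i (T (Suc i) x))"
proof (cases "i = 0")
  case False
  show ?thesis
  proof
    fix w
    show "T i (T (Suc i) (T i x)) w = T (Suc i) (T i (T (Suc i) x)) w"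
    proof (cases "Suc i < length w \<and> set w \<subseteq> {..<d}")
      case True
      define u where "u = take (i - 1) w"
      define z where "z = take 3 (drop (i - 1) w)"
      define v where "v = drop 3 (drop (i - 1) w)"
      have w: "w = u @ z @ v" unfolding u_def z_def v_def by (metis append_take_drop_id)
      have len: "length u = i - 1" "length z = 3"
        using True False by (auto simp: u_def z_def)
      have uv: "set u \<subseteq> {..<d}" "set v \<subseteq> {..<d}" "set z \<subseteq> {..<d}" using True w by auto
      \<comment> \<open>The hypothesis on \<open>R\<close> speaks of \<open>Tp d 3\<close> only,
        whereas \<open>x\<close> is an arbitrary function; cutting its slice off outside
        \<open>words d 3\<close> changes nothing that the operators read.\<close>
      define f where "f = (\<lambda>z'. if z' \<in> words d 3 then x (u @ z' @ v) else 0)"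
      have f: "f \<in> Tp d 3" by (auto simp: f_def in_Tp_iff)
      have i: "i = length u + 1" "Suc i = length u + 2" using len False by auto
      have 1: "T i y (u @ z' @ v) = T 1 (\<lambda>z'. y (u @ z' @ v)) z'" if "length z' = 3" for y z'
        unfolding i(1) by (rule Rop_sandwich) (use uv that in auto)
      have 2: "T (Suc i) y (u @ z' @ v) = T 2 (\<lambda>z'. y (u @ z' @ v)) z'" if "length z' = 3" for y z'
        unfolding i(2) by (rule Rop_sandwich) (use uv that in auto)
      have 0: "x (u @ z' @ v) = f z'" if "length z' = 3" "set z' \<subseteq> {..<d}" for z'
        using that by (simp add: f_def words_def)
      have "T i (T (Suc i) (T i x)) (u @ z @ v) = T 1 (T 2 (T 1 f)) z"
      proof -
        have a: "T i x (u @ z' @ v) = T 1 f z'" if "length z' = 3" for z'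
          unfolding 1[OF that] by (rule Rop_cong) (use 0 that in auto)
        have b: "T (Suc i) (T i x) (u @ z' @ v) = T 2 (T 1 f) z'" if "length z' = 3" for z'
          unfolding 2[OF that] by (rule Rop_cong) (use a that in auto)
        show ?thesis unfolding 1[OF len(2)] by (rule Rop_cong) (use b len in auto)
      qed
      moreover have "T (Suc i) (T i (T (Suc i) x)) (u @ z @ v) = T 2 (T 1 (T 2 f)) z"
      proof -
        have a: "T (Suc i) x (u @ z' @ v) = T 2 f z'" if "length z' = 3" for z'
          unfolding 2[OF that] by (rule Rop_cong) (use 0 that in auto)
        have b: "T i (T (Suc i) x) (u @ z' @ v) = T 1 (T 2 f) z'" if "length z' = 3" for z'
          unfolding 1[OF that] by (rule Rop_cong) (use a that in auto)
        show ?thesis unfolding 2[OF len(2)] by (rule Rop_cong) (use b len in auto)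
      qed
      moreover have "T 1 (T 2 (T 1 f)) = T 2 (T 1 (T 2 f))"
        using hecke f by (simp add: hecke_def)
      ultimately show ?thesis using w by simp
    next
      case out: False
      show ?thesis
      proof (cases "set w \<subseteq> {..<d}")
        case True
        have *: "T (Suc i) y w' = 0" if "length w' = length w" for w' y
          using that True out by (auto intro!: Rop_outside)
        have "T i (T (Suc i) (T i x)) w = T i 0 w"
          by (rule Rop_cong) (use * in auto)
        then show ?thesis using * by simp
      qed (auto intro!: trans[OF Rop_outside] Rop_outside[symmetric])
    qed
  qed
qed auto

text \<open>Here the range of \<open>i\<close> matters: for \<open>i = 0\<close> or
  \<open>i \<ge> p\<close> the operator is zero and the identity would force
  \<open>x = 0\<close>.\<close>

lemma T_quadratic:
  assumes "x \<in> Tp d p" "1 \<le> i" "i < p"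
  shows "T i (T i x) = fscale (q - 1) (T i x) + fscale q x"
proof (rule Tp_eqI[of _ d p])
  fix w assume w': "w \<in> words d p"
  define u where "u = take (i - 1) w"
  define z where "z = take 2 (drop (i - 1) w)"
  define v where "v = drop 2 (drop (i - 1) w)"
  have w: "w = u @ z @ v" unfolding u_def z_def v_def by (metis append_take_drop_id)
  have len: "length u = i - 1" "length z = 2"
    using assms w' by (auto simp: u_def z_def words_def)
  have uv: "set u \<subseteq> {..<d}" "set v \<subseteq> {..<d}" "set z \<subseteq> {..<d}" using w' w by (auto simp: words_def)
  define f where "f = (\<lambda>z'. if z' \<in> words d 2 then x (u @ z' @ v) else 0)"
  have f: "f \<in> Tp d 2" by (auto simp: f_def in_Tp_iff)
  have i: "i = length u + 1" using len assms by auto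
  have 1: "T i y (u @ z' @ v) = T 1 (\<lambda>z'. y (u @ z' @ v)) z'" if "length z' = 2" for y z'
    unfolding i by (rule Rop_sandwich) (use uv that in auto)
  have 0: "x (u @ z' @ v) = f z'" if "length z' = 2" "set z' \<subseteq> {..<d}" for z'
    using that by (simp add: f_def words_def)
  have a: "T i x (u @ z' @ v) = T 1 f z'" if "length z' = 2" for z'
    unfolding 1[OF that] by (rule Rop_cong) (use 0 that in auto)
  have b: "T i (T i x) (u @ z @ v) = T 1 (T 1 f) z"
    unfolding 1[OF len(2)] by (rule Rop_cong) (use a len in auto)
  have "(let y = (\<lambda>w. T 1 f w + f w) in (\<lambda>w. T 1 y w - q * y w) = 0)"
    using hecke f by (simp add: hecke_def)
  moreover have "(\<lambda>w. T 1 f w + f w) = T 1 f + f" by auto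
  ultimately have "(\<lambda>w. T 1 (T 1 f + f) w - q * (T 1 f + f) w) = 0" by (simp add: Let_def)
  from fun_cong[OF this, of z] have "T 1 (T 1 f) z = (q - 1) * T 1 f z + q * f z"
    by (simp add: Rop_add algebra_simps)
  then show "T i (T i x) w = (fscale (q - 1) (T i x) + fscale q x) w"
    using a[OF len(2)] b 0[OF len(2) uv(3)] w by simp
qed (use assms in \<open>auto intro!: Rop_in_Tp Tp_add Tp_scale\<close>)

lemma T_inj:
  assumes "x \<in> Tp d p" "1 \<le> i" "i < p" "T i x = 0"
  shows "x = 0"
  using T_quadratic[OF assms(1-3)] assms(4) q_nonzero by (auto simp: fun_eq_iff)

end

section \<open>Shuffle operators of the Hecke algebra\<close>

text \<open>With these simp rules active, sums of tensors get expanded pointwise inside equations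
  between tensors.\<close>

declare plus_fun_apply [simp del] minus_apply [simp del] uminus_apply [simp del]
  zero_fun_apply [simp del] fscale_apply [simp del]

lemmas tensor_apply = plus_fun_apply minus_apply uminus_apply zero_fun_apply fscale_apply
  sum_tensor_apply

context hecke_symmetry begin

lemma T_commute: "i + 1 < j \<Longrightarrow> T i (T j x) = T j (T i x)"
  by (rule Rop_commute)

text \<open>\<open>cross k l\<close> is \<open>T\<^sub>k\<^sub>+\<^sub>l\<^sub>-\<^sub>1 \<dots> T\<^sub>k\<close>. The operator \<open>Y s k l\<close> is \<open>y\<close> for the shuffle type \<open>(k, l)\<close>, acting on
  the tensor factors \<open>s + 1, \<dots>, s + k + l\<close>; the recursion distinguishes whether the last factor of
  a shuffle comes from the second or from the first block.\<close>

primrec cross :: "nat \<Rightarrow> nat \<Rightarrow> 'k tensor \<Rightarrow> 'k tensor" where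
  "cross k 0 x = x"
| "cross k (Suc l) x = T (k + l) (cross k l x)"

fun Y :: "nat \<Rightarrow> nat \<Rightarrow> nat \<Rightarrow> 'k tensor \<Rightarrow> 'k tensor" where
  "Y s 0 l x = x"
| "Y s (Suc k) 0 x = x"
| "Y s (Suc k) (Suc l) x = fscale (q ^ Suc k) (Y s (Suc k) l x) +
     fscale ((-1) ^ Suc l) (Y s k (Suc l) (cross (s + Suc k) (Suc l) x))"

lemma Y_0_right [simp]: "Y s k 0 x = x"
  by (cases k) auto

lemma cross_add: "cross k l (x + y) = cross k l x + cross k l y"
  by (induction l) (auto simp: Rop_add)

lemma cross_scale: "cross k l (fscale c x) = fscale c (cross k l x)"
  by (induction l) (auto simp: Rop_scale)

lemma cross_zero [simp]: "cross k l 0 = 0"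
  by (induction l) auto

lemma cross_sum: "cross k l (\<Sum>i\<in>A. f i) = (\<Sum>i\<in>A. cross k l (f i))"
  by (induction A rule: infinite_finite_induct) (auto simp: cross_add)

lemma cross_diff: "cross k l (x - y) = cross k l x - cross k l y"
  using cross_add[of k l "x - y" y] by simp

lemma Y_add: "Y s k l (x + y) = Y s k l x + Y s k l y"
  by (induction s k l x arbitrary: y rule: Y.induct) (auto simp: cross_add fs.scale_right_distrib)

lemma Y_scale: "Y s k l (fscale c x) = fscale c (Y s k l x)"
  by (induction s k l x rule: Y.induct) (simp_all add: cross_scale fs.scale_right_distrib fs.scale_right_diff_distrib mult.commute del: cross.simps)

lemma Y_diff: "Y s k l (x - y) = Y s k l x - Y s k l y"
  using Y_add[of s k l "x - y" y] by simp

lemma Y_zero [simp]: "Y s k l 0 = 0"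
  using Y_scale[of s k l 0 0] by simp

lemma Y_sum: "Y s k l (\<Sum>i\<in>A. f i) = (\<Sum>i\<in>A. Y s k l (f i))"
  by (induction A rule: infinite_finite_induct) (auto simp: Y_add)

lemma cross_in_Tp: "x \<in> Tp d p \<Longrightarrow> cross k l x \<in> Tp d p"
  by (induction l) (auto intro: Rop_in_Tp)

lemma Y_in_Tp: "x \<in> Tp d p \<Longrightarrow> Y s k l x \<in> Tp d p"
proof (induction s k l x rule: Y.induct)
  case (3 s k l x)
  then show ?case unfolding Y.simps by (intro Tp_add Tp_scale) (auto intro: cross_in_Tp simp del: cross.simps)
qed auto

lemma cross_inj:
  assumes "x \<in> Tp d p" "1 \<le> k" "k + l \<le> p" "cross k l x = 0"
  shows "x = 0"
  using assms(3,4)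
proof (induction l)
  case (Suc l)
  have "cross k l x = 0"
    by (rule T_inj[of _ p "k + l"]) (use Suc assms(1,2) in \<open>auto intro: cross_in_Tp\<close>)
  then show ?case using Suc by auto
qed (use assms in auto)

lemma cross_append: "cross (k + l) m (cross k l x) = cross k (l + m) x"
  by (induction m) (auto simp: add.assoc)

lemma T_cross_commute:
  assumes "j + 1 < k \<or> k + l < j"
  shows "T j (cross k l x) = cross k l (T j x)"
  using assms
proof (induction l)
  case (Suc l)
  have "T j (T (k + l) z) = T (k + l) (T j z)" for z
    using Suc.prems T_commute[of j "k + l" z] T_commute[of "k + l" j z] by auto
  then show ?case using Suc by auto
qed auto

text \<open>The crossing carries factor \<open>k\<close> to the right past the next \<open>l\<close>
  factors, which thereby move one place to the left; so an operator between two of them drops its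
  index by one. The braid relation enters when the moving factor passes exactly these two.\<close>

lemma cross_T_shift:
  assumes "k \<le> j" "Suc j < k + l"
  shows "cross k l (T (Suc j) x) = T j (cross k l x)"
  using assms
proof (induction l)
  case (Suc l)
  show ?case
  proof (cases "Suc j < k + l")
    case True
    then have "T (k + l) (T j z) = T j (T (k + l) z)" for z
      using T_commute[of j "k + l" z] by auto
    then show ?thesis using Suc True by auto
  next
    case False
    then have j: "Suc j = k + l" using Suc by simp
    then obtain l' where l: "l = Suc l'" "j = k + l'" using Suc.prems by (cases l) auto
    have "T (Suc j) (cross k l' x) = cross k l' (T (Suc j) x)"
      by (rule T_cross_commute) (use l in auto)
    then show ?thesis using l T_braid[of j] by simp
  qed
qed auto

lemma Y_T_commute:
  assumes "j < s \<or> s + k + l < j"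
  shows "T j (Y s k l x) = Y s k l (T j x)"
  using assms
proof (induction s k l x rule: Y.induct)
  case (3 s k l x)
  have "T j (cross (s + Suc k) (Suc l) x) = cross (s + Suc k) (Suc l) (T j x)"
    by (rule T_cross_commute) (use 3 in auto)
  then show ?case using 3 by (auto simp: Rop_add Rop_diff Rop_scale simp del: cross.simps)
qed auto

lemma Y_cross_commute:
  assumes "s + k + l < k'"
  shows "cross k' l' (Y s k l x) = Y s k l (cross k' l' x)"
  using assms by (induction l') (auto simp: Y_T_commute)

text \<open>The shuffle operator sits inside the block that the crossing moves one place to the
  left, so it reappears with its offset lowered by one.\<close>

lemma cross_Y_shift:
  assumes "k \<le> Suc s" "s + a + b < k + l"
  shows "cross k l (Y (Suc s) a b x) = Y s a b (cross k l x)"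
  using assms
proof (induction "Suc s" a b x rule: Y.induct)
  case (3 a b x)
  have "cross k l (cross (Suc s + Suc a) b' x) = cross (s + Suc a) b' (cross k l x)" if "b' \<le> Suc b" for b'
    using that
  proof (induction b')
    case (Suc b')
    have "cross k l (T (Suc (s + Suc a + b')) z) = T (s + Suc a + b') (cross k l z)" for z
      by (rule cross_T_shift) (use 3 Suc in auto)
    then show ?case using Suc by simp
  qed auto
  from this[of "Suc b"]
  have c: "cross k l (cross (Suc s + Suc a) (Suc b) x) = cross (s + Suc a) (Suc b) (cross k l x)"
    by simp
  have IH: "cross k l (Y (Suc s) (Suc a) b x) = Y s (Suc a) b (cross k l x)"
    "cross k l (Y (Suc s) a (Suc b) (cross (Suc s + Suc a) (Suc b) x)) =
      Y s a (Suc b) (cross k l (cross (Suc s + Suc a) (Suc b) x))"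
    using 3 by simp_all
  show ?case
    unfolding Y.simps cross_add cross_scale IH c ..
qed auto

text \<open>Both sides are the shuffle operator of three blocks. Each is split according to the
  block that supplies the last factor: the third (\<open>e1\<close>), the second (\<open>e2\<close>,
  with \<open>c\<close> as the crossed tensor) or the first (\<open>e3\<close>, with the crossing
  running over both later blocks). The pairs of terms agree by induction on the total
  degree.\<close>

theorem Y_assoc: "Y s (k + l) m (Y s k l x) = Y s k (l + m) (Y (s + k) l m x)"
proof (induction "k + l + m" arbitrary: k l m x rule: less_induct)
  case less
  show ?case
  proof (cases "k = 0 \<or> l = 0 \<or> m = 0")
    case False
    then obtain k' l' m' where klm: "k = Suc k'" "l = Suc l'" "m = Suc m'"
      by (meson not0_implies_Suc)
    have IH: "Y s (a + b) c (Y s a b z) = Y s a (b + c) (Y (s + a) b c z)"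
      if "a + b + c < k + l + m" for a b c z using less that by blast
    have e1: "Y s k (l + m') (Y (s + k) l m' x) = Y s (k + l) m' (Y s k l x)"
      by (rule IH[symmetric]) (use klm in auto)
    have e2: "Y s (k + l') m (Y s k l' z) = Y s k (l' + m) (Y (s + k) l' m z)" for z
      by (rule IH) (use klm in auto)
    have e3: "Y s (k' + l) m (Y s k' l z) = Y s k' (l + m) (Y (s + k') l m z)" for z
      by (rule IH) (use klm in auto)
    define c where "c = cross (s + k + l) m x"
    have c1: "cross (s + k + l) m (Y s k l' z) = Y s k l' (cross (s + k + l) m z)" for z
      by (rule Y_cross_commute) (use klm in auto)
    have c2: "cross (s + k + l) m (Y s k' l z) = Y s k' l (cross (s + k + l) m z)" for z
      by (rule Y_cross_commute) (use klm in auto)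
    have c3: "cross (s + k + l) m (cross (s + k) l x) = cross (s + k) (l + m) x"
      by (rule cross_append)
    have c4: "cross (s + k) (l + m) (Y (s + k) l m x) = Y (s + k') l m (cross (s + k) (l + m) x)"
      using cross_Y_shift[of "s + k" "s + k'" l m "l + m" x] klm by simp
    have "Y s (k + l) m (Y s k l x) = fscale (q ^ (k + l)) (Y s (k + l) m' (Y s k l x)) +
        fscale ((-1) ^ m) (Y s (k' + l) m (cross (s + k + l) m (Y s k l x)))"
      using klm by (simp add: ac_simps del: cross.simps)
    also have "cross (s + k + l) m (Y s k l x) =
        fscale (q ^ k) (Y s k l' c) + fscale ((-1) ^ l) (Y s k' l (cross (s + k) (l + m) x))"
      using klm c1 c2 c3 by (simp add: c_def cross_add cross_diff cross_scale del: cross.simps)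
    also have "Y s (k' + l) m \<dots> = fscale (q ^ k) (Y s (k + l') m (Y s k l' c)) +
        fscale ((-1) ^ l) (Y s (k' + l) m (Y s k' l (cross (s + k) (l + m) x)))"
      using klm by (simp add: Y_add Y_diff Y_scale del: cross.simps Y.simps)
    finally have L: "Y s (k + l) m (Y s k l x) = fscale (q ^ (k + l)) (Y s (k + l) m' (Y s k l x)) +
       fscale ((-1) ^ m) (fscale (q ^ k) (Y s (k + l') m (Y s k l' c)) +
        fscale ((-1) ^ l) (Y s (k' + l) m (Y s k' l (cross (s + k) (l + m) x))))" .
    have "Y s k (l + m) (Y (s + k) l m x) = fscale (q ^ k) (Y s k (l' + m) (Y (s + k) l m x)) +
        fscale ((-1) ^ (l + m)) (Y s k' (l + m) (cross (s + k) (l + m) (Y (s + k) l m x)))"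
      using klm by (simp del: cross.simps)
    also have "Y s k (l' + m) (Y (s + k) l m x) = fscale (q ^ l) (Y s k (l + m') (Y (s + k) l m' x)) +
        fscale ((-1) ^ m) (Y s k (l' + m) (Y (s + k) l' m c))"
      using klm by (simp add: c_def Y_add Y_diff Y_scale del: cross.simps)
    finally show ?thesis
      unfolding L e1 e2 e3 c4
      by (simp add: fs.scale_right_distrib power_add ac_simps del: cross.simps Y.simps)
  qed (auto simp: ac_simps)
qed

section \<open>Images of \<open>T i - q\<close>, and how crossings and shuffles transport
  them\<close>

definition img :: "nat \<Rightarrow> nat \<Rightarrow> 'k tensor set" where
  "img i p = (\<lambda>y. T i y - fscale q y) ` Tp d p"

lemma imgI: "y \<in> Tp d p \<Longrightarrow> T i y - fscale q y \<in> img i p"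
  by (auto simp: img_def)

lemma imgE:
  assumes "x \<in> img i p"
  obtains y where "y \<in> Tp d p" "x = T i y - fscale q y"
  using assms by (auto simp: img_def)

lemma subspace_img: "fs.subspace (img i p)"
  unfolding fs.subspace_def
proof (intro conjI ballI allI)
  show "0 \<in> img i p" using imgI[OF Tp_0, of i p] by simp
  show "x + y \<in> img i p" if "x \<in> img i p" "y \<in> img i p" for x y
  proof -
    from that obtain a b where "a \<in> Tp d p" "b \<in> Tp d p"
      "x = T i a - fscale q a" "y = T i b - fscale q b" by (auto elim!: imgE)
    then show ?thesis using imgI[of "a + b" p i] Tp_add[of a d p b]
      by (simp add: Rop_add fs.scale_right_distrib add_diff_add)
  qed
  show "fscale c x \<in> img i p" if "x \<in> img i p" for c x
  proof -
    from that obtain a where "a \<in> Tp d p" "x = T i a - fscale q a" by (auto elim!: imgE)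
    then show ?thesis using imgI[of "fscale c a" p i] Tp_scale[of a d p c]
      by (simp add: Rop_scale fs.scale_right_diff_distrib mult.commute)
  qed
qed

lemma img_add: "x \<in> img i p \<Longrightarrow> y \<in> img i p \<Longrightarrow> x + y \<in> img i p"
  and img_scale: "x \<in> img i p \<Longrightarrow> fscale c x \<in> img i p"
  using subspace_img fs.subspace_add fs.subspace_scale by metis+

lemma Ups_iff: "x \<in> Ups d r q p \<longleftrightarrow> x \<in> Tp d p \<and> (\<forall>i. 1 \<le> i \<and> i < p \<longrightarrow> x \<in> img i p)"
proof -
  have "(\<lambda>w. T i y w - q * y w) = T i y - fscale q y" for i y
    by (auto simp: tensor_apply)
  then show ?thesis unfolding Ups_def img_def by (auto simp: image_iff)
qed

lemma subspace_Ups: "fs.subspace (Ups d r q p)"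
proof -
  have "Ups d r q p = Tp d p \<inter> (\<Inter>i\<in>{i. 1 \<le> i \<and> i < p}. img i p)"
    by (auto simp: Ups_iff)
  then show ?thesis
    by (auto intro!: fs.subspace_Int subspace_Tp fs.subspace_inter subspace_img)
qed

lemma img_cross_commute:
  assumes "x \<in> img j p" "j + 1 < k \<or> k + l < j"
  shows "cross k l x \<in> img j p"
  using assms(1)
proof (rule imgE)
  fix y assume "y \<in> Tp d p" "x = T j y - fscale q y"
  then show ?thesis
    using imgI[of "cross k l y" p j] T_cross_commute[OF assms(2), of y] cross_in_Tp
    by (simp add: cross_diff cross_scale)
qed

lemma img_cross_shift:
  assumes "x \<in> img (Suc j) p" "k \<le> j" "Suc j < k + l"
  shows "cross k l x \<in> img j p"
  using assms(1)
proof (rule imgE)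
  fix y assume "y \<in> Tp d p" "x = T (Suc j) y - fscale q y"
  then show ?thesis
    using imgI[of "cross k l y" p j] cross_T_shift[OF assms(2,3), of y] cross_in_Tp
    by (simp add: cross_diff cross_scale)
qed

text \<open>Two neighbouring factors travel together past \<open>l\<close> others, so the operator
  between them travels along from index \<open>k\<close> to \<open>k + l\<close>.\<close>

lemma cross_cross_T:
  "cross k l (cross (Suc k) l (T k x)) = T (k + l) (cross k l (cross (Suc k) l x))"
proof (induction l)
  case (Suc l)
  have "cross k (Suc l) (cross (Suc k) (Suc l) y) = T (k + l) (T (Suc (k + l)) (cross k l (cross (Suc k) l y)))" for y
    using T_cross_commute[of "Suc (k + l)" k l] by simp
  then show ?case using Suc T_braid[of "k + l"] by simp
qed simp

lemma img_cross_cross: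
  assumes "x \<in> img k p"
  shows "cross k l (cross (Suc k) l x) \<in> img (k + l) p"
  using assms
proof (rule imgE)
  fix y assume "y \<in> Tp d p" "x = T k y - fscale q y"
  then show ?thesis
    using imgI[of "cross k l (cross (Suc k) l y)" p "k + l"] cross_in_Tp
    by (simp add: cross_diff cross_scale cross_cross_T)
qed

lemma img_Y_commute:
  assumes "x \<in> img j p" "s + k + l < j"
  shows "Y s k l x \<in> img j p"
  using assms(1)
proof (rule imgE)
  fix y assume "y \<in> Tp d p" "x = T j y - fscale q y"
  then show ?thesis
    using imgI[of "Y s k l y" p j] Y_T_commute[of j s k l y] Y_in_Tp assms
    by (simp add: Y_diff Y_scale)
qed

text \<open>For the last index \<open>i = k + l - 1\<close> the recursion is applied twice; its two mixed terms
  combine to a multiple of \<open>T\<^sub>i - q\<close>.\<close>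

lemma Y_img:
  assumes "x \<in> Tp d p" "k + l \<le> p"
    and "\<And>i. 1 \<le> i \<Longrightarrow> i < k + l \<Longrightarrow> i \<noteq> k \<Longrightarrow> x \<in> img i p"
    and "1 \<le> i" "i < k + l"
  shows "Y 0 k l x \<in> img i p"
  using assms
proof (induction "k + l" arbitrary: k l x i rule: less_induct)
  case less
  show ?case
  proof (cases "k = 0 \<or> l = 0")
    case True
    then show ?thesis using less.prems by auto
  next
    case False
    then obtain k' l' where kl: "k = Suc k'" "l = Suc l'"
      by (meson not0_implies_Suc)
    have IH: "Y 0 a b z \<in> img j p"
      if "a + b < k + l" "z \<in> Tp d p" "\<And>i. 1 \<le> i \<Longrightarrow> i < a + b \<Longrightarrow> i \<noteq> a \<Longrightarrow> z \<in> img i p"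
        "1 \<le> j" "j < a + b" for a b z j
      using less.hyps[of a b z j] that less.prems(2) by auto
    \<comment> \<open>The last factor of the first block has left: conditions before it stay, later
      ones move down by one, and the exceptional index drops from \<open>k\<close> to
      \<open>k'\<close>.\<close>
    have cx: "cross k l x \<in> img j p" if "1 \<le> j" "j < k' + l" "j \<noteq> k'" for j
    proof (cases "j < k'")
      case True
      then show ?thesis using that less.prems(3)[of j] kl by (intro img_cross_commute) auto
    next
      case False
      then show ?thesis using that less.prems(3)[of "Suc j"] kl by (intro img_cross_shift) auto
    qed
    show ?thesis
    proof (cases "Suc i = k + l")
      case False
      have "Y 0 k l' x \<in> img i p"
        by (rule IH) (use less.prems kl False in auto)
      moreover have "Y 0 k' l (cross k l x) \<in> img i p"
        by (rule IH) (use less.prems kl False cx in \<open>auto intro: cross_in_Tp simp del: cross.simps\<close>)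
      ultimately show ?thesis unfolding kl Y.simps using kl
        by (intro img_add img_scale) (simp_all del: cross.simps)
    next
      case True
      then have i: "i = k' + l" "i = k + l'" using kl by auto
      \<comment> \<open>\<open>A\<close> and \<open>B\<close> collect the shuffles whose last two
        factors come both from the second or both from the first block; 0 stands for the absence of
        such shuffles when that block has only one factor.\<close>
      define A where "A = (if l' = 0 then 0 else Y 0 k (l' - 1) x)"
      define B where "B = (if k' = 0 then 0 else Y 0 (k' - 1) l (cross k' l (cross k l x)))"
      have 1: "Y 0 k l' x = fscale (q ^ k) A + fscale ((-1) ^ l') (Y 0 k' l' (cross k l' x))"
        unfolding A_def kl by (cases l') auto
      have 2: "Y 0 k' l z = fscale (q ^ k') (Y 0 k' l' z) +
          (if k' = 0 then 0 else fscale ((-1) ^ l) (Y 0 (k' - 1) l (cross k' l z)))" for z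
        unfolding kl by (cases k') (auto simp del: cross.simps)
      have "A \<in> img i p"
        unfolding A_def using less.prems(3)[of i] less.prems kl i img_Y_commute[of x i p 0 k "l' - 1"]
          fs.subspace_0[OF subspace_img] by auto
      moreover have "B \<in> img i p"
      proof (cases "k' = 0")
        case False
        have "cross k' l (cross k l x) \<in> img i p"
          unfolding i(1) kl(1)
          by (rule img_cross_cross) (use less.prems(3)[of k'] kl False in auto)
        then show ?thesis using False img_Y_commute[of _ i p 0 "k' - 1" l] i
          unfolding B_def by auto
      qed (auto simp: B_def fs.subspace_0[OF subspace_img])
      moreover have "Y 0 k' l' (T i (cross k l' x) - fscale q (cross k l' x)) \<in> img i p"
        by (rule img_Y_commute) (use i kl less.prems in \<open>auto intro!: imgI cross_in_Tp\<close>)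
      \<comment> \<open>The mixed terms carry the coefficients \<open>(-1) ^ l' * q ^ k\<close> and,
        in front of \<open>T i\<close>, \<open>(-1) ^ l * q ^ k'\<close>; their ratio is
        \<open>-q\<close>, which is how the factor \<open>T i - q\<close> arises.\<close>
      moreover have "Y 0 k l x = fscale (q ^ k) (fscale (q ^ k) A) +
          fscale ((-1) ^ l * q ^ k') (Y 0 k' l' (T i (cross k l' x) - fscale q (cross k l' x))) +
          fscale ((-1) ^ l) (fscale ((-1) ^ l) B)"
      proof -
        have "Y 0 k l x = fscale (q ^ k) (Y 0 k l' x) + fscale ((-1) ^ l) (Y 0 k' l (cross k l x))"
          unfolding kl by simp
        also have "Y 0 k' l (cross k l x) = fscale (q ^ k') (Y 0 k' l' (cross k l x)) + fscale ((-1) ^ l) B"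
          unfolding 2 B_def by auto
        also have "cross k l x = T i (cross k l' x)" unfolding i by (simp add: kl)
        finally show ?thesis
          unfolding 1 by (simp add: Y_diff Y_scale kl fun_eq_iff tensor_apply algebra_simps)
      qed
      ultimately show ?thesis by (metis img_add img_scale)
    qed
  qed
qed

end

section \<open>Tensor products and slices\<close>

lemma tmul_append:
  assumes "a \<in> Tp d k" "length u = k"
  shows "tmul a b (u @ v) = a u * b v"
proof -
  have "tmul a b (u @ v) = (\<Sum>j\<le>length (u @ v). if j = k then a u * b v else 0)"
    unfolding tmul_def
  proof (rule sum.cong[OF refl])
    fix j assume "j \<in> {..length (u @ v)}"
    moreover have "a (take j (u @ v)) = 0" if "j \<noteq> k" "j \<le> length (u @ v)"
      using assms that by (intro Tp_outside[OF assms(1)]) (auto simp: words_def)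
    ultimately show "a (take j (u @ v)) * b (drop j (u @ v)) = (if j = k then a u * b v else 0)"
      using assms by auto
  qed
  then show ?thesis using assms by simp
qed

lemma tmul_short:
  assumes "a \<in> Tp d k" "length w < k"
  shows "tmul a b w = 0"
  unfolding tmul_def
  by (rule sum.neutral) (use assms in \<open>auto simp: in_Tp_iff words_def\<close>)

lemma tmul_eval:
  assumes "a \<in> Tp d k"
  shows "tmul a b w = (if k \<le> length w then a (take k w) * b (drop k w) else 0)"
  using tmul_append[OF assms, of "take k w" b "drop k w"] tmul_short[OF assms, of w b] by auto

lemma tmul_in_Tp:
  assumes "a \<in> Tp d k" "b \<in> Tp d l"
  shows "tmul a b \<in> Tp d (k + l)"
  unfolding in_Tp_iff
proof (intro allI impI)
  fix w assume w: "w \<notin> words d (k + l)"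
  show "tmul a b w = 0"
  proof (cases "k \<le> length w")
    case True
    then have "take k w \<notin> words d k \<or> drop k w \<notin> words d l"
      using w words_append_iff[of "take k w" k "drop k w" d l] by auto
    then show ?thesis using assms by (auto simp: tmul_eval[OF assms(1)] Tp_outside)
  qed (simp add: tmul_short[OF assms(1)])
qed

lemma tmul_add_left: "tmul (a + b) c = tmul a c + tmul b c"
  and tmul_add_right: "tmul a (b + c) = tmul a b + tmul a c"
  and tmul_diff_left: "tmul (a - b) c = tmul a c - tmul b c"
  and tmul_diff_right: "tmul a (b - c) = tmul a b - tmul a c"
  and tmul_scale_left: "tmul (fscale s a) b = fscale s (tmul a b)"
  and tmul_scale_right: "tmul a (fscale s b) = fscale s (tmul a b)"
  and tmul_zero_left [simp]: "tmul 0 b = 0"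
  and tmul_zero_right [simp]: "tmul a 0 = 0"
  by (auto simp: fun_eq_iff tmul_def tensor_apply algebra_simps sum.distrib sum_subtractf sum_distrib_left)

lemma tmul_sum_left: "tmul (\<Sum>i\<in>A. f i) b = (\<Sum>i\<in>A. tmul (f i) b)"
  by (induction A rule: infinite_finite_induct) (auto simp: tmul_add_left)

lemma tmul_sum_right: "tmul a (\<Sum>i\<in>A. f i) = (\<Sum>i\<in>A. tmul a (f i))"
  by (induction A rule: infinite_finite_induct) (auto simp: tmul_add_right)

lemma sum_triangle:
  fixes f :: "nat \<Rightarrow> nat \<Rightarrow> 'a::comm_monoid_add"
  shows "(\<Sum>s\<le>p. \<Sum>k\<le>s. f k (s - k)) = (\<Sum>k\<le>p. \<Sum>l\<le>p - k. f k l)"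
proof -
  have "(\<Sum>s\<le>p. \<Sum>k\<le>s. f k (s - k)) = (\<Sum>(i, j)\<in>{(i, j). i + j \<le> p}. f i j)"
    by (simp add: sum.triangle_reindex_eq)
  also have "{(i, j). i + j \<le> p} = (SIGMA i:{..p}. {..p - i})"
    by auto
  also have "(\<Sum>(i, j)\<in>\<dots>. f i j) = (\<Sum>k\<le>p. \<Sum>l\<le>p - k. f k l)"
    by (simp add: sum.Sigma)
  finally show ?thesis .
qed

lemma tmul_assoc: "tmul (tmul a b) c = tmul a (tmul b c)"
proof
  fix w :: "nat list"
  let ?f = "\<lambda>i j. a (take i w) * (b (take j (drop i w)) * c (drop (i + j) w))"
  have "tmul (tmul a b) c w = (\<Sum>k\<le>length w. \<Sum>i\<le>k. ?f i (k - i))"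
    unfolding tmul_def sum_distrib_right
  proof (intro sum.cong refl)
    fix k i assume "k \<in> {..length w}" "i \<in> {..k}"
    then show "a (take i (take k w)) * b (drop i (take k w)) * c (drop k w) = ?f i (k - i)"
      by (simp add: drop_take min_absorb1 mult.assoc)
  qed auto
  also have "\<dots> = (\<Sum>i\<le>length w. \<Sum>j\<le>length w - i. ?f i j)"
    by (rule sum_triangle)
  also have "\<dots> = tmul a (tmul b c) w"
    unfolding tmul_def sum_distrib_left by (simp add: add.commute)
  finally show "tmul (tmul a b) c w = tmul a (tmul b c) w" .
qed

lemma tone_in_Tp: "tone \<in> Tp d 0"
  by (auto simp: tone_def in_Tp_iff words_def)

lemma tmul_tone_left [simp]: "tmul tone a = a"
  by (simp add: fun_eq_iff tmul_eval[OF tone_in_Tp]) (simp add: tone_def)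

lemma tmul_tone_right [simp]: "tmul a tone = a"
proof
  fix w
  have "tmul a tone w = (\<Sum>k\<le>length w. if k = length w then a w else 0)"
    unfolding tmul_def tone_def by (intro sum.cong) auto
  then show "tmul a tone w = a w" by simp
qed

text \<open>Contraction of the first letters against a dual basis word; \<open>rsl\<close> does the
  same at the end. A tensor is determined by its slices of a fixed length, and slicing respects the
  defining conditions of \<open>\<Upsilon>\<close>, so slices take the place of tensor product
  decompositions.\<close>

definition lsl :: "nat list \<Rightarrow> ('k::field) tensor \<Rightarrow> 'k tensor" where
  "lsl u x = (\<lambda>w. x (u @ w))"

definition rsl :: "nat list \<Rightarrow> ('k::field) tensor \<Rightarrow> 'k tensor" where
  "rsl v x = (\<lambda>w. x (w @ v))"

lemma lsl_apply: "lsl u x w = x (u @ w)" and rsl_apply: "rsl v x w = x (w @ v)"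
  by (simp_all add: lsl_def rsl_def)

lemma lsl_in_Tp: "x \<in> Tp d (k + l) \<Longrightarrow> length u = k \<Longrightarrow> lsl u x \<in> Tp d l"
  by (auto simp: in_Tp_iff lsl_def words_append_iff)

lemma rsl_in_Tp: "x \<in> Tp d (k + l) \<Longrightarrow> length v = l \<Longrightarrow> rsl v x \<in> Tp d k"
  unfolding in_Tp_iff rsl_def words_def by auto

lemma lsl_diff: "lsl u (x - y) = lsl u x - lsl u y"
  and lsl_scale: "lsl u (fscale c x) = fscale c (lsl u x)"
  and lsl_add: "lsl u (x + y) = lsl u x + lsl u y"
  and rsl_diff: "rsl u (x - y) = rsl u x - rsl u y"
  and rsl_scale: "rsl u (fscale c x) = fscale c (rsl u x)"
  by (auto simp: lsl_def rsl_def fun_eq_iff tensor_apply)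

lemma lsl_eq_0: "x \<in> Tp d p \<Longrightarrow> \<not> set u \<subseteq> {..<d} \<Longrightarrow> lsl u x = 0"
  and rsl_eq_0: "x \<in> Tp d p \<Longrightarrow> \<not> set u \<subseteq> {..<d} \<Longrightarrow> rsl u x = 0"
  by (auto simp: lsl_def rsl_def in_Tp_iff words_def fun_eq_iff tensor_apply)

lemma tensor_eqI_lsl:
  assumes "x \<in> Tp d (k + l)" "y \<in> Tp d (k + l)"
    and "\<And>u. u \<in> words d k \<Longrightarrow> lsl u x = lsl u y"
  shows "x = y"
proof (rule Tp_eqI[OF assms(1,2)])
  fix w assume "w \<in> words d (k + l)"
  then have "take k w \<in> words d k"
    using words_append_iff[of "take k w" k "drop k w" d l] by (auto simp: words_def)
  from fun_cong[OF assms(3)[OF this], of "drop k w"] show "x w = y w"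
    by (simp add: lsl_apply)
qed

lemma tensor_eqI_rsl:
  assumes "x \<in> Tp d (k + l)" "y \<in> Tp d (k + l)"
    and "\<And>v. v \<in> words d l \<Longrightarrow> rsl v x = rsl v y"
  shows "x = y"
proof (rule Tp_eqI[OF assms(1,2)])
  fix w assume "w \<in> words d (k + l)"
  then have "drop k w \<in> words d l"
    using words_append_iff[of "take k w" k "drop k w" d l] by (auto simp: words_def)
  from fun_cong[OF assms(3)[OF this], of "take k w"] show "x w = y w"
    by (simp add: rsl_apply)
qed

lemma lsl_tmul: "a \<in> Tp d k \<Longrightarrow> length u = k \<Longrightarrow> lsl u (tmul a b) = fscale (a u) b"
  by (auto simp: fun_eq_iff lsl_apply tensor_apply tmul_append)

lemma rsl_tmul:
  assumes "a \<in> Tp d k" "b \<in> Tp d l" "length v = l"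
  shows "rsl v (tmul a b) = fscale (b v) a"
proof (rule Tp_eqI[of _ d k])
  fix w assume "w \<in> words d k"
  then show "rsl v (tmul a b) w = fscale (b v) a w"
    using assms by (simp add: rsl_apply tensor_apply tmul_append words_def mult.commute)
qed (use assms in \<open>auto intro: rsl_in_Tp tmul_in_Tp Tp_scale\<close>)

lemma tmul_lsl_expand:
  assumes "x \<in> Tp d (k + l)"
  shows "x = (\<Sum>u\<in>words d k. tmul (unit_tensor u) (lsl u x))"
proof (rule tensor_eqI_lsl[OF assms])
  show "(\<Sum>u\<in>words d k. tmul (unit_tensor u) (lsl u x)) \<in> Tp d (k + l)"
    using assms by (auto intro!: Tp_sum tmul_in_Tp unit_tensor_in_Tp lsl_in_Tp simp: words_def)
  fix u assume u: "u \<in> words d k"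
  show "lsl u x = lsl u (\<Sum>u\<in>words d k. tmul (unit_tensor u) (lsl u x))"
  proof
    fix w
    have "lsl u (\<Sum>u\<in>words d k. tmul (unit_tensor u) (lsl u x)) w =
        (\<Sum>u'\<in>words d k. (if u' = u then 1 else 0) * lsl u' x w)"
      unfolding lsl_apply[of u] sum_tensor_apply
    proof (intro sum.cong refl)
      fix u' assume "u' \<in> words d k"
      then have "tmul (unit_tensor u') (lsl u' x) (u @ w) = unit_tensor u' u * lsl u' x w"
        using u by (intro tmul_append[OF unit_tensor_in_Tp[of u' d k]]) (auto simp: words_def)
      then show "tmul (unit_tensor u') (lsl u' x) (u @ w) = (if u' = u then 1 else 0) * lsl u' x w"
        by (simp add: unit_tensor_def)
    qed
    then show "lsl u x w = lsl u (\<Sum>u\<in>words d k. tmul (unit_tensor u) (lsl u x)) w"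
      using u by (simp add: if_distrib[of "\<lambda>z. z * _"] sum.delta cong: if_cong)
  qed
qed

lemma tmul_rsl_expand:
  assumes "x \<in> Tp d (k + l)"
  shows "x = (\<Sum>v\<in>words d l. tmul (rsl v x) (unit_tensor v))"
proof (rule tensor_eqI_rsl[OF assms])
  show "(\<Sum>v\<in>words d l. tmul (rsl v x) (unit_tensor v)) \<in> Tp d (k + l)"
    using assms by (auto intro!: Tp_sum tmul_in_Tp unit_tensor_in_Tp rsl_in_Tp simp: words_def)
  fix v assume v: "v \<in> words d l"
  show "rsl v x = rsl v (\<Sum>v\<in>words d l. tmul (rsl v x) (unit_tensor v))"
  proof
    fix w
    have "rsl v (\<Sum>v\<in>words d l. tmul (rsl v x) (unit_tensor v)) w =
        (\<Sum>v'\<in>words d l. rsl v (tmul (rsl v' x) (unit_tensor v')) w)"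
      unfolding rsl_apply[of v] sum_tensor_apply ..
    also have "\<dots> = (\<Sum>v'\<in>words d l. (if v' = v then 1 else 0) * rsl v' x w)"
    proof (rule sum.cong[OF refl])
      fix v' assume v': "v' \<in> words d l"
      have "rsl v (tmul (rsl v' x) (unit_tensor v')) = fscale (unit_tensor v' v) (rsl v' x)"
        by (rule rsl_tmul[of _ d k _ l]) (use assms v v' in \<open>auto intro: unit_tensor_in_Tp rsl_in_Tp simp: words_def\<close>)
      then show "rsl v (tmul (rsl v' x) (unit_tensor v')) w = (if v' = v then 1 else 0) * rsl v' x w"
        by (simp add: tensor_apply unit_tensor_def)
    qed
    finally show "rsl v x w = rsl v (\<Sum>v\<in>words d l. tmul (rsl v x) (unit_tensor v)) w"
      using v by (simp add: if_distrib[of "\<lambda>z. z * _"] sum.delta cong: if_cong)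
  qed
qed

section \<open>Compatibility of the operators with products and slices\<close>

context hecke_symmetry begin

lemma T_lsl:
  assumes "set u \<subseteq> {..<d}" "1 \<le> i"
  shows "T i (lsl u x) = lsl u (T (length u + i) x)"
proof
  fix w
  show "T i (lsl u x) w = lsl u (T (length u + i) x) w"
  proof (cases "i < length w")
    case True
    then show ?thesis using Rop_sandwich[of u d "[]" i w r x] assms by (simp add: lsl_def)
  qed (simp add: Rop_outside lsl_apply)
qed

text \<open>Homogeneity is essential here, unlike for \<open>T_lsl\<close>: on a word too short for
  the index \<open>i\<close> the left side vanishes, but on the right the appended \<open>v\<close>
  could supply the missing letters.\<close>

lemma T_rsl:
  assumes "set v \<subseteq> {..<d}" "x \<in> Tp d (k + length v)" "i < k"
  shows "T i (rsl v x) = rsl v (T i x)"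
proof (rule Tp_eqI[of _ d k])
  fix w assume "w \<in> words d k"
  then show "T i (rsl v x) w = rsl v (T i x) w"
    using Rop_sandwich[of "[]" d v i w r x] assms
    by (cases i) (auto simp: rsl_def words_def tensor_apply)
qed (use assms in \<open>auto intro: rsl_in_Tp Rop_in_Tp\<close>)

lemma T_tmul_right:
  assumes "a \<in> Tp d k" "b \<in> Tp d l" "1 \<le> i"
  shows "T (k + i) (tmul a b) = tmul a (T i b)"
proof (rule tensor_eqI_lsl[of _ d k l])
  fix u assume "u \<in> words d k"
  then have u: "set u \<subseteq> {..<d}" "length u = k" by (auto simp: words_def)
  show "lsl u (T (k + i) (tmul a b)) = lsl u (tmul a (T i b))"
    using T_lsl[OF u(1) assms(3), of "tmul a b"]
    by (simp add: lsl_tmul[OF assms(1) u(2)] u(2) Rop_scale)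
qed (use assms in \<open>auto intro: Rop_in_Tp tmul_in_Tp\<close>)

lemma T_tmul_left:
  assumes "a \<in> Tp d k" "b \<in> Tp d l" "i < k"
  shows "T i (tmul a b) = tmul (T i a) b"
proof (rule tensor_eqI_rsl[of _ d k l])
  fix v assume "v \<in> words d l"
  then have v: "set v \<subseteq> {..<d}" "length v = l" by (auto simp: words_def)
  have "rsl v (T i (tmul a b)) = T i (rsl v (tmul a b))"
    by (rule T_rsl[symmetric, of _ _ k]) (use assms v in \<open>auto intro: tmul_in_Tp\<close>)
  then show "rsl v (T i (tmul a b)) = rsl v (tmul (T i a) b)"
    using rsl_tmul[OF assms(1,2) v(2)] rsl_tmul[OF Rop_in_Tp[OF assms(1)] assms(2) v(2)]
    by (simp add: Rop_scale)
qed (use assms in \<open>auto intro: Rop_in_Tp tmul_in_Tp\<close>)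

lemma cross_tmul_right:
  assumes "a \<in> Tp d p" "b \<in> Tp d p'" "1 \<le> k"
  shows "cross (p + k) l (tmul a b) = tmul a (cross k l b)"
proof (induction l)
  case (Suc l)
  have "T (p + (k + l)) (tmul a (cross k l b)) = tmul a (T (k + l) (cross k l b))"
    by (rule T_tmul_right[OF assms(1) cross_in_Tp]) (use assms in auto)
  then show ?case using Suc by (simp add: add.assoc)
qed simp

lemma cross_tmul_left:
  assumes "a \<in> Tp d p" "b \<in> Tp d p'" "k + l \<le> p"
  shows "cross k l (tmul a b) = tmul (cross k l a) b"
  using assms(3)
proof (induction l)
  case (Suc l)
  have "T (k + l) (tmul (cross k l a) b) = tmul (T (k + l) (cross k l a)) b"
    by (rule T_tmul_left[OF cross_in_Tp]) (use assms Suc in auto)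
  then show ?case using Suc by simp
qed simp

lemma Y_tmul_right:
  assumes "a \<in> Tp d p" "b \<in> Tp d p'"
  shows "Y (p + s) k l (tmul a b) = tmul a (Y s k l b)"
  using assms(2)
proof (induction s k l b rule: Y.induct)
  case (3 s k l b)
  have c: "cross (p + s + Suc k) (Suc l) (tmul a b) = tmul a (cross (s + Suc k) (Suc l) b)"
    using cross_tmul_right[OF assms(1) 3(3), of "s + Suc k" "Suc l"] by (simp add: add.assoc del: cross.simps)
  show ?case
    unfolding Y.simps c 3(1)[OF 3(3)] 3(2)[OF cross_in_Tp[OF 3(3)]]
    by (simp add: tmul_add_right tmul_scale_right tmul_diff_right del: cross.simps)
qed auto

lemma Y_tmul_left:
  assumes "a \<in> Tp d p" "b \<in> Tp d p'" "s + k + l \<le> p"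
  shows "Y s k l (tmul a b) = tmul (Y s k l a) b"
  using assms(1,3)
proof (induction s k l a rule: Y.induct)
  case (3 s k l a)
  have c: "cross (s + Suc k) (Suc l) (tmul a b) = tmul (cross (s + Suc k) (Suc l) a) b"
    by (rule cross_tmul_left[OF 3(3) assms(2)]) (use 3 in auto)
  have "Y s (Suc k) l (tmul a b) = tmul (Y s (Suc k) l a) b"
    "Y s k (Suc l) (tmul (cross (s + Suc k) (Suc l) a) b) = tmul (Y s k (Suc l) (cross (s + Suc k) (Suc l) a)) b"
    using 3 by (auto intro!: 3 cross_in_Tp simp del: cross.simps)
  then show ?case
    unfolding Y.simps c
    by (simp add: tmul_add_left tmul_scale_left tmul_diff_left del: cross.simps)
qed auto

lemma img_rsl:
  assumes "x \<in> img i (k + l)" "v \<in> words d l" "i < k"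
  shows "rsl v x \<in> img i k"
  using assms(1)
proof (rule imgE)
  fix y assume y: "y \<in> Tp d (k + l)" "x = T i y - fscale q y"
  have "T i (rsl v y) = rsl v (T i y)"
    by (rule T_rsl[of _ _ k]) (use assms y in \<open>auto simp: words_def\<close>)
  then show ?thesis
    using imgI[of "rsl v y" k i] rsl_in_Tp[OF y(1)] assms(2) y(2)
    by (simp add: rsl_diff rsl_scale words_def)
qed

lemma img_lsl:
  assumes "x \<in> img (k + i) (k + l)" "u \<in> words d k" "1 \<le> i"
  shows "lsl u x \<in> img i l"
  using assms(1)
proof (rule imgE)
  fix y assume y: "y \<in> Tp d (k + l)" "x = T (k + i) y - fscale q y"
  have "T i (lsl u y) = lsl u (T (k + i) y)"
    using T_lsl[of u i y] assms by (auto simp: words_def)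
  then show ?thesis
    using imgI[of "lsl u y" l i] lsl_in_Tp[OF y(1)] assms(2) y(2)
    by (simp add: lsl_diff lsl_scale words_def)
qed

lemma img_tmul_left:
  assumes "a \<in> img i k" "b \<in> Tp d l" "i < k"
  shows "tmul a b \<in> img i (k + l)"
  using assms(1)
proof (rule imgE)
  fix y assume y: "y \<in> Tp d k" "a = T i y - fscale q y"
  then show ?thesis
    using imgI[of "tmul y b" "k + l" i] tmul_in_Tp[OF y(1) assms(2)] T_tmul_left[OF y(1) assms(2,3)]
    by (simp add: tmul_diff_left tmul_scale_left)
qed

lemma img_tmul_right:
  assumes "b \<in> img i l" "a \<in> Tp d k" "1 \<le> i"
  shows "tmul a b \<in> img (k + i) (k + l)"
  using assms(1)
proof (rule imgE)
  fix y assume y: "y \<in> Tp d l" "b = T i y - fscale q y"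
  then show ?thesis
    using imgI[of "tmul a y" "k + l" "k + i"] tmul_in_Tp[OF assms(2) y(1)] T_tmul_right[OF assms(2) y(1) assms(3)]
    by (simp add: tmul_diff_right tmul_scale_right)
qed

section \<open>Slices and products in the components of \<open>\<Upsilon>\<close>\<close>

abbreviation U :: "nat \<Rightarrow> 'k tensor set" where
  "U \<equiv> Ups d r q"

lemma U_Tp: "x \<in> U p \<Longrightarrow> x \<in> Tp d p"
  by (simp add: Ups_iff)

lemma U_0: "0 \<in> U p"
  and U_add: "x \<in> U p \<Longrightarrow> y \<in> U p \<Longrightarrow> x + y \<in> U p"
  and U_scale: "x \<in> U p \<Longrightarrow> fscale c x \<in> U p"
  using subspace_Ups[of p] fs.subspace_0 fs.subspace_add fs.subspace_scale by metis+

text \<open>Only the conditions inside the first \<open>k\<close> factors are asked for, so that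
  this also applies to a shuffled \<open>tmul a \<omega>\<close>, which need not satisfy the
  conditions further right.\<close>

lemma rsl_in_U:
  assumes "x \<in> Tp d (k + l)" "\<And>i. 1 \<le> i \<Longrightarrow> i < k \<Longrightarrow> x \<in> img i (k + l)" "length v = l"
  shows "rsl v x \<in> U k"
proof (cases "set v \<subseteq> {..<d}")
  case True
  then show ?thesis
    using assms by (auto simp: Ups_iff words_def intro!: img_rsl rsl_in_Tp)
next
  case False
  then show ?thesis using rsl_eq_0[OF assms(1)] U_0 by simp
qed

lemma lsl_in_U:
  assumes "x \<in> Tp d (k + l)" "\<And>i. 1 \<le> i \<Longrightarrow> i < l \<Longrightarrow> x \<in> img (k + i) (k + l)" "length u = k"
  shows "lsl u x \<in> U l"
proof (cases "set u \<subseteq> {..<d}")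
  case True
  then show ?thesis
    using assms by (auto simp: Ups_iff words_def intro!: img_lsl[of _ k] lsl_in_Tp)
next
  case False
  then show ?thesis using lsl_eq_0[OF assms(1)] U_0 by simp
qed

lemma U_rsl: "x \<in> U (k + l) \<Longrightarrow> length v = l \<Longrightarrow> rsl v x \<in> U k"
  and U_lsl: "x \<in> U (k + l) \<Longrightarrow> length u = k \<Longrightarrow> lsl u x \<in> U l"
  by (rule rsl_in_U[of x k l v]; simp add: Ups_iff) (rule lsl_in_U[of x k l u]; simp add: Ups_iff)

text \<open>Only the seam index \<open>k\<close> is missing, which is exactly the hypothesis of
  \<open>Y_img\<close>.\<close>

lemma tmul_U_img:
  assumes "a \<in> U k" "b \<in> U l" "1 \<le> i" "i < k + l" "i \<noteq> k"
  shows "tmul a b \<in> img i (k + l)"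
proof (cases "i < k")
  case True
  then show ?thesis using assms by (auto intro!: img_tmul_left simp: Ups_iff)
next
  case False
  then show ?thesis using assms img_tmul_right[of b "i - k" l a k] by (auto simp: Ups_iff)
qed

lemma Y_in_U:
  assumes "a \<in> U k" "b \<in> U l"
  shows "Y 0 k l (tmul a b) \<in> U (k + l)"
  unfolding Ups_iff using assms
  by (auto intro!: Y_img Y_in_Tp tmul_in_Tp tmul_U_img simp: Ups_iff[of _ k] Ups_iff[of _ l])

end

section \<open>Reduced words and shuffles\<close>

lemma perm_of_word_simps [simp]:
  "perm_of_word [] = id"
  "perm_of_word (i # ws) = tau i \<circ> perm_of_word ws"
  "perm_of_word (us @ ws) = perm_of_word us \<circ> perm_of_word ws"
proof -
  show "perm_of_word [] = id" "perm_of_word (i # ws) = tau i \<circ> perm_of_word ws" for i ws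
    by (simp_all add: perm_of_word_def)
  then show "perm_of_word (us @ ws) = perm_of_word us \<circ> perm_of_word ws"
    by (induction us) (simp_all add: comp_assoc)
qed

lemma tau_tau [simp]: "tau i (tau i x) = x"
  by (simp add: tau_def)

lemma bij_perm_of_word: "bij (perm_of_word ws)"
proof (induction ws)
  case (Cons i ws)
  have "bij (tau i)" by (rule o_bij[of "tau i"]) (auto simp: fun_eq_iff)
  then show ?case unfolding perm_of_word_simps using Cons by (rule bij_comp[rotated])
qed (simp only: perm_of_word_simps bij_id)

lemma perm_of_word_fixes:
  assumes "set ws \<subseteq> {1..m}" "Suc m < x"
  shows "perm_of_word ws x = x"
  using assms(1) by (induction ws) (use assms(2) in \<open>auto simp: tau_def\<close>)

lemma perm_of_word_rev_upt:
  "perm_of_word (rev [j..<j + l]) x = (if x = j then j + l else if j < x \<and> x \<le> j + l then x - 1 else x)"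
proof (induction l)
  case (Suc l)
  have "[j..<j + Suc l] = [j..<j + l] @ [j + l]" by simp
  then have "perm_of_word (rev [j..<j + Suc l]) x = tau (j + l) (perm_of_word (rev [j..<j + l]) x)"
    by (simp only: rev_append rev.simps perm_of_word_simps append_Nil append_Cons o_def)
  then show ?case unfolding Suc by (auto simp: tau_def)
qed simp

lemma perm_of_word_rev_upt':
  assumes "j \<le> n"
  shows "perm_of_word (rev [j..<n]) x = (if x = j then n else if j < x \<and> x \<le> n then x - 1 else x)"
  using perm_of_word_rev_upt[of j "n - j" x] assms by simp

lemma perm_cycle_tau_commute:
  assumes "i + 1 < j" "j \<le> n"
  shows "perm_of_word (rev [j..<n]) \<circ> tau i = tau i \<circ> perm_of_word (rev [j..<n])"
  using assms by (auto simp: fun_eq_iff perm_of_word_rev_upt' tau_def)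

lemma perm_cycle_tau_shift:
  assumes "j \<le> i" "Suc i < n"
  shows "perm_of_word (rev [j..<n]) \<circ> tau (Suc i) = tau i \<circ> perm_of_word (rev [j..<n])"
  using assms by (auto simp: fun_eq_iff perm_of_word_rev_upt' tau_def)

text \<open>Canonical reduced words for the permutations of \<open>{1..m + 1}\<close>: the suffix is the
  cycle that moves the preimage of \<open>m + 1\<close> to its place.\<close>

fun canon :: "nat \<Rightarrow> nat list set" where
  "canon 0 = {[]}"
| "canon (Suc m) = {w @ rev [j..<m + 2] | w j. w \<in> canon m \<and> 1 \<le> j \<and> j \<le> m + 2}"

lemma canon_letters: "u \<in> canon m \<Longrightarrow> set u \<subseteq> {1..m}"
proof (induction m arbitrary: u)
  case (Suc m)
  from Suc.prems obtain w j where w: "u = w @ rev [j..<m + 2]" "w \<in> canon m" "1 \<le> j"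
    by auto
  with Suc.IH[of w] show ?case by (auto simp del: upt_Suc)
qed simp

lemma canon_mono: "canon m \<subseteq> canon (Suc m)"
proof
  fix w assume "w \<in> canon m"
  moreover have "w = w @ rev [m + 2..<m + 2]" by simp
  ultimately show "w \<in> canon (Suc m)" unfolding canon.simps mem_Collect_eq
    by (intro exI[of _ w] exI[of _ "m + 2"]) (simp del: upt_Suc)
qed

lemma Nil_in_canon: "[] \<in> canon m"
proof (induction m)
  case (Suc m)
  then show ?case using canon_mono by blast
qed simp

text \<open>The preimage of the largest point gives the cycle at the end of the word; after
  cancelling it, the rest is determined by induction.\<close>

lemma inj_on_perm_canon: "inj_on perm_of_word (canon m)"
proof (induction m)
  case (Suc m)
  show ?case
  proof (rule inj_onI)
    fix u u' assume "u \<in> canon (Suc m)" "u' \<in> canon (Suc m)" and eq: "perm_of_word u = perm_of_word u'"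
    then obtain w j w' j' where u: "u = w @ rev [j..<m + 2]" "w \<in> canon m" "1 \<le> j" "j \<le> m + 2"
      and u': "u' = w' @ rev [j'..<m + 2]" "w' \<in> canon m" "1 \<le> j'" "j' \<le> m + 2"
      by auto
    have "perm_of_word u j = m + 2" "perm_of_word u' j' = m + 2"
      using u u' perm_of_word_fixes[of _ m "m + 2"] canon_letters
      by (simp_all add: perm_of_word_rev_upt' del: upt_Suc)
    then have j: "j = j'"
      using eq bij_perm_of_word[of u'] by (metis bij_is_inj injD)
    have "perm_of_word w \<circ> perm_of_word (rev [j..<m + 2]) = perm_of_word w' \<circ> perm_of_word (rev [j..<m + 2])"
      using eq u u' j by (simp del: upt_Suc)
    then have "perm_of_word w = perm_of_word w'"
      using bij_is_surj[OF bij_perm_of_word[of "rev [j..<m + 2]"]]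
      by (auto simp: fun_eq_iff surj_def simp del: upt_Suc) metis
    then show "u = u'" using Suc u u' j by (auto dest: inj_onD)
  qed
qed simp

context hecke_symmetry begin

lemma foldr_rev_upt: "foldr T (rev [k..<k + l]) x = cross k l x"
  by (induction l) auto

lemma foldr_rev_upt':
  assumes "k \<le> n"
  shows "foldr T (rev [k..<n]) x = cross k (n - k) x"
  using foldr_rev_upt[of k "n - k" x] assms by simp

text \<open>This replaces the exchange condition in the proof of Matsumoto's theorem: when the letter \<open>i\<close> is
  appended to a canonical word, either the braid relations alone turn it into a canonical word,
  or the permutation has a strictly shorter canonical word.\<close>

lemma canon_step:
  assumes "u \<in> canon m" "1 \<le> i" "i \<le> m"
  shows "\<exists>u'\<in>canon m. perm_of_word u' = perm_of_word u \<circ> tau i \<and>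
    ((length u' = Suc (length u) \<and> (\<forall>x. foldr T u (T i x) = foldr T u' x)) \<or> length u' < length u)"
  using assms
proof (induction m arbitrary: u i)
  case (Suc m)
  from Suc.prems(1) obtain w j where u: "u = w @ rev [j..<m + 2]" "w \<in> canon m" "1 \<le> j" "j \<le> m + 2"
    by auto
  let ?c = "rev [j..<m + 2]"
  have mk: ?case
    if i': "1 \<le> i'" "i' \<le> m"
      and p: "perm_of_word ?c \<circ> tau i = tau i' \<circ> perm_of_word ?c"
      and t: "\<And>x. foldr T ?c (T i x) = T i' (foldr T ?c x)" for i'
  proof -
    from Suc.IH[OF u(2) i'] obtain w' where w': "w' \<in> canon m" "perm_of_word w' = perm_of_word w \<circ> tau i'"
      "(length w' = Suc (length w) \<and> (\<forall>x. foldr T w (T i' x) = foldr T w' x)) \<or> length w' < length w"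
      by blast
    show ?thesis
    proof (intro bexI[of _ "w' @ ?c"] conjI)
      show "perm_of_word (w' @ ?c) = perm_of_word u \<circ> tau i"
        unfolding u(1) perm_of_word_simps w'(2) comp_assoc p ..
      show "length (w' @ ?c) = Suc (length u) \<and> (\<forall>x. foldr T u (T i x) = foldr T (w' @ ?c) x)
          \<or> length (w' @ ?c) < length u"
        using w'(3) t by (auto simp: u(1) simp del: upt_Suc)
      show "w' @ ?c \<in> canon (Suc m)" using w'(1) u by auto
    qed
  qed
  \<comment> \<open>Relative to the start \<open>j\<close> of the final cycle, the letter commutes
    with it, prolongs it, cancels its last letter, or passes through it lowered by one. When it
    passes through, \<open>mk\<close> hands it to the shorter canonical word.\<close>
  consider "i + 1 < j" | "i + 1 = j" | "i = j" | "j < i" by linarith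
  then show ?case
  proof cases
    case 1
    show ?thesis
    proof (rule mk)
      show "foldr T ?c (T i x) = T i (foldr T ?c x)" for x
        unfolding foldr_rev_upt'[OF u(4)] using T_cross_commute[of i j] 1 by simp
      show "perm_of_word ?c \<circ> tau i = tau i \<circ> perm_of_word ?c"
        by (rule perm_cycle_tau_commute) (use u 1 in auto)
    qed (use Suc.prems u 1 in auto)
  next
    case 2
    have c: "rev [i..<m + 2] = ?c @ [i]"
      using 2 u(4) by (simp add: upt_conv_Cons del: upt_Suc)
    show ?thesis
    proof (intro bexI[of _ "w @ rev [i..<m + 2]"] conjI disjI1)
      show "w @ rev [i..<m + 2] \<in> canon (Suc m)"
        using u Suc.prems by auto
      show "perm_of_word (w @ rev [i..<m + 2]) = perm_of_word u \<circ> tau i"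
        unfolding u(1) c by (simp only: perm_of_word_simps comp_assoc comp_id)
      show "length (w @ rev [i..<m + 2]) = Suc (length u)"
        unfolding u(1) c by (simp del: upt_Suc)
      show "\<forall>x. foldr T u (T i x) = foldr T (w @ rev [i..<m + 2]) x"
        unfolding u(1) c by (simp only: foldr_append foldr.simps o_def id_apply) simp
    qed
  next
    case 3
    have c: "?c = rev [Suc i..<m + 2] @ [i]"
      using 3 Suc.prems by (simp add: upt_conv_Cons del: upt_Suc)
    show ?thesis
    proof (intro bexI[of _ "w @ rev [Suc i..<m + 2]"] conjI disjI2)
      show "w @ rev [Suc i..<m + 2] \<in> canon (Suc m)"
        using u Suc.prems by (auto simp del: upt_Suc)
      show "perm_of_word (w @ rev [Suc i..<m + 2]) = perm_of_word u \<circ> tau i"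
        unfolding u(1) c by (simp only: perm_of_word_simps fun_eq_iff o_apply tau_tau id_apply) simp
      show "length (w @ rev [Suc i..<m + 2]) < length u"
        unfolding u(1) c by (simp del: upt_Suc)
    qed
  next
    case 4
    then obtain i' where i': "i = Suc i'" by (cases i) auto
    show ?thesis
    proof (rule mk)
      show "foldr T ?c (T i x) = T i' (foldr T ?c x)" for x
        unfolding foldr_rev_upt'[OF u(4)] i' by (rule cross_T_shift) (use 4 i' Suc.prems in auto)
      show "perm_of_word ?c \<circ> tau i = tau i' \<circ> perm_of_word ?c"
        unfolding i' by (rule perm_cycle_tau_shift) (use 4 i' Suc.prems in auto)
    qed (use 4 i' Suc.prems u in auto)
  qed
qed simp

text \<open>The letters are appended one after the other. Equality of the operators is claimed only
  while no length is lost, since \<open>T i\<close> does not square to the identity; a word that has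
  become shorter stays shorter than the original.\<close>

lemma word_to_canon:
  assumes "set ws \<subseteq> {1..m}"
  shows "\<exists>u\<in>canon m. perm_of_word u = perm_of_word ws \<and>
    ((length u = length ws \<and> (\<forall>x. foldr T ws x = foldr T u x)) \<or> length u < length ws)"
  using assms
proof (induction ws rule: rev_induct)
  case Nil
  show ?case by (intro bexI[OF _ Nil_in_canon]) simp
next
  case (snoc i ws)
  have i: "1 \<le> i" "i \<le> m" and ws: "set ws \<subseteq> {1..m}" using snoc.prems by auto
  obtain u where u: "u \<in> canon m" "perm_of_word u = perm_of_word ws"
    "(length u = length ws \<and> (\<forall>x. foldr T ws x = foldr T u x)) \<or> length u < length ws"
    using snoc.IH[OF ws] by blast
  obtain u' where u': "u' \<in> canon m" "perm_of_word u' = perm_of_word u \<circ> tau i"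
    "(length u' = Suc (length u) \<and> (\<forall>x. foldr T u (T i x) = foldr T u' x)) \<or> length u' < length u"
    using canon_step[OF u(1) i] by blast
  have p: "perm_of_word u' = perm_of_word (ws @ [i])"
    unfolding u' u(2) by (simp only: perm_of_word_simps comp_id)
  have len: "length (ws @ [i]) = Suc (length ws)" by simp
  have op: "foldr T (ws @ [i]) x = foldr T ws (T i x)" for x by simp
  show ?case
  proof (intro bexI[OF _ u'(1)] conjI p)
    show "(length u' = length (ws @ [i]) \<and> (\<forall>x. foldr T (ws @ [i]) x = foldr T u' x)) \<or> length u' < length (ws @ [i])"
      unfolding len op
    proof (cases "length u = length ws \<and> length u' = Suc (length u)")
      case True
      then have "\<forall>x. foldr T ws (T i x) = foldr T u' x" using u(3) u'(3) by simp
      with True show "(length u' = Suc (length ws) \<and> (\<forall>x. foldr T ws (T i x) = foldr T u' x)) \<or> length u' < Suc (length ws)"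
        by simp
    next
      case False
      then have "length u' < Suc (length ws)" using u(3) u'(3) by linarith
      then show "(length u' = Suc (length ws) \<and> (\<forall>x. foldr T ws (T i x) = foldr T u' x)) \<or> length u' < Suc (length ws)" ..
    qed
  qed
qed

text \<open>A canonical word is the only one for its permutation, so \<open>word_to_canon\<close>
  compares every word of that permutation with it: none is shorter, and those of equal length,
  including the one picked by \<open>SOME\<close>, act in the same way.\<close>

lemma canon_reduced:
  assumes "u \<in> canon m"
  shows "plen (Suc m) (perm_of_word u) = length u"
    and "Tperm d r (Suc m) (perm_of_word u) x = foldr T u x"
proof -
  have interval: "{1..<Suc m} = {1..m}" by auto
  have *: "(length u = length ws \<and> (\<forall>x. foldr T ws x = foldr T u x)) \<or> length u < length ws"
    if ws: "set ws \<subseteq> {1..m}" and pw: "perm_of_word ws = perm_of_word u" for ws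
  proof -
    obtain u' where u': "u' \<in> canon m" "perm_of_word u' = perm_of_word ws"
      "(length u' = length ws \<and> (\<forall>x. foldr T ws x = foldr T u' x)) \<or> length u' < length ws"
      using word_to_canon[OF ws] by blast
    moreover have "u' = u" by (rule inj_onD[OF inj_on_perm_canon]) (use u' pw assms in auto)
    ultimately show ?thesis by simp
  qed
  have least: "length u \<le> length ws" if "set ws \<subseteq> {1..m}" "perm_of_word ws = perm_of_word u" for ws
    using *[OF that] by linarith
  show plen: "plen (Suc m) (perm_of_word u) = length u"
    unfolding plen_def interval
  proof (rule Least_equality)
    show "\<exists>ws. set ws \<subseteq> {1..m} \<and> perm_of_word ws = perm_of_word u \<and> length ws = length u"
      using canon_letters[OF assms] by blast
    show "length u \<le> l" if "\<exists>ws. set ws \<subseteq> {1..m} \<and> perm_of_word ws = perm_of_word u \<and> length ws = l" for l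
      using that least by blast
  qed
  define ws where "ws = (SOME ws. set ws \<subseteq> {1..m} \<and> perm_of_word ws = perm_of_word u \<and> length ws = length u)"
  have ws: "set ws \<subseteq> {1..m} \<and> perm_of_word ws = perm_of_word u \<and> length ws = length u"
    unfolding ws_def
    by (rule someI[of "\<lambda>ws. set ws \<subseteq> {1..m} \<and> perm_of_word ws = perm_of_word u \<and> length ws = length u" u])
      (use canon_letters[OF assms] in blast)
  have "foldr T ws x = foldr T u x"
    using *[of ws] ws by (metis less_irrefl)
  then show "Tperm d r (Suc m) (perm_of_word u) x = foldr T u x"
    by (simp only: Tperm_def plen interval Let_def ws_def)
qed

end

text \<open>Canonical words of the permutations in \<open>Dset k (k + l)\<close>, built by the
  recursion of \<open>Y\<close>: the appended cycle sends the last factor of the first block to the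
  end.\<close>

fun shuf :: "nat \<Rightarrow> nat \<Rightarrow> nat list set" where
  "shuf 0 l = {[]}"
| "shuf (Suc k) 0 = {[]}"
| "shuf (Suc k) (Suc l) = shuf (Suc k) l \<union> (\<lambda>w. w @ rev [Suc k..<Suc k + Suc l]) ` shuf k (Suc l)"

lemma shuf_canon: "shuf k l \<subseteq> canon (k + l - 1)"
proof (induction k l rule: shuf.induct)
  case (3 k l)
  have "shuf (Suc k) l \<subseteq> canon (k + l)" "shuf k (Suc l) \<subseteq> canon (k + l)" using 3 by auto
  moreover have "w @ rev [Suc k..<Suc k + Suc l] \<in> canon (Suc (k + l))" if "w \<in> canon (k + l)" for w
    unfolding canon.simps mem_Collect_eq
    by (intro exI[of _ w] exI[of _ "Suc k"]) (use that in \<open>simp del: upt_Suc\<close>)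
  ultimately show ?case using canon_mono[of "k + l"] by (auto simp del: canon.simps upt_Suc)
qed (auto intro: Nil_in_canon)

lemma finite_shuf: "finite (shuf k l)"
  by (induction k l rule: shuf.induct) auto

lemma length_shuf: "w \<in> shuf k l \<Longrightarrow> length w \<le> k * l"
proof (induction k l arbitrary: w rule: shuf.induct)
  case (3 k l)
  from 3(3) consider "w \<in> shuf (Suc k) l" | v where "v \<in> shuf k (Suc l)" "w = v @ rev [Suc k..<Suc k + Suc l]"
    by auto
  then show ?case
  proof cases
    case 1
    then show ?thesis using 3(1)[of w] by simp
  next
    case 2
    then show ?thesis using 3(2)[of v] by (simp del: upt_Suc)
  qed
qed auto

text \<open>If the second block supplies the last factor, no letter is added while the maximal
  length grows by \<open>Suc k\<close>, whence \<open>q ^ Suc k\<close>; here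
  \<open>length_shuf\<close> keeps the subtraction exact. If the first block does, the cycle adds
  \<open>Suc l\<close> letters, which gives the sign and leaves the exponent of \<open>q\<close>
  unchanged.\<close>

lemma (in hecke_symmetry) sum_shuf:
  "(\<Sum>u\<in>shuf k l. fscale ((-1) ^ length u * q ^ (k * l - length u)) (foldr T u x)) = Y 0 k l x"
proof (induction k l arbitrary: x rule: shuf.induct)
  case (3 k l)
  let ?f = "\<lambda>w. w @ rev [Suc k..<Suc k + Suc l]"
  \<comment> \<open>The two families are disjoint, because only the appended cycle contains the
    letter \<open>Suc (k + l)\<close>.\<close>
  have "Suc (k + l) \<in> set (?f w)" for w by auto
  moreover have "Suc (k + l) \<notin> set w" if "w \<in> shuf (Suc k) l" for w
    using that shuf_canon[of "Suc k" l] canon_letters[of w "k + l"] by fastforce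
  ultimately have disj: "shuf (Suc k) l \<inter> ?f ` shuf k (Suc l) = {}" by blast
  have inj: "inj_on ?f (shuf k (Suc l))" by (auto intro: inj_onI)
  have 1: "(\<Sum>u\<in>shuf (Suc k) l. fscale ((-1) ^ length u * q ^ (Suc k * Suc l - length u)) (foldr T u x))
      = fscale (q ^ Suc k) (Y 0 (Suc k) l x)"
    unfolding 3(1)[symmetric] fs.scale_sum_right fs.scale_scale
  proof (intro sum.cong refl)
    fix u assume "u \<in> shuf (Suc k) l"
    from length_shuf[OF this] have "Suc k * Suc l - length u = Suc k + (Suc k * l - length u)"
      by simp
    then have e: "q ^ (Suc k * Suc l - length u) = q ^ Suc k * q ^ (Suc k * l - length u)"
      by (simp only: power_add)
    show "fscale ((-1) ^ length u * q ^ (Suc k * Suc l - length u)) (foldr T u x) =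
      fscale (q ^ Suc k * ((-1) ^ length u * q ^ (Suc k * l - length u))) (foldr T u x)"
      by (simp only: e mult_ac)
  qed
  have 2: "(\<Sum>u\<in>?f ` shuf k (Suc l). fscale ((-1) ^ length u * q ^ (Suc k * Suc l - length u)) (foldr T u x))
      = fscale ((-1) ^ Suc l) (Y 0 k (Suc l) (cross (0 + Suc k) (Suc l) x))"
    unfolding sum.reindex[OF inj] 3(2)[symmetric] fs.scale_sum_right fs.scale_scale o_def
  proof (intro sum.cong refl)
    fix u assume u: "u \<in> shuf k (Suc l)"
    have "foldr T (?f u) x = foldr T u (cross (0 + Suc k) (Suc l) x)"
      by (simp only: foldr_append foldr_rev_upt add_0)
    then show "fscale ((-1) ^ length (?f u) * q ^ (Suc k * Suc l - length (?f u))) (foldr T (?f u) x) =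
      fscale ((-1) ^ Suc l * ((-1) ^ length u * q ^ (k * Suc l - length u))) (foldr T u (cross (0 + Suc k) (Suc l) x))"
      by (simp add: power_add mult_ac del: upt_Suc cross.simps)
  qed
  show ?case
    unfolding shuf.simps Y.simps
    by (subst sum.union_disjoint) (use disj 1 2 finite_shuf in \<open>simp_all del: upt_Suc cross.simps\<close>)
qed auto

lemma permutes_drop_last:
  assumes "\<sigma> permutes {1..Suc m}" "\<sigma> (Suc m) = Suc m"
  shows "\<sigma> permutes {1..m}"
  by (rule permutes_superset[OF assms(1)]) (use assms in \<open>auto simp: le_Suc_eq\<close>)

lemma increasing_permutation_id:
  assumes "\<sigma> permutes {1..m}" "\<And>a b. 1 \<le> a \<Longrightarrow> a < b \<Longrightarrow> b \<le> m \<Longrightarrow> \<sigma> a < \<sigma> b"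
  shows "\<sigma> = (id :: nat \<Rightarrow> nat)"
  using assms
proof (induction m)
  case (Suc m)
  have "\<sigma> (Suc m) = Suc m"
  proof (rule ccontr)
    assume ne: "\<sigma> (Suc m) \<noteq> Suc m"
    obtain a where a: "a \<in> {1..Suc m}" "\<sigma> a = Suc m"
      using permutes_image[OF Suc.prems(1)] by (metis atLeastAtMost_iff imageE le_refl le_add1 plus_1_eq_Suc)
    then have "\<sigma> a < \<sigma> (Suc m)" using ne by (intro Suc.prems(2)) (auto simp: le_less)
    moreover have "\<sigma> (Suc m) \<in> {1..Suc m}" using permutes_in_image[OF Suc.prems(1)] by simp
    ultimately show False using a by simp
  qed
  from permutes_drop_last[OF Suc.prems(1) this] Suc.IH Suc.prems(2) show ?case by simp
qed simp

lemma Dset_trivial: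
  assumes "k = 0 \<or> k = m"
  shows "Dset k m = {id}"
  using assms increasing_permutation_id[of _ m] by (auto simp: Dset_def permutes_id)

lemma Dset_Suc:
  "Dset (Suc k) (Suc (Suc (k + l))) = Dset (Suc k) (Suc (k + l)) \<union>
     (\<lambda>\<sigma>. \<sigma> \<circ> perm_of_word (rev [Suc k..<Suc (Suc (k + l))])) ` Dset k (Suc (k + l))"
  (is "?L = ?A \<union> ?f ` ?B")
proof
  define M where "M = Suc (Suc (k + l))"
  define c where "c = perm_of_word (rev [Suc k..<M])"
  have c: "c x = (if x = Suc k then M else if Suc k < x \<and> x \<le> M then x - 1 else x)" for x
    unfolding c_def by (rule perm_of_word_rev_upt') (simp add: M_def)
  have cp: "c permutes {1..M}"
    unfolding permutes_def bij_iff[symmetric]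
    using bij_perm_of_word[of "rev [Suc k..<M]"] by (auto simp: c_def[symmetric]) (auto simp: c M_def)
  show "?A \<union> ?f ` ?B \<subseteq> ?L"
  proof
    fix \<sigma> assume "\<sigma> \<in> ?A \<union> ?f ` ?B"
    then consider "\<sigma> \<in> ?A" | \<sigma>' where "\<sigma>' \<in> ?B" "\<sigma> = \<sigma>' \<circ> c"
      by (auto simp: c_def M_def)
    then show "\<sigma> \<in> ?L"
    proof cases
      case 1
      then have p: "\<sigma> permutes {1..Suc (k + l)}" by (simp add: Dset_def)
      then have "\<sigma> M = M" by (simp add: permutes_def M_def)
      moreover have "\<sigma> a < M" if "1 \<le> a" "a < M" for a
        using permutes_in_image[OF p, of a] that by (simp add: M_def)
      moreover have "\<sigma> permutes {1..M}" by (rule permutes_subset[OF p]) (auto simp: M_def)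
      ultimately show ?thesis using 1 unfolding Dset_def M_def by (auto simp: le_Suc_eq)
    next
      case 2
      then have p: "\<sigma>' permutes {1..Suc (k + l)}" by (simp add: Dset_def)
      then have fM: "\<sigma>' M = M" by (simp add: permutes_def M_def)
      have lt: "\<sigma>' a < M" if "1 \<le> a" "a < M" for a
        using permutes_in_image[OF p, of a] that by (simp add: M_def)
      have "\<sigma>' permutes {1..M}" by (rule permutes_subset[OF p]) (auto simp: M_def)
      then have "\<sigma> permutes {1..M}" unfolding 2 by (rule permutes_compose[OF cp])
      moreover have "\<sigma> a < \<sigma> b" if "1 \<le> a" "a < b" "b \<le> Suc k" for a b
        using that 2 fM lt[of a] unfolding Dset_def by (auto simp: c M_def)
      moreover have "\<sigma> a < \<sigma> b" if "Suc k + 1 \<le> a" "a < b" "b \<le> M" for a b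
      proof -
        have "\<sigma>' (a - 1) < \<sigma>' (b - 1)"
        proof -
          have "\<forall>a b. k + 1 \<le> a \<and> a < b \<and> b \<le> Suc (k + l) \<longrightarrow> \<sigma>' a < \<sigma>' b"
            using 2(1) by (simp add: Dset_def)
          moreover have "k + 1 \<le> a - 1" "a - 1 < b - 1" "b - 1 \<le> Suc (k + l)"
            using that by (auto simp: M_def)
          ultimately show ?thesis by blast
        qed
        then show ?thesis using that 2 by (simp add: c)
      qed
      ultimately show ?thesis unfolding Dset_def M_def by auto
    qed
  qed
  show "?L \<subseteq> ?A \<union> ?f ` ?B"
  proof
    fix \<sigma> assume "\<sigma> \<in> ?L"
    then have p: "\<sigma> permutes {1..M}"
      and inc1: "\<And>a b. 1 \<le> a \<Longrightarrow> a < b \<Longrightarrow> b \<le> Suc k \<Longrightarrow> \<sigma> a < \<sigma> b"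
      and inc2: "\<And>a b. Suc k + 1 \<le> a \<Longrightarrow> a < b \<Longrightarrow> b \<le> M \<Longrightarrow> \<sigma> a < \<sigma> b"
      unfolding Dset_def M_def by auto
    obtain b where b: "b \<in> {1..M}" "\<sigma> b = M"
      using permutes_image[OF p] by (metis atLeastAtMost_iff imageE le_refl M_def le_add1 plus_1_eq_Suc)
    have le: "\<sigma> x \<le> M" if "x \<in> {1..M}" for x
      using permutes_in_image[OF p] that by auto
    have "b = Suc k \<or> b = M"
    proof (rule ccontr)
      assume "\<not> (b = Suc k \<or> b = M)"
      then consider "b < Suc k" | "Suc k < b" "b < M" using b by force
      then show False
        using inc1[of b "Suc k"] inc2[of b M] le[of "Suc k"] le[of M] b by cases (auto simp: M_def)
    qed
    then show "\<sigma> \<in> ?A \<union> ?f ` ?B"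
    proof
      assume "b = M"
      then have "\<sigma> permutes {1..Suc (k + l)}"
        using permutes_drop_last[of \<sigma> "Suc (k + l)"] p b by (simp add: M_def)
      then show ?thesis using inc1 inc2 unfolding Dset_def M_def by auto
    next
      assume bk: "b = Suc k"
      have inv: "inv c x = (if x = M then Suc k else if Suc k \<le> x \<and> x < M then Suc x else x)" for x
        by (rule inv_f_eq[OF permutes_inj[OF cp]]) (auto simp: c M_def)
      define \<sigma>' where "\<sigma>' = \<sigma> \<circ> inv c"
      have "\<sigma>' permutes {1..M}"
        unfolding \<sigma>'_def by (rule permutes_compose[OF permutes_inv[OF cp] p])
      moreover have "\<sigma>' M = M" by (simp add: \<sigma>'_def inv b bk[symmetric])
      ultimately have "\<sigma>' permutes {1..Suc (k + l)}"
        using permutes_drop_last[of \<sigma>' "Suc (k + l)"] by (simp add: M_def)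
      moreover have "\<sigma>' a < \<sigma>' b" if "1 \<le> a" "a < b" "b \<le> k" for a b
        using inc1[of a b] that by (simp add: \<sigma>'_def inv M_def)
      moreover have "\<sigma>' a < \<sigma>' b" if "k + 1 \<le> a" "a < b" "b \<le> Suc (k + l)" for a b
        using inc2[of "Suc a" "Suc b"] that by (simp add: \<sigma>'_def inv M_def)
      ultimately have "\<sigma>' \<in> ?B" unfolding Dset_def by blast
      moreover have "\<sigma> = \<sigma>' \<circ> c"
        unfolding \<sigma>'_def by (simp add: comp_assoc permutes_inv_o[OF cp])
      ultimately show ?thesis by (auto simp: c_def M_def)
    qed
  qed
qed

lemma perm_shuf: "perm_of_word ` shuf k l = Dset k (k + l)"
proof (induction k l rule: shuf.induct)
  case (3 k l)
  have "perm_of_word ` shuf (Suc k) (Suc l) = perm_of_word ` shuf (Suc k) l \<union>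
      (\<lambda>\<sigma>. \<sigma> \<circ> perm_of_word (rev [Suc k..<Suc k + Suc l])) ` perm_of_word ` shuf k (Suc l)"
    by (simp add: image_Un image_image del: upt_Suc)
  also have "\<dots> = Dset (Suc k) (Suc k + Suc l)"
    unfolding 3 using Dset_Suc[of k l] by (simp del: upt_Suc)
  finally show ?case .
qed (simp_all only: shuf.simps Dset_trivial add_0 add_0_right image_insert image_empty perm_of_word_simps simp_thms)

text \<open>From here on the product is given by the recursion; the chosen reduced words do not
  appear again.\<close>

lemma (in hecke_symmetry) yop_eq_Y: "yop d r q (k + l) k x = Y 0 k l x"
proof (cases "k + l = 0")
  case True
  have "plen 0 id = 0" unfolding plen_def by (rule Least_eq_0) auto
  moreover have "Tperm d r 0 id x = x"
    using someI[of "\<lambda>ws::nat list. set ws \<subseteq> {1..<0} \<and> perm_of_word ws = id \<and> length ws = 0" "[]"]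
    by (simp add: Tperm_def \<open>plen 0 id = 0\<close>)
  ultimately show ?thesis using True by (simp add: yop_def Dset_trivial)
next
  case False
  have inj: "inj_on perm_of_word (shuf k l)"
    using inj_on_subset[OF inj_on_perm_canon shuf_canon] .
  have "yop d r q (k + l) k x w = (\<Sum>u\<in>shuf k l.
     (-1) ^ length u * q ^ (k * l - length u) * foldr T u x w)" for w
    unfolding yop_def perm_shuf[symmetric] sum.reindex[OF inj] o_def
    using canon_reduced[of _ "k + l - 1"] shuf_canon[of k l] False
    by (intro sum.cong) auto
  also have "\<dots> w = Y 0 k l x w" for w
    unfolding sum_shuf[symmetric] by (simp add: tensor_apply)
  finally show ?thesis by auto
qed

section \<open>Linear algebra in finite-dimensional spaces of tensors\<close>

interpretation fsp: vector_space_pair "fscale :: 'k::field \<Rightarrow> 'k tensor \<Rightarrow> 'k tensor" "fscale :: 'k \<Rightarrow> 'k tensor \<Rightarrow> 'k tensor"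
  by (intro vector_space_pair.intro vector_space_fscale)

interpretation fsf: vector_space_pair "fscale :: 'k::field \<Rightarrow> 'k tensor \<Rightarrow> 'k tensor" "(*) :: 'k \<Rightarrow> 'k \<Rightarrow> 'k"
  by (intro vector_space_pair.intro vector_space_fscale) (unfold_locales, auto simp: algebra_simps)

lemma linear_fscaleI:
  assumes "\<And>x y. f (x + y) = f x + f y" "\<And>c x. f (fscale c x) = fscale c (f x)"
  shows "Vector_Spaces.linear fscale fscale (f :: ('k::field) tensor \<Rightarrow> 'k tensor)"
  unfolding Vector_Spaces.linear_def module_hom_axioms_def module_hom_def
  using assms vector_space_fscale fs.module_axioms by auto

lemma Tp_span: "Tp d p \<subseteq> fs.span (unit_tensor ` words d p)"
proof
  fix x :: "'a tensor" assume "x \<in> Tp d p"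
  from Tp_expand[OF this] show "x \<in> fs.span (unit_tensor ` words d p)"
    by (metis (no_types, lifting) fs.span_base fs.span_scale fs.span_sum imageI)
qed

lemma finite_basis:
  assumes "S \<subseteq> fs.span W" "finite W"
  obtains C where "C \<subseteq> S" "finite C" "fs.independent C" "S \<subseteq> fs.span C" "card C = fs.dim S"
proof -
  obtain C where C: "C \<subseteq> S" "fs.independent C" "S \<subseteq> fs.span C" "card C = fs.dim S"
    using fs.basis_exists by blast
  moreover have "finite C"
    using fs.independent_span_bound[OF assms(2) C(2)] C(1) assms(1) by blast
  ultimately show ?thesis using that by blast
qed

lemma finite_basis_Tp:
  assumes "S \<subseteq> Tp d p"
  obtains C where "C \<subseteq> S" "finite C" "fs.independent C" "S \<subseteq> fs.span C" "card C = fs.dim S"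
  by (rule finite_basis[of S "unit_tensor ` words d p"]) (use assms Tp_span[of d p] in auto)

lemma subset_span_if_card:
  assumes "S \<subseteq> Tp d p" "C \<subseteq> S" "finite C" "fs.independent C" "fs.dim S \<le> card C"
  shows "S \<subseteq> fs.span C"
proof (rule ccontr)
  assume "\<not> S \<subseteq> fs.span C"
  then obtain y where y: "y \<in> S" "y \<notin> fs.span C" by auto
  obtain D where D: "finite D" "S \<subseteq> fs.span D" "card D = fs.dim S"
    using finite_basis_Tp[OF assms(1)] by metis
  have "fs.independent (insert y C)" by (rule fs.independent_insertI[OF y(2) assms(4)])
  then have "card (insert y C) \<le> card D"
    using fs.independent_span_bound[OF D(1), of "insert y C"] D(2) y(1) assms(2) by blast
  moreover have "y \<notin> C" using y(2) fs.span_base by blast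
  ultimately show False using assms(3,5) D(3) by simp
qed

lemma subspace_eq_if_dim_le:
  assumes "S \<subseteq> Tp d p" "S' \<subseteq> S" "fs.subspace S'" "fs.dim S \<le> fs.dim S'"
  shows "S' = S"
proof -
  obtain C where C: "C \<subseteq> S'" "finite C" "fs.independent C" "card C = fs.dim S'"
    using finite_basis_Tp[of S' d p] assms by (metis order_trans)
  have "S \<subseteq> fs.span C"
    by (rule subset_span_if_card[OF assms(1)]) (use C assms in auto)
  also have "\<dots> \<subseteq> S'" by (rule fs.span_minimal[OF C(1) assms(3)])
  finally show ?thesis using assms(2) by blast
qed

text \<open>In finite dimension an injective endomorphism of \<open>S\<close> is onto, so a subspace
  containing its image is all of \<open>S\<close>.\<close>

lemma injective_image_spans:
  assumes "S \<subseteq> Tp d p" "fs.subspace S" "fs.subspace S'" "S' \<subseteq> S"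
    and "Vector_Spaces.linear fscale fscale \<psi>" "\<And>x. x \<in> S \<Longrightarrow> \<psi> x \<in> S'"
    and "\<And>x. x \<in> S \<Longrightarrow> \<psi> x = 0 \<Longrightarrow> x = 0"
  shows "S' = S"
proof -
  obtain C where C: "C \<subseteq> S" "finite C" "fs.independent C" "S \<subseteq> fs.span C" "card C = fs.dim S"
    using finite_basis_Tp[OF assms(1)] by metis
  have "inj_on \<psi> S"
    using fsp.linear_inj_on_iff_eq_0[OF assms(5,2)] assms(7) by blast
  moreover have sp: "fs.span C \<subseteq> S" by (rule fs.span_minimal[OF C(1) assms(2)])
  ultimately have inj: "inj_on \<psi> (fs.span C)" by (rule inj_on_subset)
  have "S \<subseteq> fs.span (\<psi> ` C)"
  proof (rule subset_span_if_card[OF assms(1)])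
    show "fs.independent (\<psi> ` C)"
      by (rule fsp.linear_independent_injective_image[OF assms(5) C(3) inj])
    have "inj_on \<psi> C" using inj fs.span_superset by (rule inj_on_subset)
    then show "fs.dim S \<le> card (\<psi> ` C)" using C(5) by (simp add: card_image)
    show "\<psi> ` C \<subseteq> S" using C(1) assms(4,6) by blast
  qed (use C in auto)
  also have "\<dots> \<subseteq> S'" by (rule fs.span_minimal) (use C assms in auto)
  finally show ?thesis using assms(4) by blast
qed

lemma dim_le_card_separating:
  fixes f :: "'b \<Rightarrow> ('k::field) tensor \<Rightarrow> 'k"
  assumes "S \<subseteq> Tp d p" "fs.subspace S" "finite B"
    and add: "\<And>b x y. f b (x + y) = f b x + f b y" and scale: "\<And>b c x. f b (fscale c x) = c * f b x"
    and sep: "\<And>x. x \<in> S \<Longrightarrow> (\<And>b. b \<in> B \<Longrightarrow> f b x = 0) \<Longrightarrow> x = 0"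
  shows "fs.dim S \<le> card B"
proof -
  obtain h :: "'b \<Rightarrow> nat" where h: "inj_on h B"
    using finite_imp_inj_to_nat_seg[OF assms(3)] by blast
  \<comment> \<open>The functionals embed \<open>S\<close> into a coordinate space with basis
    \<open>B\<close>. It is modelled inside the tensors by words of zeros, told apart by their
    lengths.\<close>
  define e :: "'b \<Rightarrow> 'k tensor" where "e b = unit_tensor (replicate (h b) 0)" for b
  define g where "g x = (\<Sum>b\<in>B. fscale (f b x) (e b))" for x
  have lin: "Vector_Spaces.linear fscale fscale g"
    by (rule linear_fscaleI)
      (simp_all add: g_def add scale fs.scale_left_distrib sum.distrib fs.scale_sum_right)
  have coeff: "g x (replicate (h b) 0) = f b x" if "b \<in> B" for x b
  proof -
    have "g x (replicate (h b) 0) = (\<Sum>b'\<in>B. f b' x * (if b' = b then 1 else 0))"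
      unfolding g_def sum_tensor_apply
      using h that by (intro sum.cong) (auto simp: e_def unit_tensor_def tensor_apply replicate_eq_replicate dest: inj_onD)
    then show ?thesis using that assms(3) by (simp add: if_distrib sum.delta cong: if_cong)
  qed
  obtain C where C: "C \<subseteq> S" "finite C" "fs.independent C" "S \<subseteq> fs.span C" "card C = fs.dim S"
    using finite_basis_Tp[OF assms(1)] by metis
  have "inj_on g S"
    unfolding fsp.linear_inj_on_iff_eq_0[OF lin assms(2)]
  proof (intro ballI impI)
    fix x assume "x \<in> S" "g x = 0"
    then show "x = 0" using sep[of x] coeff[of _ x] by (simp add: tensor_apply)
  qed
  moreover have "fs.span C \<subseteq> S" by (rule fs.span_minimal[OF C(1) assms(2)])
  ultimately have inj: "inj_on g (fs.span C)" by (rule inj_on_subset)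
  have "g ` C \<subseteq> fs.span (e ` B)"
    unfolding g_def image_subset_iff by (blast intro: fs.span_sum fs.span_scale fs.span_base)
  then have "card (g ` C) \<le> card (e ` B)"
    using fs.independent_span_bound[of "e ` B" "g ` C"] assms(3)
      fsp.linear_independent_injective_image[OF lin C(3) inj] by auto
  moreover have "card (g ` C) = card C"
    using inj fs.span_superset by (intro card_image) (rule inj_on_subset)
  ultimately show ?thesis using C(5) card_image_le[OF assms(3), of e] by linarith
qed

text \<open>V and its dual share one coordinate model, so this formula is symmetric and either
  argument can be read as the functional.\<close>

definition pairing :: "nat \<Rightarrow> nat \<Rightarrow> ('k::field) tensor \<Rightarrow> 'k tensor \<Rightarrow> 'k" where
  "pairing d p x \<xi> = (\<Sum>w\<in>words d p. x w * \<xi> w)"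

lemma pairing_add_left: "pairing d p (x + y) \<xi> = pairing d p x \<xi> + pairing d p y \<xi>"
  and pairing_add_right: "pairing d p x (\<xi> + \<eta>) = pairing d p x \<xi> + pairing d p x \<eta>"
  and pairing_scale_left: "pairing d p (fscale c x) \<xi> = c * pairing d p x \<xi>"
  and pairing_scale_right: "pairing d p x (fscale c \<xi>) = c * pairing d p x \<xi>"
  and pairing_commute: "pairing d p x \<xi> = pairing d p \<xi> x"
proof -
  show "pairing d p x \<xi> = pairing d p \<xi> x" for x \<xi> :: "'a tensor"
    unfolding pairing_def by (intro sum.cong refl mult.commute)
  show "pairing d p (x + y) \<xi> = pairing d p x \<xi> + pairing d p y \<xi>"
    "pairing d p x (\<xi> + \<eta>) = pairing d p x \<xi> + pairing d p x \<eta>"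
    by (simp_all only: pairing_def tensor_apply distrib_left distrib_right sum.distrib)
  show "pairing d p (fscale c x) \<xi> = c * pairing d p x \<xi>"
    "pairing d p x (fscale c \<xi>) = c * pairing d p x \<xi>"
    unfolding pairing_def sum_distrib_left by (simp_all only: tensor_apply mult.assoc mult.left_commute)
qed

lemma subspace_pairing: "fs.subspace {x. pairing d p x \<xi> = 0}"
  unfolding fs.subspace_def
  by (simp add: pairing_add_left pairing_scale_left) (simp add: pairing_def tensor_apply)

text \<open>\<open>S\<close> need not be homogeneous (it will be the ideal), so the functional is
  built on all tensors by extending a basis of \<open>S\<close> by \<open>x\<close>; its coordinates
  in degree \<open>p\<close> give \<open>\<xi>\<close>, which represents it on
  \<open>Tp d p\<close>.\<close>

lemma separating_functional:
  fixes S :: "('k::field) tensor set"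
  assumes "fs.subspace S" "x \<in> Tp d p" "x \<notin> S"
  obtains \<xi> where "\<xi> \<in> Tp d p" "\<And>u. u \<in> S \<Longrightarrow> u \<in> Tp d p \<Longrightarrow> pairing d p u \<xi> = 0" "pairing d p x \<xi> \<noteq> 0"
proof -
  obtain B where B: "B \<subseteq> S" "fs.independent B" "S \<subseteq> fs.span B"
    using fs.basis_exists[of S] by metis
  have sp: "fs.span B = S"
    by (rule equalityI[OF fs.span_minimal[OF B(1) assms(1)] B(3)])
  have "fs.independent (insert x B)"
  proof (rule fs.independent_insertI[OF _ B(2)])
    show "x \<notin> fs.span B" using sp assms(3) by blast
  qed
  from fsf.linear_independent_extend[OF this, of "\<lambda>b. if b = x then 1 else 0"]
  obtain g where g: "Vector_Spaces.linear fscale (*) g"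
    and gB: "\<forall>b\<in>insert x B. g b = (if b = x then 1 else 0)"
    by (elim exE conjE)
  have gS: "g u = 0" if "u \<in> S" for u
  proof (rule fsf.linear_eq_0_on_span[OF g])
    show "g b = 0" if "b \<in> B" for b
    proof -
      have "b \<noteq> x" using that B(1) assms(3) by blast
      then show ?thesis using gB that by simp
    qed
    show "u \<in> fs.span B" using sp that by blast
  qed
  define \<xi> where "\<xi> w = (if w \<in> words d p then g (unit_tensor w) else 0)" for w
  have *: "pairing d p u \<xi> = g u" if "u \<in> Tp d p" for u
  proof -
    have "g u = g (\<Sum>w\<in>words d p. fscale (u w) (unit_tensor w))"
      by (rule arg_cong[OF Tp_expand[OF that]])
    also have "\<dots> = pairing d p u \<xi>"
      unfolding fsf.linear_sum[OF g] fsf.linear_scale[OF g] pairing_def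
      by (intro sum.cong) (simp_all add: \<xi>_def)
    finally show ?thesis ..
  qed
  show ?thesis
  proof (rule that[of \<xi>])
    show "\<xi> \<in> Tp d p" by (simp add: \<xi>_def in_Tp_iff)
    show "pairing d p u \<xi> = 0" if "u \<in> S" "u \<in> Tp d p" for u
      using *[OF that(2)] gS[OF that(1)] by simp
    show "pairing d p x \<xi> \<noteq> 0" using *[OF assms(2)] gB by simp
  qed
qed

lemma dim_1_generator:
  assumes "fs.subspace S" "fs.dim S = 1"
  obtains \<omega> where "\<omega> \<noteq> 0" "S = range (\<lambda>c. fscale c \<omega>)"
proof -
  obtain B where B: "B \<subseteq> S" "fs.independent B" "S \<subseteq> fs.span B" "card B = 1"
    using fs.basis_exists[of S] assms(2) by metis
  then obtain \<omega> where \<omega>: "B = {\<omega>}" by (auto simp: card_1_singleton_iff)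
  have "fs.span B = S"
    using B(3) fs.span_minimal[OF B(1) assms(1)] by blast
  then have "S = range (\<lambda>c. fscale c \<omega>)" unfolding \<omega> fs.span_singleton by simp
  moreover have "\<omega> \<noteq> 0" using B(2) fs.dependent_zero[of B] unfolding \<omega> by blast
  ultimately show ?thesis using that[of \<omega>] by blast
qed

section \<open>A one-dimensional component of \<open>\<Upsilon>\<close>\<close>

lemma rsl_zero [simp]: "rsl v 0 = 0" and lsl_zero [simp]: "lsl v 0 = 0"
  by (auto simp: rsl_def lsl_def fun_eq_iff tensor_apply)

locale hecke_top = hecke_symmetry d r q
  for d r and q :: "'k::field" +
  fixes n :: nat and \<omega> :: "'k tensor"
  assumes n_pos: "n > 0"
    and omega_nonzero: "\<omega> \<noteq> 0"
    and U_n: "U n = range (\<lambda>c. fscale c \<omega>)"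
begin

text \<open>A word at which \<open>\<omega>\<close> does not vanish. Its coefficient identifies the
  line \<open>U n\<close> with the field, and contraction with it undoes left multiplication by
  \<open>\<omega>\<close> up to a scalar.\<close>

definition pivot :: "nat list" where "pivot = (SOME w. \<omega> w \<noteq> 0)"

lemma omega_pivot: "\<omega> pivot \<noteq> 0"
proof -
  have "\<exists>w. \<omega> w \<noteq> 0" using omega_nonzero by (auto simp: fun_eq_iff tensor_apply)
  then show ?thesis unfolding pivot_def by (rule someI_ex)
qed

lemma omega_U: "\<omega> \<in> U n"
proof -
  have "\<omega> = fscale 1 \<omega>" by simp
  then show ?thesis unfolding U_n by blast
qed

lemma omega_Tp: "\<omega> \<in> Tp d n"
  using omega_U by (rule U_Tp)

lemma pivot_words: "pivot \<in> words d n"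
  using Tp_outside[OF omega_Tp] omega_pivot by blast

lemma length_pivot: "length pivot = n"
  using pivot_words by (simp add: words_def)

lemma U_n_pivot:
  assumes "z \<in> U n"
  shows "z = fscale (z pivot / \<omega> pivot) \<omega>"
proof -
  obtain c where "z = fscale c \<omega>" using assms U_n by blast
  then show ?thesis using omega_pivot by (simp add: tensor_apply)
qed

lemma U_n_eq_0: "z \<in> U n \<Longrightarrow> z pivot = 0 \<Longrightarrow> z = 0"
  using U_n_pivot[of z] by simp

text \<open>Normalised so that \<open>rfac (tmul \<omega> y) = y\<close>; being defined on all
  tensors, it is linear without side conditions.\<close>

definition rfac :: "'k tensor \<Rightarrow> 'k tensor" where
  "rfac z = fscale (1 / \<omega> pivot) (lsl pivot z)"

lemma rfac_in_Tp: "z \<in> Tp d (n + m) \<Longrightarrow> rfac z \<in> Tp d m"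
  unfolding rfac_def using length_pivot by (intro Tp_scale lsl_in_Tp)

lemma rfac_add: "rfac (x + y) = rfac x + rfac y"
  and rfac_scale: "rfac (fscale c x) = fscale c (rfac x)"
  by (simp_all add: rfac_def lsl_add lsl_scale fs.scale_right_distrib mult.commute)

lemma rfac_sum: "rfac (\<Sum>i\<in>A. f i) = (\<Sum>i\<in>A. rfac (f i))"
proof (induction A rule: infinite_finite_induct)
  case (infinite A)
  then show ?case using rfac_scale[of 0 0] by simp
next
  case empty
  then show ?case using rfac_scale[of 0 0] by simp
qed (simp add: rfac_add)

text \<open>Every slice of \<open>z\<close> by its last \<open>m\<close> letters lies in the line
  \<open>U n\<close>, hence is a multiple of \<open>\<omega>\<close>, and the multiples are the
  coefficients of \<open>rfac z\<close>.\<close>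

lemma tmul_omega_rfac:
  assumes "z \<in> Tp d (n + m)" "\<And>i. 1 \<le> i \<Longrightarrow> i < n \<Longrightarrow> z \<in> img i (n + m)"
  shows "z = tmul \<omega> (rfac z)"
proof (rule tensor_eqI_rsl[of _ d n m])
  fix v assume v: "v \<in> words d m"
  then have len: "length v = m" by (simp add: words_def)
  have "rsl v z \<in> U n" by (rule rsl_in_U[OF assms len])
  from U_n_pivot[OF this] have "rsl v z = fscale (rfac z v) \<omega>"
    by (simp add: rfac_def rsl_apply lsl_apply tensor_apply)
  also have "\<dots> = rsl v (tmul \<omega> (rfac z))"
    by (rule rsl_tmul[OF omega_Tp rfac_in_Tp[OF assms(1)] len, symmetric])
  finally show "rsl v z = rsl v (tmul \<omega> (rfac z))" .
qed (use assms in \<open>auto intro: tmul_in_Tp omega_Tp rfac_in_Tp\<close>)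

lemma tmul_left_omega_cancel:
  assumes "tmul \<omega> y = 0"
  shows "y = 0"
proof -
  have "lsl pivot (tmul \<omega> y) = fscale (\<omega> pivot) y"
    by (rule lsl_tmul[OF omega_Tp length_pivot])
  then show ?thesis using assms omega_pivot by simp
qed

lemma tmul_right_omega_cancel:
  assumes "a \<in> Tp d k" "tmul a \<omega> = 0"
  shows "a = 0"
proof -
  have "rsl pivot (tmul a \<omega>) = fscale (\<omega> pivot) a"
    by (rule rsl_tmul[OF assms(1) omega_Tp length_pivot])
  then show ?thesis using assms omega_pivot by simp
qed

definition \<phi> :: "'k tensor \<Rightarrow> 'k tensor" where
  "\<phi> v = rfac (cross 1 n (tmul v \<omega>))"

lemma phi_add: "\<phi> (x + y) = \<phi> x + \<phi> y"
  and phi_scale: "\<phi> (fscale c x) = fscale c (\<phi> x)"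
  by (simp_all add: \<phi>_def rfac_add rfac_scale cross_add cross_scale tmul_add_left tmul_scale_left)

lemma phi_in_Tp: "v \<in> Tp d 1 \<Longrightarrow> \<phi> v \<in> Tp d 1"
  unfolding \<phi>_def
  by (intro rfac_in_Tp cross_in_Tp) (use tmul_in_Tp[OF _ omega_Tp, of v 1] in \<open>simp add: add.commute\<close>)

text \<open>The crossing shifts the conditions on \<open>\<omega>\<close> from the places 2 to n + 1
  to the places 1 to n.\<close>

lemma cross_omega:
  assumes "v \<in> Tp d 1"
  shows "cross 1 n (tmul v \<omega>) = tmul \<omega> (\<phi> v)"
  unfolding \<phi>_def
proof (rule tmul_omega_rfac[of _ 1])
  show "cross 1 n (tmul v \<omega>) \<in> Tp d (n + 1)"
    using cross_in_Tp[OF tmul_in_Tp[OF assms omega_Tp]] by (simp only: add.commute)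
  fix i assume i: "1 \<le> i" "i < n"
  have "tmul v \<omega> \<in> img (1 + i) (1 + n)"
    by (rule img_tmul_right[OF _ assms i(1)]) (use omega_U i in \<open>auto simp: Ups_iff\<close>)
  then have "cross 1 n (tmul v \<omega>) \<in> img i (1 + n)"
    using i by (intro img_cross_shift) auto
  then show "cross 1 n (tmul v \<omega>) \<in> img i (n + 1)" by (simp only: add.commute)
qed

lemma cross_omega_cancel:
  assumes "v \<in> Tp d 1" "cross 1 n (tmul v \<omega>) = 0"
  shows "v = 0"
proof -
  have "tmul v \<omega> = 0"
    by (rule cross_inj[OF tmul_in_Tp[OF assms(1) omega_Tp] _ _ assms(2)]) auto
  then show ?thesis by (rule tmul_right_omega_cancel[OF assms(1)])
qed

lemma phi_eq_0: "v \<in> Tp d 1 \<Longrightarrow> \<phi> v = 0 \<Longrightarrow> v = 0"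
  by (rule cross_omega_cancel) (simp_all only: cross_omega tmul_zero_right)

lemma unit_letter: "v \<in> words d 1 \<Longrightarrow> unit_tensor v \<in> Tp d 1"
  by (rule unit_tensor_in_Tp)

lemma sum_unit_tensor_apply:
  "finite A \<Longrightarrow> (\<Sum>v\<in>A. fscale (c v) (unit_tensor v)) w = (if w \<in> A then c w else 0)"
  by (simp add: sum_tensor_apply tensor_apply unit_tensor_def if_distrib sum.delta cong: if_cong)

text \<open>At each word \<open>u\<close> the relation becomes a linear dependence among the images
  of the letters under \<open>\<phi>\<close>, which injectivity excludes.\<close>

lemma tmul_phi_independent:
  assumes "\<And>v. v \<in> words d 1 \<Longrightarrow> z v \<in> Tp d m"
    and "(\<Sum>v\<in>words d 1. tmul (z v) (\<phi> (unit_tensor v))) = 0" and "v \<in> words d 1"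
  shows "z v = 0"
proof (rule Tp_eqI[OF assms(1)[OF assms(3)] Tp_0])
  fix u assume u: "u \<in> words d m"
  define c where "c = (\<Sum>v\<in>words d 1. fscale (z v u) (unit_tensor v))"
  have c: "c \<in> Tp d 1" unfolding c_def by (intro Tp_sum Tp_scale unit_letter)
  have "\<phi> c = (\<Sum>v\<in>words d 1. fscale (z v u) (\<phi> (unit_tensor v)))"
  proof -
    have "\<phi> (\<Sum>v\<in>A. f v) = (\<Sum>v\<in>A. \<phi> (f v))" for A and f :: "nat list \<Rightarrow> 'k tensor"
      using phi_scale[of 0 0] by (induction A rule: infinite_finite_induct) (simp_all add: phi_add)
    then show ?thesis by (simp add: c_def phi_scale)
  qed
  also have "\<dots> = lsl u (\<Sum>v\<in>words d 1. tmul (z v) (\<phi> (unit_tensor v)))"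
  proof -
    have "lsl u (\<Sum>v\<in>A. f v) = (\<Sum>v\<in>A. lsl u (f v))" for A and f :: "nat list \<Rightarrow> 'k tensor"
      by (induction A rule: infinite_finite_induct) (simp_all add: lsl_add)
    moreover have "lsl u (tmul (z v) y) = fscale (z v u) y" if "v \<in> words d 1" for v y
      by (rule lsl_tmul[OF assms(1)[OF that]]) (use u in \<open>simp add: words_def\<close>)
    ultimately show ?thesis by simp
  qed
  finally have "\<phi> c = 0" unfolding assms(2) by simp
  then have "c = 0" by (rule phi_eq_0[OF c])
  moreover have "c v = z v u" unfolding c_def using assms(3) by (simp add: sum_unit_tensor_apply)
  ultimately show "z v u = 0 u" by (simp add: tensor_apply)
qed

end

section \<open>Nondegeneracy when the next component vanishes\<close>

locale hecke_frobenius = hecke_top d r q n \<omega>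
  for d r and q :: "'k::field" and n \<omega> +
  assumes U_Suc_n: "U (n + 1) = {0}"
begin

lemma U_above: "p > n \<Longrightarrow> U p = {0}"
proof (rule equalityI[OF subsetI])
  fix x assume p: "p > n" and x: "x \<in> U p"
  then obtain m where m: "p = (n + 1) + m" by (metis Suc_eq_plus1 less_iff_Suc_add add_Suc)
  have "x = 0"
  proof (rule tensor_eqI_rsl[of _ d "n + 1" m])
    fix v assume "v \<in> words d m"
    then have "rsl v x \<in> U (n + 1)" using x unfolding m by (intro U_rsl) (auto simp: words_def)
    then show "rsl v x = rsl v 0" using U_Suc_n by simp
  qed (use x m U_Tp Tp_0 in blast)+
  then show "x \<in> {0}" by simp
qed (simp add: U_0)

text \<open>Write \<open>a = \<Sum> a\<^sub>i e\<^sub>i\<close>. Products of degree \<open>n + 1\<close> vanish, so the recursion turns the hypothesis on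
  \<open>a\<close> into one on the image of \<open>a \<omega>\<close> under the crossing of \<open>e\<^sub>i\<close> with \<open>\<omega>\<close>, which is \<open>\<Sum> a\<^sub>i \<omega> \<phi>(e\<^sub>i)\<close>;
  since \<open>\<phi>\<close> is injective, each \<open>a\<^sub>i\<close> satisfies the hypothesis as well.\<close>

lemma Y_omega_nondegenerate:
  assumes "k \<le> n" "a \<in> U k" "Y 0 k (n - k) (tmul a \<omega>) = 0"
  shows "a = 0"
  using assms
proof (induction k arbitrary: a)
  case 0
  then have "tmul a \<omega> = 0" by simp
  then show ?case by (rule tmul_right_omega_cancel[OF U_Tp[OF 0(2)]])
next
  case (Suc k)
  define l where "l = n - Suc k"
  have l: "n = k + Suc l" "n - k = Suc l" using Suc.prems(1) by (auto simp: l_def)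
  let ?x = "tmul a \<omega>"
  have aT: "a \<in> Tp d (Suc k)" "a \<in> Tp d (k + 1)" using U_Tp[OF Suc.prems(2)] by simp_all
  have xT: "?x \<in> Tp d (Suc k + n)" by (rule tmul_in_Tp[OF aT(1) omega_Tp])
  \<comment> \<open>The first n + 1 factors satisfy all conditions after this shuffle, so cutting
    off the remaining \<open>k\<close> leaves slices in \<open>U (n + 1)\<close>. With the
    hypothesis on \<open>a\<close>, the recursion then leaves only the shuffles that end with the
    last letter of \<open>a\<close>.\<close>
  have "Y 0 (Suc k) (Suc l) ?x = 0"
  proof (rule tensor_eqI_rsl[of _ d "n + 1" k])
    fix v assume v: "v \<in> words d k"
    have "rsl v (Y 0 (Suc k) (Suc l) ?x) \<in> U (n + 1)"
    proof (rule rsl_in_U[of _ _ k])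
      show T: "Y 0 (Suc k) (Suc l) ?x \<in> Tp d (n + 1 + k)"
        using Y_in_Tp[OF xT] by (simp add: ac_simps del: Y.simps)
      show "length v = k" using v by (simp add: words_def)
      fix i assume i: "1 \<le> i" "i < n + 1"
      have "Y 0 (Suc k) (Suc l) ?x \<in> img i (Suc k + n)"
      proof (rule Y_img[OF xT])
        fix j assume "1 \<le> j" "j < Suc k + Suc l" "j \<noteq> Suc k"
        then show "?x \<in> img j (Suc k + n)"
          using l by (intro tmul_U_img[OF Suc.prems(2) omega_U]) auto
      qed (use i l in auto)
      then show "Y 0 (Suc k) (Suc l) ?x \<in> img i (n + 1 + k)" by (simp add: ac_simps del: Y.simps)
    qed
    then show "rsl v (Y 0 (Suc k) (Suc l) ?x) = rsl v 0" using U_Suc_n by simp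
  qed (use Y_in_Tp[OF xT, of 0 "Suc k" "Suc l"] Tp_0 in \<open>simp_all add: ac_simps del: Y.simps\<close>)
  moreover have "Y 0 (Suc k) l ?x = 0" using Suc.prems(3) by (simp add: l_def)
  ultimately have "fscale ((-1) ^ Suc l) (Y 0 k (Suc l) (cross (Suc k) (Suc l) ?x)) = 0"
    unfolding Y.simps by (simp del: cross.simps)
  then have "Y 0 k (Suc l) (cross (Suc k) (Suc l) ?x) = 0"
    unfolding fs.scale_eq_0_iff by simp
  \<comment> \<open>So far the last letter of \<open>a\<close> has crossed only \<open>Suc l\<close>
    factors of \<open>\<omega>\<close>. The remaining \<open>k\<close> crossings take place to the
    right of everything that \<open>Y 0 k (Suc l)\<close> touches, so they may be added outside and
    moved inside, which completes the crossing.\<close>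
  then have "0 = cross (Suc k + Suc l) k (Y 0 k (Suc l) (cross (Suc k) (Suc l) ?x))"
    by simp
  also have "\<dots> = Y 0 k (Suc l) (cross (Suc k + Suc l) k (cross (Suc k) (Suc l) ?x))"
    by (rule Y_cross_commute) simp
  also have "cross (Suc k + Suc l) k (cross (Suc k) (Suc l) ?x) = cross (Suc k) n ?x"
    unfolding cross_append l(1) by (simp only: add.commute)
  finally have E: "Y 0 k (Suc l) (cross (Suc k) n ?x) = 0" ..
  define z where "z v = Y 0 k (Suc l) (tmul (rsl v a) \<omega>)" for v
  have rT: "rsl v a \<in> Tp d k" if "v \<in> words d 1" for v
    using that by (intro rsl_in_Tp[OF aT(2)]) (simp add: words_def)
  have zT: "z v \<in> Tp d (k + n)" if "v \<in> words d 1" for v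
    unfolding z_def by (intro Y_in_Tp tmul_in_Tp omega_Tp rT that)
  have "Y 0 k (Suc l) (cross (Suc k) n ?x) = (\<Sum>v\<in>words d 1. tmul (z v) (\<phi> (unit_tensor v)))"
  proof -
    have "?x = (\<Sum>v\<in>words d 1. tmul (rsl v a) (tmul (unit_tensor v) \<omega>))"
      by (subst tmul_rsl_expand[OF aT(2)]) (simp only: tmul_sum_left tmul_assoc)
    then have "Y 0 k (Suc l) (cross (Suc k) n ?x) =
      (\<Sum>v\<in>words d 1. Y 0 k (Suc l) (cross (k + 1) n (tmul (rsl v a) (tmul (unit_tensor v) \<omega>))))"
      by (simp only: cross_sum Y_sum Suc_eq_plus1)
    also have "\<dots> = (\<Sum>v\<in>words d 1. tmul (z v) (\<phi> (unit_tensor v)))"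
    proof (rule sum.cong[OF refl])
      fix v assume v: "v \<in> words d 1"
      have "cross (k + 1) n (tmul (rsl v a) (tmul (unit_tensor v) \<omega>)) =
          tmul (rsl v a) (cross 1 n (tmul (unit_tensor v) \<omega>))"
        by (rule cross_tmul_right[OF rT[OF v] tmul_in_Tp[OF unit_letter[OF v] omega_Tp]]) simp
      also have "\<dots> = tmul (tmul (rsl v a) \<omega>) (\<phi> (unit_tensor v))"
        unfolding cross_omega[OF unit_letter[OF v]] tmul_assoc ..
      finally show "Y 0 k (Suc l) (cross (k + 1) n (tmul (rsl v a) (tmul (unit_tensor v) \<omega>))) =
          tmul (z v) (\<phi> (unit_tensor v))"
        unfolding z_def
        by (simp only:) (rule Y_tmul_left[OF tmul_in_Tp[OF rT[OF v] omega_Tp] phi_in_Tp[OF unit_letter[OF v]]], use l in simp)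
    qed
    finally show ?thesis .
  qed
  with E have z0: "(\<Sum>v\<in>words d 1. tmul (z v) (\<phi> (unit_tensor v))) = 0" by simp
  show ?case
  proof (rule tensor_eqI_rsl[OF aT(2) Tp_0])
    fix v assume v: "v \<in> words d 1"
    have "rsl v a \<in> U k"
      using Suc.prems(2) v by (intro U_rsl[of a k 1]) (simp_all add: words_def)
    moreover have "Y 0 k (n - k) (tmul (rsl v a) \<omega>) = 0"
      using tmul_phi_independent[OF zT z0 v] by (simp only: z_def l(2))
    ultimately have "rsl v a = 0" using Suc.IH Suc.prems(1) by simp
    then show "rsl v a = rsl v 0" by simp
  qed
qed

text \<open>The span of the left factors of \<open>\<omega>\<close> of degree \<open>k\<close>: the
  smallest space W such that \<open>\<omega>\<close> lies in the product of W with the tensors of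
  degree n - k.\<close>

definition left_support :: "nat \<Rightarrow> 'k tensor set" where
  "left_support k = fs.span ((\<lambda>v. rsl v \<omega>) ` words d (n - k))"

definition right_support :: "nat \<Rightarrow> 'k tensor set" where
  "right_support k = fs.span ((\<lambda>u. lsl u \<omega>) ` words d (n - k))"

lemma left_support_subset: "k \<le> n \<Longrightarrow> left_support k \<subseteq> U k"
  unfolding left_support_def
  by (rule fs.span_minimal[OF _ subspace_Ups])
    (use omega_U U_rsl[of \<omega> k "n - k"] in \<open>auto simp: words_def\<close>)

lemma right_support_subset: "k \<le> n \<Longrightarrow> right_support k \<subseteq> U k"
  unfolding right_support_def
  by (rule fs.span_minimal[OF _ subspace_Ups])
    (use omega_U U_lsl[of \<omega> "n - k" k] in \<open>auto simp: words_def\<close>)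

lemma U_subset_Tp: "U p \<subseteq> Tp d p"
  using U_Tp by blast

text \<open>The argument \<open>b\<close> comes first, so that \<open>form j k b\<close> is a
  functional on \<open>U j\<close> indexed by \<open>b\<close>, the shape required by
  \<open>dim_le_card_separating\<close>.\<close>

definition form :: "nat \<Rightarrow> nat \<Rightarrow> 'k tensor \<Rightarrow> 'k tensor \<Rightarrow> 'k" where
  "form j k b a = Y 0 j k (tmul a b) pivot"

lemma form_add_right: "form j k b (x + y) = form j k b x + form j k b y"
  and form_add_left: "form j k (x + y) a = form j k x a + form j k y a"
  and form_scale_right: "form j k b (fscale c x) = c * form j k b x"
  and form_scale_left: "form j k (fscale c x) a = c * form j k x a"
  by (simp_all add: form_def tmul_add_left tmul_add_right tmul_scale_left tmul_scale_right Y_add Y_scale tensor_apply)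

lemma subspace_form: "fs.subspace {b. form j k b a = 0}"
  unfolding fs.subspace_def
  by (simp add: form_add_left form_scale_left) (simp add: form_def tensor_apply)

lemma form_eq_0_iff:
  assumes "j + k = n" "a \<in> U j" "b \<in> U k"
  shows "form j k b a = 0 \<longleftrightarrow> Y 0 j k (tmul a b) = 0"
  using U_n_eq_0[of "Y 0 j k (tmul a b)"] Y_in_U[OF assms(2,3)] assms(1)
  by (auto simp: form_def tensor_apply)

text \<open>Expanding \<open>\<omega>\<close> by its last letters turns
  \<open>Y 0 j k (tmul a \<omega>)\<close> into products of \<open>a\<close> with left factors of
  \<open>\<omega>\<close>, so \<open>Y_omega_nondegenerate\<close> applies. \<open>B\<close> is kept
  general: it will be a basis of the left support, a basis of \<open>U k\<close>, or
  \<open>U k\<close> itself.\<close>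

lemma form_separating:
  assumes "j + k = n" "a \<in> U j" "left_support k \<subseteq> fs.span B" "\<And>b. b \<in> B \<Longrightarrow> form j k b a = 0"
  shows "a = 0"
proof (rule Y_omega_nondegenerate[OF _ assms(2)])
  show "j \<le> n" using assms(1) by simp
  have wT: "\<omega> \<in> Tp d (k + j)" using omega_Tp assms(1) by (simp add: add.commute)
  have "fs.span B \<subseteq> {b. form j k b a = 0}"
    by (rule fs.span_minimal[OF _ subspace_form]) (use assms(4) in blast)
  then have "form j k (rsl v \<omega>) a = 0" if "v \<in> words d j" for v
  proof -
    have "n - k = j" using assms(1) by simp
    then have "rsl v \<omega> \<in> left_support k"
      unfolding left_support_def using that by (intro fs.span_base) auto
    then show ?thesis using assms(3) \<open>fs.span B \<subseteq> _\<close> by blast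
  qed
  moreover have rU: "rsl v \<omega> \<in> U k" if "v \<in> words d j" for v
    using omega_U assms(1) that by (intro U_rsl[of _ k j]) (auto simp: words_def add.commute)
  ultimately have 0: "Y 0 j k (tmul a (rsl v \<omega>)) = 0" if "v \<in> words d j" for v
    using form_eq_0_iff[OF assms(1,2)] that by blast
  have "tmul a \<omega> = (\<Sum>v\<in>words d j. tmul (tmul a (rsl v \<omega>)) (unit_tensor v))"
    by (subst tmul_rsl_expand[OF wT]) (simp only: tmul_sum_right tmul_assoc)
  then have "Y 0 j k (tmul a \<omega>) = (\<Sum>v\<in>words d j. Y 0 j k (tmul (tmul a (rsl v \<omega>)) (unit_tensor v)))"
    by (simp only: Y_sum)
  also have "\<dots> = 0"
  proof (rule sum.neutral, rule ballI)
    fix v assume v: "v \<in> words d j"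
    have "Y 0 j k (tmul (tmul a (rsl v \<omega>)) (unit_tensor v)) = tmul (Y 0 j k (tmul a (rsl v \<omega>))) (unit_tensor v)"
      by (rule Y_tmul_left[OF tmul_in_Tp[OF U_Tp[OF assms(2)] U_Tp[OF rU[OF v]]] unit_tensor_in_Tp[OF v]]) simp
    then show "Y 0 j k (tmul (tmul a (rsl v \<omega>)) (unit_tensor v)) = 0" using 0[OF v] by simp
  qed
  finally show "Y 0 j (n - j) (tmul a \<omega>) = 0" using assms(1) by auto
qed

lemma dim_U_le:
  assumes "j + k = n" "finite B" "left_support k \<subseteq> fs.span B"
  shows "fs.dim (U j) \<le> card B"
  by (rule dim_le_card_separating[OF U_subset_Tp subspace_Ups assms(2), of "form j k"])
    (use form_separating[OF assms(1) _ assms(3)] in \<open>auto simp: form_add_right form_scale_right\<close>)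

text \<open>Together with their versions for exchanged \<open>j\<close> and \<open>k\<close>, these
  inequalities close up to a cycle, so all of them are equalities.\<close>

lemma dim_left_support:
  assumes "j + k = n"
  shows "fs.dim (U j) \<le> fs.dim (left_support k)" and "fs.dim (left_support k) \<le> fs.dim (U k)"
proof -
  have sub: "left_support k \<subseteq> U k" by (rule left_support_subset) (use assms in simp)
  obtain C where C: "finite C" "left_support k \<subseteq> fs.span C" "card C = fs.dim (left_support k)"
    using finite_basis_Tp[of "left_support k" d k] sub U_subset_Tp by (metis order_trans)
  show "fs.dim (U j) \<le> fs.dim (left_support k)"
    using dim_U_le[OF assms C(1,2)] C(3) by simp
  obtain D where D: "finite D" "U k \<subseteq> fs.span D" "card D = fs.dim (U k)"
    using finite_basis_Tp[OF U_subset_Tp[of k]] by metis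
  show "fs.dim (left_support k) \<le> fs.dim (U k)"
    using fs.dim_le_card[of "left_support k" D] sub D by auto
qed

lemma dim_U_symmetric: "j + k = n \<Longrightarrow> fs.dim (U j) = fs.dim (U k)"
  using dim_left_support[of j k] dim_left_support[of k j] by simp

lemma left_support_eq:
  assumes "k \<le> n"
  shows "left_support k = U k"
proof (rule subspace_eq_if_dim_le[OF U_subset_Tp left_support_subset[OF assms]])
  show "fs.subspace (left_support k)" by (simp add: left_support_def)
  show "fs.dim (U k) \<le> fs.dim (left_support k)"
    using dim_left_support(1)[of "n - k" k] dim_U_symmetric[of "n - k" k] assms by simp
qed

lemma star_left_nondegenerate:
  assumes "j + k = n" "a \<in> U j" "\<And>b. b \<in> U k \<Longrightarrow> Y 0 j k (tmul a b) = 0"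
  shows "a = 0"
proof (rule form_separating[OF assms(1,2), of "U k"])
  show "left_support k \<subseteq> fs.span (U k)"
    using left_support_subset[of k] assms(1) fs.span_superset by auto
  show "form j k b a = 0" if "b \<in> U k" for b using assms(3)[OF that] by (simp add: form_def tensor_apply)
qed

text \<open>A nonzero \<open>b\<close> annihilated from the left could be put into a basis of
  \<open>U k\<close>. The other basis vectors would then already separate \<open>U j\<close>, which
  is one functional too few for its dimension.\<close>

lemma star_right_nondegenerate:
  assumes "j + k = n" "b \<in> U k" "\<And>a. a \<in> U j \<Longrightarrow> Y 0 j k (tmul a b) = 0"
  shows "b = 0"
proof (rule ccontr)
  assume "b \<noteq> 0"
  then have "fs.independent {b}" by simp
  then obtain B where B: "{b} \<subseteq> B" "B \<subseteq> U k" "fs.independent B" "U k \<subseteq> fs.span B"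
    using fs.maximal_independent_subset_extend[of "{b}" "U k"] assms(2) by auto
  have card: "card B = fs.dim (U k)" by (rule fs.basis_card_eq_dim[OF B(2,4,3)])
  obtain D where D: "finite D" "U k \<subseteq> fs.span D"
    using finite_basis_Tp[OF U_subset_Tp[of k]] by metis
  have fin: "finite B" using fs.independent_span_bound[OF D(1) B(3)] B(2) D(2) by blast
  have "fs.dim (U j) \<le> card (B - {b})"
  proof (rule dim_le_card_separating[OF U_subset_Tp subspace_Ups, of _ "form j k"])
    fix a assume a: "a \<in> U j" "\<And>b'. b' \<in> B - {b} \<Longrightarrow> form j k b' a = 0"
    show "a = 0"
    proof (rule form_separating[OF assms(1) a(1), of B])
      show "left_support k \<subseteq> fs.span B"
        using left_support_subset[of k] assms(1) B(4) by auto
      show "form j k b' a = 0" if "b' \<in> B" for b'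
        using a that assms(3)[OF a(1)] by (cases "b' = b") (auto simp: form_def tensor_apply)
    qed
  qed (use fin in \<open>auto simp: form_add_right form_scale_right\<close>)
  moreover have "card (B - {b}) < card B" using B(1) fin by (intro card_Diff1_less) auto
  ultimately show False using card dim_U_symmetric[OF assms(1)] by simp
qed

text \<open>The argument for the left support is not mirrored. Instead
  \<open>Y 0 k j (tmul a \<omega>) = tmul \<omega> (\<psi> a)\<close> yields a map
  \<open>\<psi>\<close> of \<open>U k\<close> into the right support, injective by
  \<open>Y_omega_nondegenerate\<close>.\<close>

lemma right_support_eq:
  assumes "k \<le> n"
  shows "right_support k = U k"
proof -
  define j where "j = n - k"
  have j: "k + j = n" "n - k = j" "j + k = n" using assms by (auto simp: j_def)
  define \<psi> where "\<psi> a = rfac (Y 0 k j (tmul a \<omega>))" for a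
  have lin: "Vector_Spaces.linear fscale fscale \<psi>"
    by (rule linear_fscaleI)
      (simp_all add: \<psi>_def rfac_add rfac_scale Y_add Y_scale tmul_add_left tmul_scale_left)
  have wT: "\<omega> \<in> Tp d (j + k)" using omega_Tp j by simp
  show ?thesis
  proof (rule injective_image_spans[OF U_subset_Tp subspace_Ups _ right_support_subset[OF assms] lin])
    show "fs.subspace (right_support k)" by (simp add: right_support_def)
    fix a assume a: "a \<in> U k"
    have aT: "a \<in> Tp d k" by (rule U_Tp[OF a])
    have T: "tmul a \<omega> \<in> Tp d (k + n)" by (rule tmul_in_Tp[OF aT omega_Tp])
    have "Y 0 k j (tmul a \<omega>) = tmul \<omega> (\<psi> a)"
      unfolding \<psi>_def
    proof (rule tmul_omega_rfac[of _ k])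
      show "Y 0 k j (tmul a \<omega>) \<in> Tp d (n + k)" using Y_in_Tp[OF T] by (simp add: add.commute)
      fix i assume i: "1 \<le> i" "i < n"
      have "Y 0 k j (tmul a \<omega>) \<in> img i (k + n)"
      proof (rule Y_img[OF T])
        fix i' assume "1 \<le> i'" "i' < k + j" "i' \<noteq> k"
        then show "tmul a \<omega> \<in> img i' (k + n)"
          using j(1) by (intro tmul_U_img[OF a omega_U]) simp_all
      qed (use i j(1) in simp_all)
      then show "Y 0 k j (tmul a \<omega>) \<in> img i (n + k)" by (simp add: add.commute)
    qed
    then have "Y 0 k (n - k) (tmul a \<omega>) = 0" if "\<psi> a = 0"
      using that j(2) by simp
    then show "a = 0" if "\<psi> a = 0"
      using that by (intro Y_omega_nondegenerate[OF assms a])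
    \<comment> \<open>Only the first \<open>j\<close> letters of \<open>\<omega>\<close> are
      shuffled with \<open>a\<close>; the right factor \<open>lsl u \<omega>\<close> rides along,
      and \<open>rfac\<close> returns a multiple of it.\<close>
    have "tmul a \<omega> = (\<Sum>u\<in>words d j. tmul (tmul a (unit_tensor u)) (lsl u \<omega>))"
      by (subst tmul_lsl_expand[OF wT]) (simp only: tmul_sum_right tmul_assoc)
    then have "Y 0 k j (tmul a \<omega>) = (\<Sum>u\<in>words d j. Y 0 k j (tmul (tmul a (unit_tensor u)) (lsl u \<omega>)))"
      by (simp only: Y_sum)
    also have "\<dots> = (\<Sum>u\<in>words d j. tmul (Y 0 k j (tmul a (unit_tensor u))) (lsl u \<omega>))"
    proof (rule sum.cong[OF refl])
      fix u assume u: "u \<in> words d j"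
      show "Y 0 k j (tmul (tmul a (unit_tensor u)) (lsl u \<omega>)) = tmul (Y 0 k j (tmul a (unit_tensor u))) (lsl u \<omega>)"
        by (rule Y_tmul_left[OF tmul_in_Tp[OF aT unit_tensor_in_Tp[OF u]] lsl_in_Tp[OF wT]])
          (use u in \<open>auto simp: words_def\<close>)
    qed
    finally have "\<psi> a = (\<Sum>u\<in>words d j. rfac (tmul (Y 0 k j (tmul a (unit_tensor u))) (lsl u \<omega>)))"
      by (simp only: \<psi>_def rfac_sum)
    moreover have "rfac (tmul (Y 0 k j (tmul a (unit_tensor u))) (lsl u \<omega>)) \<in> right_support k"
      if u: "u \<in> words d j" for u
    proof -
      have "Y 0 k j (tmul a (unit_tensor u)) \<in> Tp d n"
        using Y_in_Tp[OF tmul_in_Tp[OF aT unit_tensor_in_Tp[OF u]]] j by simp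
      from lsl_tmul[OF this length_pivot] show ?thesis
        unfolding rfac_def right_support_def j(2)
        by (simp only:) (intro fs.span_scale fs.span_base imageI u)
    qed
    ultimately show "\<psi> a \<in> right_support k"
      unfolding right_support_def by (simp only: fs.span_sum)
  qed
qed

end

section \<open>Vanishing of the next component when dim V > 1\<close>

context hecke_top begin

text \<open>Slice \<open>x = tmul \<omega> (rfac x)\<close> by its first letter: the left side lies
  in \<open>U n\<close> and so is a multiple of \<open>\<omega>\<close>, while on the right only
  \<open>\<omega>\<close> is sliced.\<close>

lemma omega_factor:
  assumes x: "x \<in> U (n + 1)" "x \<noteq> 0"
  obtains \<omega>' where "\<omega>' \<in> U (n - 1)" "\<omega> = tmul \<omega>' (rfac x)"
proof -
  let ?w = "rfac x"
  have xT: "x \<in> Tp d (n + 1)" by (rule U_Tp[OF x(1)])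
  have wT: "?w \<in> Tp d 1" by (rule rfac_in_Tp[OF xT])
  have xw: "x = tmul \<omega> ?w"
    by (rule tmul_omega_rfac[OF xT]) (use x(1) in \<open>auto simp: Ups_iff\<close>)
  have x': "x \<in> U (1 + n)" using x(1) by (simp add: add.commute)
  obtain u where u: "u \<in> words d 1" "lsl u x \<noteq> 0"
    using tensor_eqI_lsl[OF U_Tp[OF x'] Tp_0] x(2) by auto
  have lu: "length u = 1" using u(1) by (simp add: words_def)
  obtain c where c: "lsl u x = fscale c \<omega>"
    using U_lsl[OF x' lu] U_n by blast
  then have c0: "c \<noteq> 0" using u(2) by auto
  define \<omega>' where "\<omega>' = fscale (1 / c) (lsl u \<omega>)"
  have n1: "n = 1 + (n - 1)" "n = (n - 1) + 1" using n_pos by auto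
  have w'T: "\<omega>' \<in> Tp d (n - 1)"
    unfolding \<omega>'_def using omega_Tp n1(1) lu by (intro Tp_scale lsl_in_Tp[of _ _ 1]) simp_all
  have wT': "\<omega> \<in> Tp d ((n - 1) + 1)" using omega_Tp n1 by simp
  have w: "\<omega> = tmul \<omega>' ?w"
  proof (rule Tp_eqI[OF wT' tmul_in_Tp[OF w'T wT]])
    fix t assume t: "t \<in> words d (n - 1 + 1)"
    define s b where "s = take (n - 1) t" and "b = drop (n - 1) t"
    have tb: "t = s @ b" "length s = n - 1" using t by (auto simp: s_def b_def words_def)
    have "c * \<omega> t = x (u @ t)" using fun_cong[OF c, of t] by (simp add: lsl_apply tensor_apply)
    also have "\<dots> = tmul \<omega> ?w ((u @ s) @ b)" using xw tb by simp
    also have "\<dots> = \<omega> (u @ s) * ?w b"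
      by (rule tmul_append[OF omega_Tp]) (use tb lu n1 in simp)
    also have "\<dots> = c * (\<omega>' s * ?w b)" using c0 by (simp add: \<omega>'_def tensor_apply lsl_apply)
    also have "\<omega>' s * ?w b = tmul \<omega>' ?w t"
      unfolding tb(1) by (rule tmul_append[OF w'T tb(2), symmetric])
    finally show "\<omega> t = tmul \<omega>' ?w t" using c0 by simp
  qed
  have "?w \<noteq> 0" using w omega_nonzero by auto
  then obtain b where b: "?w b \<noteq> 0" by (auto simp: fun_eq_iff tensor_apply)
  then have lb: "length b = 1" using Tp_outside[OF wT, of b] by (auto simp: words_def)
  have "rsl b \<omega> = fscale (?w b) \<omega>'"
    using rsl_tmul[OF w'T wT lb] w by simp
  then have "\<omega>' = fscale (1 / ?w b) (rsl b \<omega>)" using b by simp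
  moreover have "rsl b \<omega> \<in> U (n - 1)"
    using omega_U n1(2) lb by (intro U_rsl[of _ _ 1]) simp_all
  ultimately have "\<omega>' \<in> U (n - 1)" using U_scale by simp
  with w that show ?thesis by blast
qed

text \<open>The line is spanned by a slice of \<open>\<omega>\<close> that does not depend on
  \<open>x\<close>: for nonzero \<open>x\<close>, \<open>omega_factor\<close> makes this slice a
  multiple of \<open>rfac x\<close>, and it does not vanish at the last letter of
  \<open>pivot\<close>.\<close>

lemma rfac_line:
  assumes "x \<in> U (n + 1)"
  obtains c where "rfac x = fscale c (lsl (butlast pivot) \<omega>)"
proof (cases "x = 0")
  case True
  then show ?thesis using that[of 0] by (simp add: rfac_def)
next
  case False
  then obtain \<omega>' where w: "\<omega>' \<in> U (n - 1)" "\<omega> = tmul \<omega>' (rfac x)"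
    using omega_factor[OF assms] by metis
  have *: "lsl (butlast pivot) \<omega> = fscale (\<omega>' (butlast pivot)) (rfac x)"
    by (subst w(2), rule lsl_tmul[OF U_Tp[OF w(1)]]) (simp add: length_pivot)
  have "pivot \<noteq> []" using length_pivot n_pos by auto
  then have "lsl (butlast pivot) \<omega> [last pivot] \<noteq> 0" using omega_pivot by (simp add: lsl_apply)
  then have "\<omega>' (butlast pivot) \<noteq> 0" unfolding * by (simp add: tensor_apply)
  then have "rfac x = fscale (1 / \<omega>' (butlast pivot)) (lsl (butlast pivot) \<omega>)"
    unfolding * by simp
  then show ?thesis by (rule that)
qed

text \<open>A nonzero element of \<open>U (n + 1)\<close> would force \<open>\<phi>\<close> to map \<open>V\<close> into a line.\<close>

theorem U_Suc_n_trivial: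
  assumes "d > 1"
  shows "U (n + 1) = {0}"
proof (rule ccontr)
  assume "U (n + 1) \<noteq> {0}"
  then obtain x where x: "x \<in> U (n + 1)" "x \<noteq> 0" using U_0[of "n + 1"] by auto
  obtain \<omega>' where w: "\<omega>' \<in> U (n - 1)" "\<omega> = tmul \<omega>' (rfac x)"
    using omega_factor[OF x] .
  let ?e = "lsl (butlast pivot) \<omega>"
  obtain cx where cx: "rfac x = fscale cx ?e" using rfac_line[OF x(1)] .
  obtain m where m: "n = Suc m" using n_pos by (cases n) auto
  have line: "\<exists>c. \<phi> v = fscale c ?e" if v: "v \<in> Tp d 1" for v
  proof -
    have vU: "v \<in> U 1" using v by (simp add: Ups_iff)
    have z: "Y 0 1 n (tmul v \<omega>) \<in> U (n + 1)" using Y_in_U[OF vU omega_U] by (simp only: add.commute)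
    obtain cz where cz: "rfac (Y 0 1 n (tmul v \<omega>)) = fscale cz ?e" using rfac_line[OF z] .
    have "Y 0 1 n (tmul v \<omega>) = tmul \<omega> (rfac (Y 0 1 n (tmul v \<omega>)))"
      by (rule tmul_omega_rfac[OF U_Tp[OF z]]) (use z in \<open>auto simp: Ups_iff\<close>)
    then have z1: "Y 0 1 n (tmul v \<omega>) = tmul \<omega> (fscale cz ?e)" using cz by simp
    have wU: "\<omega>' \<in> U m" using w(1) m by simp
    \<comment> \<open>Shuffling \<open>v\<close> into the first n - 1 letters of
      \<open>\<omega>\<close> is its product with \<open>\<omega>'\<close>, an element of the line
      \<open>U n\<close>; the last factor \<open>rfac x\<close> is untouched.\<close>
    have "Y 0 1 m (tmul v \<omega>) = Y 0 1 m (tmul (tmul v \<omega>') (rfac x))"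
      by (subst w(2)) (simp only: tmul_assoc)
    also have "\<dots> = tmul (Y 0 1 m (tmul v \<omega>')) (rfac x)"
      by (rule Y_tmul_left[OF tmul_in_Tp[OF v U_Tp[OF wU]] rfac_in_Tp[OF U_Tp[OF x(1)]]]) simp
    also obtain c' where "Y 0 1 m (tmul v \<omega>') = fscale c' \<omega>"
      using Y_in_U[OF vU wU] U_n m by auto
    finally have y: "Y 0 1 m (tmul v \<omega>) = tmul \<omega> (fscale (c' * cx) ?e)"
      unfolding cx by (simp add: tmul_scale_left tmul_scale_right)
    \<comment> \<open>All terms of the recursion begin with \<open>\<omega>\<close>; cancelling it
      expresses \<open>\<phi> v\<close> by multiples of the fixed vector \<open>?e\<close>.\<close>
    have "Y 0 1 n (tmul v \<omega>) = fscale q (Y 0 1 m (tmul v \<omega>)) + fscale ((-1) ^ n) (cross 1 n (tmul v \<omega>))"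
      unfolding m One_nat_def Y.simps by (simp del: cross.simps)
    also have "\<dots> = tmul \<omega> (fscale (q * (c' * cx)) ?e + fscale ((-1) ^ n) (\<phi> v))"
      unfolding y cross_omega[OF v] by (simp add: tmul_scale_right tmul_add_right)
    finally have "tmul \<omega> (fscale (q * (c' * cx)) ?e + fscale ((-1) ^ n) (\<phi> v) - fscale cz ?e) = 0"
      unfolding z1 tmul_diff_right by simp
    then have "fscale (q * (c' * cx)) ?e + fscale ((-1) ^ n) (\<phi> v) - fscale cz ?e = 0"
      by (rule tmul_left_omega_cancel)
    then have "fscale ((-1) ^ n) (\<phi> v) = fscale (cz - q * (c' * cx)) ?e"
      unfolding fs.scale_left_diff_distrib by (metis add_diff_cancel_left' right_minus_eq)
    from arg_cong[OF this, of "fscale ((-1) ^ n)"]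
    have "\<phi> v = fscale ((-1) ^ n * (cz - q * (c' * cx))) ?e"
      by (simp only: fs.scale_scale power_mult_distrib[symmetric]) simp
    then show ?thesis ..
  qed
  have e01: "unit_tensor [0] \<in> Tp d 1" "unit_tensor [1] \<in> Tp d 1"
    using assms by (simp_all add: unit_tensor_in_Tp words_def)
  obtain c0 where c0: "\<phi> (unit_tensor [0]) = fscale c0 ?e" using line[OF e01(1)] ..
  obtain c1 where c1: "\<phi> (unit_tensor [1]) = fscale c1 ?e" using line[OF e01(2)] ..
  \<comment> \<open>With both images on one line, this combination is in the kernel of
    \<open>\<phi>\<close>. Hence \<open>c0 = 0\<close>, and then the first basis letter itself is in
    the kernel.\<close>
  define v where "v = fscale c1 (unit_tensor [0]) + fscale (- c0) (unit_tensor [1])"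
  have "\<phi> v = 0" unfolding v_def phi_add phi_scale c0 c1 by (simp add: mult.commute)
  then have "v = 0" by (rule phi_eq_0[rotated]) (unfold v_def, intro Tp_add Tp_scale e01)
  from fun_cong[OF this, of "[1]"] have "c0 = 0"
    by (simp add: v_def tensor_apply unit_tensor_def)
  then have "\<phi> (unit_tensor [0]) = 0" using c0 by simp
  then have "unit_tensor [0] = (0 :: 'k tensor)" by (rule phi_eq_0[OF e01(1)])
  from fun_cong[OF this, of "[0]"] show False by (simp add: unit_tensor_def tensor_apply)
qed

end

section \<open>The algebra \<open>\<Upsilon>(V, R)\<close>\<close>

lemma hom_apply: "hom p x w = (if length w = p then x w else 0)"
  by (simp add: hom_def)

lemma tensor_eqI_hom: "(\<And>p. hom p x = hom p y) \<Longrightarrow> x = y"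
  by (metis (no_types, lifting) ext hom_apply)

lemma hom_add: "hom p (x + y) = hom p x + hom p y"
  and hom_diff: "hom p (x - y) = hom p x - hom p y"
  and hom_scale: "hom p (fscale c x) = fscale c (hom p x)"
  and hom_zero [simp]: "hom p 0 = 0"
  by (simp_all add: hom_def fun_eq_iff tensor_apply)

lemma hom_sum: "hom p (\<Sum>i\<in>A. f i) = (\<Sum>i\<in>A. hom p (f i))"
  by (induction A rule: infinite_finite_induct) (simp_all add: hom_add)

lemma hom_Tp: "x \<in> Tp d k \<Longrightarrow> hom p x = (if p = k then x else 0)"
  by (auto simp: hom_def fun_eq_iff tensor_apply in_Tp_iff words_def)

lemma hom_in_Tp: "x \<in> TV d \<Longrightarrow> hom p x \<in> Tp d p"
  by (auto simp: TV_def hom_def Tp_def split: if_splits)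

lemma hom_outside_degs: "p \<notin> degs x \<Longrightarrow> hom p x = 0"
  by (auto simp: degs_def hom_def fun_eq_iff tensor_apply)

lemma finite_degs: "x \<in> TV d \<Longrightarrow> finite (degs x)"
  by (simp add: degs_def TV_def)

lemma sum_hom:
  assumes "finite P" "\<And>p. p \<notin> P \<Longrightarrow> hom p x = 0"
  shows "x = (\<Sum>p\<in>P. hom p x)"
proof
  fix w
  have "x w = hom (length w) x w" by (simp add: hom_apply)
  also have "\<dots> = (\<Sum>p\<in>P. hom p x w)"
  proof (cases "length w \<in> P")
    case True
    then have "(\<Sum>p\<in>P. hom p x w) = (\<Sum>p\<in>{length w}. hom p x w)"
      using assms(1) by (intro sum.mono_neutral_right) (auto simp: hom_apply)
    then show ?thesis by simp
  next
    case False
    then have "(\<Sum>p\<in>P. hom p x w) = 0" by (intro sum.neutral) (auto simp: hom_apply)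
    then show ?thesis using assms(2)[OF False] by (simp add: tensor_apply)
  qed
  finally show "x w = (\<Sum>p\<in>P. hom p x) w" by (simp add: sum_tensor_apply)
qed

lemma subspace_TV: "fs.subspace (TV d)"
  unfolding fs.subspace_def
proof (intro conjI ballI allI)
  show "0 \<in> TV d" by (simp add: TV_def tensor_apply)
  fix x :: "'a tensor" and c assume x: "x \<in> TV d"
  have sub: "{w. fscale c x w \<noteq> 0} \<subseteq> {w. x w \<noteq> 0}" by (auto simp: tensor_apply)
  then have "finite {w. fscale c x w \<noteq> 0}" by (rule finite_subset) (use x in \<open>simp add: TV_def\<close>)
  then show "fscale c x \<in> TV d" using x sub unfolding TV_def by blast
  fix y :: "'a tensor" assume y: "y \<in> TV d"
  have sub: "{w. (x + y) w \<noteq> 0} \<subseteq> {w. x w \<noteq> 0} \<union> {w. y w \<noteq> 0}" by (auto simp: tensor_apply)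
  then have "finite {w. (x + y) w \<noteq> 0}" by (rule finite_subset) (use x y in \<open>simp add: TV_def\<close>)
  then show "x + y \<in> TV d" using x y sub unfolding TV_def by blast
qed

lemma TV_0: "0 \<in> TV d"
  and TV_add: "x \<in> TV d \<Longrightarrow> y \<in> TV d \<Longrightarrow> x + y \<in> TV d"
  and TV_diff: "x \<in> TV d \<Longrightarrow> y \<in> TV d \<Longrightarrow> x - y \<in> TV d"
  and TV_scale: "x \<in> TV d \<Longrightarrow> fscale c x \<in> TV d"
  and TV_sum: "(\<And>i. i \<in> A \<Longrightarrow> f i \<in> TV d) \<Longrightarrow> sum f A \<in> TV d"
  using subspace_TV fs.subspace_0 fs.subspace_add fs.subspace_diff fs.subspace_scale fs.subspace_sum
  by metis+

lemma Tp_TV: "x \<in> Tp d p \<Longrightarrow> x \<in> TV d"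
proof -
  assume x: "x \<in> Tp d p"
  have "finite {w. x w \<noteq> 0}"
    by (rule finite_subset[OF _ finite_words[of d p]]) (use x in \<open>auto simp: in_Tp_iff\<close>)
  then show "x \<in> TV d" using x by (auto simp: TV_def Tp_def)
qed

lemma TV_expand: "x \<in> TV d \<Longrightarrow> x = (\<Sum>p\<in>degs x. hom p x)"
  using sum_hom[OF finite_degs hom_outside_degs] by blast

lemma TV_homI:
  assumes "finite P" "\<And>p. p \<notin> P \<Longrightarrow> hom p x = 0" "\<And>p. p \<in> P \<Longrightarrow> hom p x \<in> S" "fs.subspace S"
  shows "x \<in> S"
  by (subst sum_hom[OF assms(1,2)]) (auto intro: fs.subspace_sum assms(3,4))

lemma tmul_in_TV:
  assumes "x \<in> TV d" "y \<in> TV d"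
  shows "tmul x y \<in> TV d"
proof -
  have "tmul x y = (\<Sum>l\<in>degs y. \<Sum>k\<in>degs x. tmul (hom k x) (hom l y))"
    by (subst TV_expand[OF assms(1)], subst TV_expand[OF assms(2)])
      (simp only: tmul_sum_left tmul_sum_right)
  also have "\<dots> \<in> TV d"
    by (intro TV_sum Tp_TV[OF tmul_in_Tp[OF hom_in_Tp[OF assms(1)] hom_in_Tp[OF assms(2)]]])
  finally show ?thesis .
qed

lemma TV_span_units: "TV d \<subseteq> fs.span (unit_tensor ` {w. set w \<subseteq> {..<d}})"
proof
  fix x :: "'a tensor" assume x: "x \<in> TV d"
  show "x \<in> fs.span (unit_tensor ` {w. set w \<subseteq> {..<d}})"
  proof (rule TV_homI[OF finite_degs[OF x] hom_outside_degs _ fs.subspace_span])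
    fix p
    have "hom p x \<in> fs.span (unit_tensor ` words d p)"
      using Tp_span hom_in_Tp[OF x] by blast
    then show "hom p x \<in> fs.span (unit_tensor ` {w. set w \<subseteq> {..<d}})"
      by (rule subsetD[OF fs.span_mono, rotated]) (auto simp: words_def)
  qed
qed

text \<open>Multiplication by a basis word in the dual is adjoint to slicing by that word. The
  factor \<open>a\<close> may be inhomogeneous: in degree k + l only its part of degree
  \<open>k\<close> is met.\<close>

lemma pairing_tmul_unit_right:
  assumes "v \<in> words d l"
  shows "pairing d (k + l) x (tmul a (unit_tensor v)) = pairing d k (rsl v x) a"
proof -
  have inj: "inj_on (\<lambda>u. u @ v) (words d k)" by (auto intro: inj_onI)
  have lv: "length v = l" using assms by (simp add: words_def)
  have ev: "tmul a (unit_tensor v) w = (if drop k w = v then a (take k w) else 0)"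
    if "w \<in> words d (k + l)" for w
  proof -
    have lw: "length w = k + l" using that by (simp add: words_def)
    have "tmul a (unit_tensor v) w = (\<Sum>j\<le>length w. if j = k then (if drop k w = v then a (take k w) else 0) else 0)"
      unfolding tmul_def
    proof (rule sum.cong[OF refl])
      fix j assume j: "j \<in> {..length w}"
      show "a (take j w) * unit_tensor v (drop j w) =
          (if j = k then (if drop k w = v then a (take k w) else 0) else 0)"
      proof (cases "drop j w = v")
        case True
        have "length w - j = l" using arg_cong[OF True, of length] lv by simp
        then have "j = k" using j lw by simp
        with True show ?thesis by (simp add: unit_tensor_def)
      next
        case False
        then show ?thesis by (cases "j = k") (simp_all add: unit_tensor_def)
      qed
    qed
    then show ?thesis using lw by simp
  qed
  have "pairing d (k + l) x (tmul a (unit_tensor v)) =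
      (\<Sum>w\<in>(\<lambda>u. u @ v) ` words d k. x w * tmul a (unit_tensor v) w)"
    unfolding pairing_def
  proof (rule sum.mono_neutral_right)
    show "(\<lambda>u. u @ v) ` words d k \<subseteq> words d (k + l)" using assms by (auto simp: words_def)
    show "\<forall>w\<in>words d (k + l) - (\<lambda>u. u @ v) ` words d k. x w * tmul a (unit_tensor v) w = 0"
    proof
      fix w assume w: "w \<in> words d (k + l) - (\<lambda>u. u @ v) ` words d k"
      have "drop k w \<noteq> v"
      proof
        assume "drop k w = v"
        then have "w = take k w @ v" by (metis append_take_drop_id)
        moreover have "take k w \<in> words d k"
          using w set_take_subset[of k w] by (auto simp: words_def)
        ultimately show False using w by blast
      qed
      then show "x w * tmul a (unit_tensor v) w = 0" using ev w by simp
    qed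
  qed simp
  also have "\<dots> = (\<Sum>u\<in>words d k. x (u @ v) * a u)"
    unfolding sum.reindex[OF inj] o_def
  proof (rule sum.cong[OF refl])
    fix u assume "u \<in> words d k"
    then show "x (u @ v) * tmul a (unit_tensor v) (u @ v) = x (u @ v) * a u"
      using ev[of "u @ v"] assms by (auto simp: words_def)
  qed
  finally show ?thesis by (simp add: pairing_def rsl_apply)
qed

lemma pairing_tmul_unit_left:
  assumes "u \<in> words d k"
  shows "pairing d (k + l) x (tmul (unit_tensor u) b) = pairing d l (lsl u x) b"
proof -
  have inj: "inj_on (\<lambda>v. u @ v) (words d l)" by (auto intro: inj_onI)
  have lu: "length u = k" using assms by (simp add: words_def)
  have ev: "tmul (unit_tensor u) b w = (if take k w = u then b (drop k w) else 0)"
    if "w \<in> words d (k + l)" for w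
    using that by (simp add: tmul_eval[OF unit_tensor_in_Tp[OF assms]] words_def) (simp add: unit_tensor_def)
  have "pairing d (k + l) x (tmul (unit_tensor u) b) =
      (\<Sum>w\<in>(\<lambda>v. u @ v) ` words d l. x w * tmul (unit_tensor u) b w)"
    unfolding pairing_def
  proof (rule sum.mono_neutral_right)
    show "(\<lambda>v. u @ v) ` words d l \<subseteq> words d (k + l)" using assms by (auto simp: words_def)
    show "\<forall>w\<in>words d (k + l) - (\<lambda>v. u @ v) ` words d l. x w * tmul (unit_tensor u) b w = 0"
    proof
      fix w assume w: "w \<in> words d (k + l) - (\<lambda>v. u @ v) ` words d l"
      have "take k w \<noteq> u"
      proof
        assume "take k w = u"
        then have "w = u @ drop k w" by (metis append_take_drop_id)
        moreover have "drop k w \<in> words d l"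
          using w set_drop_subset[of k w] by (auto simp: words_def)
        ultimately show False using w by blast
      qed
      then show "x w * tmul (unit_tensor u) b w = 0" using ev w by simp
    qed
  qed simp
  also have "\<dots> = (\<Sum>v\<in>words d l. x (u @ v) * b v)"
    unfolding sum.reindex[OF inj] o_def
  proof (rule sum.cong[OF refl])
    fix v assume "v \<in> words d l"
    then show "x (u @ v) * tmul (unit_tensor u) b (u @ v) = x (u @ v) * b v"
      using ev[of "u @ v"] assms by (auto simp: words_def)
  qed
  finally show ?thesis by (simp add: pairing_def lsl_apply)
qed

lemma pairing_hom: "pairing d p x (hom p \<xi>) = pairing d p x \<xi>"
  unfolding pairing_def by (intro sum.cong) (auto simp: hom_apply words_def)

lemma sum_words_2: "(\<Sum>w\<in>words d 2. f w) = (\<Sum>i<d. \<Sum>j<d. f [i, j])"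
proof -
  let ?g = "\<lambda>p. [fst p, snd p] :: nat list"
  have "words d 2 = ?g ` ({..<d} \<times> {..<d})"
    by (auto simp: words_def length_Suc_conv numeral_2_eq_2 image_iff)
  moreover have "inj_on ?g ({..<d} \<times> {..<d})" by (auto intro: inj_onI)
  ultimately show ?thesis
    by (simp add: sum.reindex sum.cartesian_product case_prod_beta)
qed

section \<open>The product \<open>star\<close>, degree by degree\<close>

context hecke_symmetry begin

lemma Ups2perp_iff: "\<xi> \<in> Ups2perp d r q \<longleftrightarrow> \<xi> \<in> Tp d 2 \<and> (\<forall>x\<in>U 2. pairing d 2 x \<xi> = 0)"
  by (simp add: Ups2perp_def pairing_def sum_words_2 mult.commute)

lemma star_expand:
  assumes "a \<in> TV d" "b \<in> TV d"
  shows "star d r q a b = (\<Sum>k\<in>degs a. \<Sum>l\<in>degs b. Y 0 k l (tmul (hom k a) (hom l b)))"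
  unfolding star_def yop_eq_Y ..

lemma Y_hom_Tp: "a \<in> TV d \<Longrightarrow> b \<in> TV d \<Longrightarrow> Y 0 k l (tmul (hom k a) (hom l b)) \<in> Tp d (k + l)"
  by (intro Y_in_Tp tmul_in_Tp hom_in_Tp)

lemma star_in_TV: "a \<in> TV d \<Longrightarrow> b \<in> TV d \<Longrightarrow> star d r q a b \<in> TV d"
  unfolding star_expand by (intro TV_sum Tp_TV[OF Y_hom_Tp])

text \<open>\<open>degs\<close> is not additive, as cancellation can shrink it. Summing over all
  \<open>k \<le> p\<close> instead, with zero terms for the missing degrees, makes bilinearity and
  associativity accessible.\<close>

lemma hom_star:
  assumes "a \<in> TV d" "b \<in> TV d"
  shows "hom p (star d r q a b) = (\<Sum>k\<le>p. Y 0 k (p - k) (tmul (hom k a) (hom (p - k) b)))"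
proof -
  let ?F = "\<lambda>k l. Y 0 k l (tmul (hom k a) (hom l b))"
  have F0: "?F k l = 0" if "k \<notin> degs a \<or> l \<notin> degs b" for k l
    using that by (auto simp: hom_outside_degs)
  have hF: "hom p (?F k l) = (if p = k + l then ?F k l else 0)" for k l
    by (rule hom_Tp[OF Y_hom_Tp[OF assms]])
  have inner: "(\<Sum>l\<in>degs b. hom p (?F k l)) = (if k \<le> p then ?F k (p - k) else 0)" for k
  proof -
    have "(\<Sum>l\<in>degs b. hom p (?F k l)) = (\<Sum>l\<in>degs b. if l = p - k then (if k \<le> p then ?F k (p - k) else 0) else 0)"
      by (intro sum.cong) (auto simp: hF)
    also have "\<dots> = (if p - k \<in> degs b then (if k \<le> p then ?F k (p - k) else 0) else 0)"
      using finite_degs[OF assms(2)] by simp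
    finally show ?thesis using F0[of k "p - k"] by auto
  qed
  have "hom p (star d r q a b) = (\<Sum>k\<in>degs a. if k \<le> p then ?F k (p - k) else 0)"
    unfolding star_expand[OF assms] hom_sum inner ..
  also have "\<dots> = (\<Sum>k\<in>degs a \<inter> {..p}. ?F k (p - k))"
    using finite_degs[OF assms(1)] by (simp add: sum.If_cases Int_def)
  also have "\<dots> = (\<Sum>k\<le>p. ?F k (p - k))"
    using F0 by (intro sum.mono_neutral_left) auto
  finally show ?thesis .
qed

lemma hom_star_left:
  assumes "a \<in> Tp d k" "b \<in> TV d" "k \<le> p"
  shows "hom p (star d r q a b) = Y 0 k (p - k) (tmul a (hom (p - k) b))"
proof -
  have "hom p (star d r q a b) = (\<Sum>j\<in>{k}. Y 0 j (p - j) (tmul (hom j a) (hom (p - j) b)))"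
    unfolding hom_star[OF Tp_TV[OF assms(1)] assms(2)]
    by (rule sum.mono_neutral_right) (use assms in \<open>auto simp: hom_Tp[OF assms(1)]\<close>)
  then show ?thesis by (simp add: hom_Tp[OF assms(1)])
qed

lemma hom_star_right:
  assumes "a \<in> TV d" "b \<in> Tp d l" "l \<le> p"
  shows "hom p (star d r q a b) = Y 0 (p - l) l (tmul (hom (p - l) a) b)"
proof -
  have "hom p (star d r q a b) = (\<Sum>j\<in>{p - l}. Y 0 j (p - j) (tmul (hom j a) (hom (p - j) b)))"
    unfolding hom_star[OF assms(1) Tp_TV[OF assms(2)]]
    by (rule sum.mono_neutral_right) (use assms in \<open>auto simp: hom_Tp[OF assms(2)]\<close>)
  then show ?thesis using assms(3) by (simp add: hom_Tp[OF assms(2)])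
qed

lemma star_tone:
  assumes "a \<in> TV d"
  shows "star d r q tone a = a" and "star d r q a tone = a"
proof -
  show "star d r q tone a = a"
    by (rule tensor_eqI_hom) (simp add: hom_star_left[OF tone_in_Tp assms])
  show "star d r q a tone = a"
    by (rule tensor_eqI_hom) (simp add: hom_star_right[OF assms tone_in_Tp])
qed

lemma star_add_left:
  assumes "a \<in> TV d" "b \<in> TV d" "c \<in> TV d"
  shows "star d r q (a + b) c = star d r q a c + star d r q b c"
  by (rule tensor_eqI_hom)
    (simp add: hom_add hom_star assms TV_add tmul_add_left Y_add sum.distrib)

lemma star_add_right:
  assumes "a \<in> TV d" "b \<in> TV d" "c \<in> TV d"
  shows "star d r q a (b + c) = star d r q a b + star d r q a c"
  by (rule tensor_eqI_hom)
    (simp add: hom_add hom_star assms TV_add tmul_add_right Y_add sum.distrib)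

lemma star_scale:
  assumes "a \<in> TV d" "b \<in> TV d"
  shows "star d r q (fscale c a) b = fscale c (star d r q a b)"
    and "star d r q a (fscale c b) = fscale c (star d r q a b)"
  by (rule tensor_eqI_hom,
      simp add: hom_scale hom_star assms TV_scale tmul_scale_left tmul_scale_right Y_scale fs.scale_sum_right)+

lemma star_assoc:
  assumes "a \<in> TV d" "b \<in> TV d" "c \<in> TV d"
  shows "star d r q (star d r q a b) c = star d r q a (star d r q b c)"
proof (rule tensor_eqI_hom)
  fix p
  let ?G = "\<lambda>k l m. Y 0 (k + l) m (Y 0 k l (tmul (tmul (hom k a) (hom l b)) (hom m c)))"
  have "hom p (star d r q (star d r q a b) c) = (\<Sum>s\<le>p. \<Sum>k\<le>s. ?G k (s - k) (p - (k + (s - k))))"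
    unfolding hom_star[OF star_in_TV[OF assms(1,2)] assms(3)]
      hom_star[OF assms(1,2)] tmul_sum_left Y_sum
  proof (intro sum.cong refl)
    fix s k assume sk: "s \<in> {..p}" "k \<in> {..s}"
    have "tmul (Y 0 k (s - k) (tmul (hom k a) (hom (s - k) b))) (hom (p - s) c) =
      Y 0 k (s - k) (tmul (tmul (hom k a) (hom (s - k) b)) (hom (p - s) c))"
      by (rule Y_tmul_left[symmetric, OF tmul_in_Tp[OF hom_in_Tp[OF assms(1)] hom_in_Tp[OF assms(2)]] hom_in_Tp[OF assms(3)]])
        simp
    then show "Y 0 s (p - s) (tmul (Y 0 k (s - k) (tmul (hom k a) (hom (s - k) b))) (hom (p - s) c)) =
      ?G k (s - k) (p - (k + (s - k)))" using sk by simp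
  qed
  also have "\<dots> = (\<Sum>k\<le>p. \<Sum>l\<le>p - k. ?G k l (p - (k + l)))"
    by (rule sum_triangle)
  also have "\<dots> = hom p (star d r q a (star d r q b c))"
    unfolding hom_star[OF assms(1) star_in_TV[OF assms(2,3)]]
      hom_star[OF assms(2,3)] tmul_sum_right Y_sum
  proof (intro sum.cong refl)
    fix k l assume kl: "k \<in> {..p}" "l \<in> {..p - k}"
    define m where "m = p - (k + l)"
    have m: "p - (k + l) = m" "p - k = l + m" "l + m - l = m" using kl by (auto simp: m_def)
    have "tmul (hom k a) (Y 0 l m (tmul (hom l b) (hom m c))) =
        Y (k + 0) l m (tmul (hom k a) (tmul (hom l b) (hom m c)))"
      by (rule Y_tmul_right[symmetric, OF hom_in_Tp[OF assms(1)] tmul_in_Tp[OF hom_in_Tp[OF assms(2)] hom_in_Tp[OF assms(3)]]])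
    then show "?G k l (p - (k + l)) =
      Y 0 k (p - k) (tmul (hom k a) (Y 0 l (p - k - l) (tmul (hom l b) (hom (p - k - l) c))))"
      unfolding m by (simp only: Y_assoc tmul_assoc add_0 add_0_right)
  qed
  finally show "hom p (star d r q (star d r q a b) c) = hom p (star d r q a (star d r q b c))" .
qed

lemma UpsAlg_iff: "x \<in> UpsAlg d r q \<longleftrightarrow> x \<in> TV d \<and> (\<forall>p. hom p x \<in> U p)"
  by (simp add: UpsAlg_def)

lemma UpsAlg_TV: "x \<in> UpsAlg d r q \<Longrightarrow> x \<in> TV d"
  by (simp add: UpsAlg_def)

lemma U_UpsAlg: "x \<in> U p \<Longrightarrow> x \<in> UpsAlg d r q"
  using hom_Tp[OF U_Tp, of x p] by (auto simp: UpsAlg_def intro: Tp_TV U_Tp U_0)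

lemma UpsAlg_star:
  assumes "a \<in> UpsAlg d r q" "b \<in> UpsAlg d r q"
  shows "star d r q a b \<in> UpsAlg d r q"
proof -
  have "Y 0 k (p - k) (tmul (hom k a) (hom (p - k) b)) \<in> U p" if "k \<le> p" for k p
    using Y_in_U[of "hom k a" k "hom (p - k) b" "p - k"] assms that by (simp add: UpsAlg_iff)
  then have "(\<Sum>k\<le>p. Y 0 k (p - k) (tmul (hom k a) (hom (p - k) b))) \<in> U p" for p
    by (intro fs.subspace_sum[OF subspace_Ups]) simp
  then show ?thesis
    using assms by (simp add: UpsAlg_iff star_in_TV hom_star)
qed

lemma subspace_UpsAlg: "fs.subspace (UpsAlg d r q)"
  unfolding fs.subspace_def
  by (simp add: UpsAlg_iff TV_0 TV_add TV_scale hom_add hom_scale U_0 U_add U_scale)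

end

context hecke_frobenius begin

text \<open>The linear form is the coefficient at \<open>pivot\<close>, a coordinate on the line
  \<open>U n\<close>. Testing with homogeneous elements of degree n - k isolates the component of
  degree \<open>k\<close>.\<close>

lemma frobenius_UpsAlg: "frobenius_quot (UpsAlg d r q) {0} (star d r q) tone"
proof -
  let ?A = "UpsAlg d r q"
  note TV = UpsAlg_TV
  have basis: "\<exists>B. finite B \<and> B \<subseteq> ?A \<and> (\<forall>a\<in>?A. \<exists>b\<in>fs.span B. a - b \<in> {0})"
  proof -
    let ?W = "unit_tensor ` (\<Union>p\<le>n. words d p)"
    have "?A \<subseteq> fs.span ?W"
    proof
      fix x assume x: "x \<in> ?A"
      show "x \<in> fs.span ?W"
      proof (rule TV_homI[of "{..n}", OF _ _ _ fs.subspace_span])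
        show "hom p x = 0" if "p \<notin> {..n}" for p
          using x U_above[of p] that by (auto simp: UpsAlg_iff)
        show "hom p x \<in> fs.span ?W" if "p \<in> {..n}" for p
        proof -
          have "hom p x \<in> fs.span (unit_tensor ` words d p)"
            using Tp_span hom_in_Tp[OF TV[OF x]] by blast
          then show ?thesis by (rule subsetD[OF fs.span_mono, rotated]) (use that in auto)
        qed
      qed simp
    qed
    then obtain C where C: "C \<subseteq> ?A" "finite C" "?A \<subseteq> fs.span C"
      by (rule finite_basis) simp
    have "\<exists>b\<in>fs.span C. a - b \<in> {0}" if "a \<in> ?A" for a
      by (rule bexI[of _ a]) (use C(3) that in auto)
    with C(1,2) show ?thesis by blast
  qed
  have eval: "x pivot = hom n x pivot" for x :: "'k tensor"
    by (simp add: hom_apply length_pivot)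
  have homU: "hom k a \<in> U k" if "a \<in> ?A" for a k using that by (simp add: UpsAlg_iff)
  have zero: "Y 0 j k (tmul a b) = 0"
    if "j + k = n" "a \<in> U j" "b \<in> U k" "Y 0 j k (tmul a b) pivot = 0" for j k a b
    using form_eq_0_iff[OF that(1-3)] that(4) by (simp add: form_def)
  have left: "a = 0" if a: "a \<in> ?A" and 0: "\<forall>b\<in>?A. star d r q a b pivot = 0" for a
  proof (rule tensor_eqI_hom)
    fix k
    show "hom k a = hom k 0"
    proof (cases "k \<le> n")
      case True
      have "hom k a = 0"
      proof (rule star_left_nondegenerate[of k "n - k"])
        fix b assume b: "b \<in> U (n - k)"
        have "hom n (star d r q a b) = Y 0 k (n - k) (tmul (hom k a) b)"
          using hom_star_right[OF TV[OF a] U_Tp[OF b], of n] True by simp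
        then show "Y 0 k (n - k) (tmul (hom k a) b) = 0"
          using 0 U_UpsAlg[OF b] eval[of "star d r q a b"] True by (intro zero homU[OF a] b) auto
      qed (use True homU[OF a] in auto)
      then show ?thesis by simp
    next
      case False
      then show ?thesis using U_above[of k] homU[OF a, of k] by simp
    qed
  qed
  have right: "b = 0" if b: "b \<in> ?A" and 0: "\<forall>a\<in>?A. star d r q a b pivot = 0" for b
  proof (rule tensor_eqI_hom)
    fix k
    show "hom k b = hom k 0"
    proof (cases "k \<le> n")
      case True
      have "hom k b = 0"
      proof (rule star_right_nondegenerate[of "n - k" k])
        fix a assume a: "a \<in> U (n - k)"
        have "hom n (star d r q a b) = Y 0 (n - k) k (tmul a (hom k b))"
          using hom_star_left[OF U_Tp[OF a] TV[OF b], of n] True by simp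
        then show "Y 0 (n - k) k (tmul a (hom k b)) = 0"
          using 0 U_UpsAlg[OF a] eval[of "star d r q a b"] True by (intro zero homU[OF b] a) auto
      qed (use True homU[OF b] in auto)
      then show ?thesis by simp
    next
      case False
      then show ?thesis using U_above[of k] homU[OF b, of k] by simp
    qed
  qed
  have star0: "star d r q a 0 = 0" "star d r q 0 a = 0" if "a \<in> ?A" for a
    using star_scale(2)[OF TV[OF that] TV_0, of 0] star_scale(1)[OF TV_0 TV[OF that], of 0] by simp_all
  show ?thesis
    unfolding frobenius_quot_def
  proof (intro conjI)
    show "\<exists>\<epsilon>. (\<forall>a\<in>?A. \<forall>b\<in>?A. \<epsilon> (a + b) = \<epsilon> a + \<epsilon> b) \<and> (\<forall>c. \<forall>a\<in>?A. \<epsilon> (fscale c a) = c * \<epsilon> a) \<and>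
        (\<forall>x\<in>{0}. \<epsilon> x = 0) \<and>
        (\<forall>a\<in>?A. (\<forall>b\<in>?A. \<epsilon> (star d r q a b) = 0) \<longrightarrow> a \<in> {0}) \<and>
        (\<forall>a\<in>?A. (\<forall>b\<in>?A. \<epsilon> (star d r q b a) = 0) \<longrightarrow> a \<in> {0})"
      using left right by (intro exI[of _ "\<lambda>x. x pivot"]) (simp add: tensor_apply)
    show "0 \<in> ?A" "\<forall>a\<in>?A. \<forall>b\<in>?A. a + b \<in> ?A" "\<forall>c. \<forall>a\<in>?A. fscale c a \<in> ?A"
      using subspace_UpsAlg unfolding fs.subspace_def by blast+
    then show "{0} \<subseteq> ?A" by blast
    show "tone \<in> ?A"
      by (rule U_UpsAlg[of _ 0]) (simp add: Ups_iff tone_in_Tp)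
  qed (use basis star0 in \<open>auto simp: star_assoc star_tone star_add_left star_add_right star_scale UpsAlg_star TV\<close>)
qed

end

section \<open>The quadratic dual\<close>

context hecke_symmetry begin

abbreviation "I \<equiv> Sdual_ideal d r q"

lemma subspace_I: "fs.subspace I"
  by (simp add: Sdual_ideal_def)

lemma I_generator: "u \<in> TV d \<Longrightarrow> v \<in> TV d \<Longrightarrow> \<xi> \<in> Ups2perp d r q \<Longrightarrow> tmul (tmul u \<xi>) v \<in> I"
  unfolding Sdual_ideal_def by (intro fs.span_base) blast

lemma I_minimal:
  assumes "fs.subspace S" "\<And>u v \<xi>. u \<in> TV d \<Longrightarrow> v \<in> TV d \<Longrightarrow> \<xi> \<in> Ups2perp d r q \<Longrightarrow> tmul (tmul u \<xi>) v \<in> S"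
  shows "I \<subseteq> S"
  unfolding Sdual_ideal_def by (rule fs.span_minimal[OF _ assms(1)]) (use assms(2) in blast)

lemma I_subset_TV: "I \<subseteq> TV d"
proof (rule I_minimal[OF subspace_TV])
  fix u v \<xi> :: "'k tensor" assume "u \<in> TV d" "v \<in> TV d" "\<xi> \<in> Ups2perp d r q"
  then show "tmul (tmul u \<xi>) v \<in> TV d"
    by (intro tmul_in_TV) (auto simp: Ups2perp_iff intro: Tp_TV)
qed

lemma I_ideal:
  assumes "a \<in> TV d" "x \<in> I"
  shows "tmul a x \<in> I" "tmul x a \<in> I"
proof -
  have "I \<subseteq> {x. tmul a x \<in> I}"
  proof (rule I_minimal)
    show "fs.subspace {x. tmul a x \<in> I}"
      using subspace_I by (simp add: fs.subspace_def tmul_add_right tmul_scale_right)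
    show "tmul (tmul u \<xi>) v \<in> {x. tmul a x \<in> I}"
      if "u \<in> TV d" "v \<in> TV d" "\<xi> \<in> Ups2perp d r q" for u v \<xi>
      using I_generator[OF tmul_in_TV[OF assms(1) that(1)] that(2,3)] by (simp add: tmul_assoc)
  qed
  then show "tmul a x \<in> I" using assms(2) by blast
  have "I \<subseteq> {x. tmul x a \<in> I}"
  proof (rule I_minimal)
    show "fs.subspace {x. tmul x a \<in> I}"
      using subspace_I by (simp add: fs.subspace_def tmul_add_left tmul_scale_left)
    show "tmul (tmul u \<xi>) v \<in> {x. tmul x a \<in> I}"
      if "u \<in> TV d" "v \<in> TV d" "\<xi> \<in> Ups2perp d r q" for u v \<xi>
      using I_generator[OF that(1) tmul_in_TV[OF that(2) assms(1)] that(3)] by (simp add: tmul_assoc)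
  qed
  then show "tmul x a \<in> I" using assms(2) by blast
qed

text \<open>The converse of slicing: preimages found for the two-letter windows recombine to one
  preimage of \<open>x\<close>.\<close>

lemma img_from_slices:
  assumes "x \<in> Tp d (s + 2 + t)"
    and "\<And>u v. u \<in> words d s \<Longrightarrow> v \<in> words d t \<Longrightarrow> lsl u (rsl v x) \<in> img 1 2"
  shows "x \<in> img (s + 1) (s + 2 + t)"
proof -
  have "tmul (rsl v x) (unit_tensor v) \<in> img (s + 1) (s + 2 + t)" if v: "v \<in> words d t" for v
  proof (rule img_tmul_left[OF _ unit_tensor_in_Tp[OF v]])
    have T: "rsl v x \<in> Tp d (s + 2)" using assms(1) v by (intro rsl_in_Tp) (auto simp: words_def)
    have "(\<Sum>u\<in>words d s. tmul (unit_tensor u) (lsl u (rsl v x))) \<in> img (s + 1) (s + 2)"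
      by (intro fs.subspace_sum[OF subspace_img] img_tmul_right assms(2) v unit_tensor_in_Tp) simp_all
    then show "rsl v x \<in> img (s + 1) (s + 2)" using tmul_lsl_expand[OF T] by simp
  qed simp
  then have "(\<Sum>v\<in>words d t. tmul (rsl v x) (unit_tensor v)) \<in> img (s + 1) (s + 2 + t)"
    by (intro fs.subspace_sum[OF subspace_img])
  then show ?thesis using tmul_rsl_expand[OF assms(1)] by simp
qed

text \<open>Both sides of the pairing are finite dimensional, so it suffices that the annihilator
  of the ideal in degree \<open>k\<close> is \<open>U k\<close>; this in turn is double annihilation in degree 2.\<close>

lemma perp_U_in_I:
  assumes "\<xi> \<in> Tp d k" "\<And>x. x \<in> U k \<Longrightarrow> pairing d k x \<xi> = 0"
  shows "\<xi> \<in> I"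
proof (rule ccontr)
  assume "\<xi> \<notin> I"
  then obtain x where x: "x \<in> Tp d k" "\<And>\<eta>. \<eta> \<in> I \<Longrightarrow> \<eta> \<in> Tp d k \<Longrightarrow> pairing d k \<eta> x = 0"
    "pairing d k \<xi> x \<noteq> 0"
    using separating_functional[OF subspace_I assms(1)] by metis
  have "x \<in> img i k" if i: "1 \<le> i" "i < k" for i
  proof -
    define s t where "s = i - 1" and "t = k - i - 1"
    have st: "k = s + 2 + t" "i = s + 1" using i by (auto simp: s_def t_def)
    have "lsl u (rsl v x) \<in> U 2" if u: "u \<in> words d s" and v: "v \<in> words d t" for u v
    proof (rule ccontr)
      \<comment> \<open>A window outside \<open>U 2\<close> is detected by a relation
        \<open>\<eta>\<close>; framed by the words \<open>u\<close> and \<open>v\<close>, it becomes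
        an element of the ideal that does not annihilate \<open>x\<close>.\<close>
      assume n: "lsl u (rsl v x) \<notin> U 2"
      have rT: "rsl v x \<in> Tp d (s + 2)"
        using x(1) v unfolding st by (intro rsl_in_Tp) (auto simp: words_def)
      have T: "lsl u (rsl v x) \<in> Tp d 2"
        using u by (intro lsl_in_Tp[OF rT]) (auto simp: words_def)
      obtain \<eta> where \<eta>: "\<eta> \<in> Tp d 2" "\<And>z. z \<in> U 2 \<Longrightarrow> z \<in> Tp d 2 \<Longrightarrow> pairing d 2 z \<eta> = 0"
        "pairing d 2 (lsl u (rsl v x)) \<eta> \<noteq> 0"
        using separating_functional[OF subspace_Ups T n] by metis
      let ?e = "tmul (tmul (unit_tensor u) \<eta>) (unit_tensor v)"
      have "\<eta> \<in> Ups2perp d r q" using \<eta>(1,2) U_Tp by (auto simp: Ups2perp_iff)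
      then have "?e \<in> I"
        by (intro I_generator Tp_TV[OF unit_tensor_in_Tp[OF u]] Tp_TV[OF unit_tensor_in_Tp[OF v]])
      moreover have "?e \<in> Tp d k"
        unfolding st by (intro tmul_in_Tp unit_tensor_in_Tp u v \<eta>(1))
      ultimately have "pairing d k x ?e = 0" using x(2) pairing_commute[of d k x ?e] by simp
      moreover have "pairing d k x ?e = pairing d 2 (lsl u (rsl v x)) \<eta>"
        unfolding st(1) pairing_tmul_unit_right[OF v] pairing_tmul_unit_left[OF u] ..
      ultimately show False using \<eta>(3) by simp
    qed
    then show ?thesis
      unfolding st using x(1) by (intro img_from_slices) (auto simp: st Ups_iff)
  qed
  then have "x \<in> U k" using x(1) by (simp add: Ups_iff)
  then show False using assms(2) x(3) pairing_commute[of d k x \<xi>] by simp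
qed

end

section \<open>The linear form on the dual given by \<open>\<omega>\<close>\<close>

context hecke_frobenius begin

text \<open>By linearity the outer factors may be taken to be basis words. In degree
  \<open>n\<close> the pairing is then that of a relation with a two-letter window of
  \<open>\<omega>\<close>, which lies in \<open>U 2\<close>; in other degrees it is zero.\<close>

lemma omega_vanishes_on_I:
  assumes "x \<in> I"
  shows "pairing d n \<omega> x = 0"
proof -
  have sub: "fs.subspace {x. pairing d n \<omega> (f x) = 0}"
    if "\<And>x y. f (x + y) = f x + f y" "\<And>c x. f (fscale c x) = fscale c (f x)" for f
    using that(2)[of 0 0] unfolding fs.subspace_def
    by (simp add: that pairing_add_right pairing_scale_right) (simp add: pairing_def tensor_apply)
  let ?E = "unit_tensor ` {w. set w \<subseteq> {..<d}} :: 'k tensor set"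
  have "I \<subseteq> {x. pairing d n \<omega> x = 0}"
  proof (rule I_minimal)
    show "fs.subspace {x. pairing d n \<omega> x = 0}" by (rule sub) simp_all
    fix u v \<xi> :: "'k tensor" assume uv: "u \<in> TV d" "v \<in> TV d" and \<xi>: "\<xi> \<in> Ups2perp d r q"
    have \<xi>T: "\<xi> \<in> Tp d 2" using \<xi> by (simp add: Ups2perp_iff)
    have unit: "pairing d n \<omega> (tmul (tmul (unit_tensor u) \<xi>) (unit_tensor v)) = 0"
      if "set u \<subseteq> {..<d}" "set v \<subseteq> {..<d}" for u v
    proof -
      define s t where "s = length u" and "t = length v"
      have u: "u \<in> words d s" and v: "v \<in> words d t" using that by (simp_all add: words_def s_def t_def)
      have T: "tmul (tmul (unit_tensor u) \<xi>) (unit_tensor v) \<in> Tp d (s + 2 + t)"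
        by (intro tmul_in_Tp unit_tensor_in_Tp u v \<xi>T)
      show ?thesis
      proof (cases "s + 2 + t = n")
        case True
        have "rsl v \<omega> \<in> U (s + 2)"
          using omega_U True v by (intro U_rsl[of _ _ t]) (auto simp: words_def)
        then have "lsl u (rsl v \<omega>) \<in> U 2"
          using u by (intro U_lsl[of _ s]) (auto simp: words_def)
        then have "pairing d 2 (lsl u (rsl v \<omega>)) \<xi> = 0" using \<xi> by (simp add: Ups2perp_iff)
        then show ?thesis
          unfolding True[symmetric] pairing_tmul_unit_right[OF v] pairing_tmul_unit_left[OF u] .
      next
        case False
        show ?thesis
          unfolding pairing_def
          by (intro sum.neutral ballI) (use False Tp_outside[OF T] in \<open>auto simp: words_def\<close>)
      qed
    qed
    have "fs.span ?E \<subseteq> {v. pairing d n \<omega> (tmul (tmul (unit_tensor u) \<xi>) v) = 0}" if "set u \<subseteq> {..<d}" for u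
    proof (rule fs.span_minimal)
      show "fs.subspace {v. pairing d n \<omega> (tmul (tmul (unit_tensor u) \<xi>) v) = 0}"
        by (rule sub) (simp_all add: tmul_add_right tmul_scale_right)
    qed (use unit that in blast)
    then have 1: "pairing d n \<omega> (tmul (tmul (unit_tensor u) \<xi>) v) = 0" if "set u \<subseteq> {..<d}" for u
      using TV_span_units uv(2) that by blast
    have "fs.span ?E \<subseteq> {u. pairing d n \<omega> (tmul (tmul u \<xi>) v) = 0}"
    proof (rule fs.span_minimal)
      show "fs.subspace {u. pairing d n \<omega> (tmul (tmul u \<xi>) v) = 0}"
        by (rule sub) (simp_all add: tmul_add_left tmul_scale_left)
    qed (use 1 in blast)
    then show "tmul (tmul u \<xi>) v \<in> {x. pairing d n \<omega> x = 0}"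
      using TV_span_units uv(1) by blast
  qed
  then show ?thesis using assms by blast
qed

lemma perp_support_in_I:
  assumes "\<xi> \<in> TV d" "k \<le> n" "fs.span S = U k" "\<And>x. x \<in> S \<Longrightarrow> pairing d k x \<xi> = 0"
  shows "hom k \<xi> \<in> I"
proof (rule perp_U_in_I[OF hom_in_Tp[OF assms(1)]])
  fix x assume "x \<in> U k"
  moreover have "fs.span S \<subseteq> {x. pairing d k x \<xi> = 0}"
    by (rule fs.span_minimal[OF _ subspace_pairing]) (use assms(4) in blast)
  ultimately show "pairing d k x (hom k \<xi>) = 0" using assms(3) by (auto simp: pairing_hom)
qed

text \<open>In these degrees \<open>U k\<close> is zero, so every tensor annihilates it; this makes
  the quotient finite dimensional.\<close>

lemma hom_above_in_I: "\<xi> \<in> TV d \<Longrightarrow> k > n \<Longrightarrow> hom k \<xi> \<in> I"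
  by (rule perp_U_in_I[OF hom_in_Tp]) (auto simp: U_above pairing_def tensor_apply)

lemma hom_in_I:
  assumes "\<xi> \<in> TV d" "\<And>k. k \<le> n \<Longrightarrow> hom k \<xi> \<in> I"
  shows "\<xi> \<in> I"
proof (rule TV_homI[OF finite_degs[OF assms(1)] hom_outside_degs _ subspace_I])
  show "hom p \<xi> \<in> I" for p
    using assms hom_above_in_I by (cases "p \<le> n") auto
qed

text \<open>The linear form is evaluation on \<open>\<omega>\<close>. Multiplying by a basis word
  slices \<open>\<omega>\<close>, so each radical is orthogonal to all left, respectively right,
  factors of \<open>\<omega>\<close>, hence to every \<open>U k\<close> with
  \<open>k \<le> n\<close>, and \<open>perp_U_in_I\<close> puts it into the ideal.\<close>

lemma frobenius_dual: "frobenius_quot (TV d) I tmul tone"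
proof -
  let ?\<epsilon> = "\<lambda>x. pairing d n \<omega> x"
  have left: "a \<in> I" if a: "a \<in> TV d" and 0: "\<forall>b\<in>TV d. ?\<epsilon> (tmul a b) = 0" for a
  proof (rule hom_in_I[OF a])
    fix k assume k: "k \<le> n"
    show "hom k a \<in> I"
    proof (rule perp_support_in_I[OF a k left_support_eq[OF k, unfolded left_support_def]])
      fix x assume "x \<in> (\<lambda>v. rsl v \<omega>) ` words d (n - k)"
      then obtain v where v: "v \<in> words d (n - k)" "x = rsl v \<omega>" by blast
      have "?\<epsilon> (tmul a (unit_tensor v)) = 0" using 0 Tp_TV[OF unit_tensor_in_Tp[OF v(1)]] by blast
      then show "pairing d k x a = 0"
        using pairing_tmul_unit_right[OF v(1), of k \<omega> a] k v(2) by simp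
    qed
  qed
  have right: "a \<in> I" if a: "a \<in> TV d" and 0: "\<forall>b\<in>TV d. ?\<epsilon> (tmul b a) = 0" for a
  proof (rule hom_in_I[OF a])
    fix k assume k: "k \<le> n"
    show "hom k a \<in> I"
    proof (rule perp_support_in_I[OF a k right_support_eq[OF k, unfolded right_support_def]])
      fix x assume "x \<in> (\<lambda>u. lsl u \<omega>) ` words d (n - k)"
      then obtain u where u: "u \<in> words d (n - k)" "x = lsl u \<omega>" by blast
      have "?\<epsilon> (tmul (unit_tensor u) a) = 0" using 0 Tp_TV[OF unit_tensor_in_Tp[OF u(1)]] by blast
      then show "pairing d k x a = 0"
        using pairing_tmul_unit_left[OF u(1), of k \<omega> a] k u(2) by simp
    qed
  qed
  have basis: "\<exists>B. finite B \<and> B \<subseteq> TV d \<and> (\<forall>a\<in>TV d. \<exists>b\<in>fs.span B. a - b \<in> I)"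
  proof (intro exI[of _ "unit_tensor ` (\<Union>p\<le>n. words d p)"] conjI ballI)
    show "unit_tensor ` (\<Union>p\<le>n. words d p) \<subseteq> TV d"
      by (auto intro: Tp_TV unit_tensor_in_Tp)
    fix a :: "'k tensor" assume a: "a \<in> TV d"
    define b where "b = (\<Sum>p\<le>n. hom p a)"
    have bT: "b \<in> TV d" unfolding b_def by (intro TV_sum Tp_TV[OF hom_in_Tp[OF a]])
    have "b \<in> fs.span (unit_tensor ` (\<Union>p\<le>n. words d p))"
      unfolding b_def
    proof (rule fs.span_sum)
      fix p assume p: "p \<in> {..n}"
      have "hom p a \<in> fs.span (unit_tensor ` words d p)"
        using Tp_span hom_in_Tp[OF a] by blast
      then show "hom p a \<in> fs.span (unit_tensor ` (\<Union>p\<le>n. words d p))"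
        by (rule subsetD[OF fs.span_mono, rotated]) (use p in auto)
    qed
    moreover have "a - b \<in> I"
    proof (rule hom_in_I[OF TV_diff[OF a bT]])
      fix k assume k: "k \<le> n"
      have "hom k b = (\<Sum>p\<le>n. if p = k then hom k a else 0)"
        unfolding b_def hom_sum by (intro sum.cong) (auto simp: hom_Tp[OF hom_in_Tp[OF a]])
      then have "hom k b = hom k a" using k by simp
      then show "hom k (a - b) \<in> I" using fs.subspace_0[OF subspace_I] by (simp add: hom_diff)
    qed
    ultimately show "\<exists>b\<in>fs.span (unit_tensor ` (\<Union>p\<le>n. words d p)). a - b \<in> I" by blast
  qed simp
  show ?thesis
    unfolding frobenius_quot_def
  proof (intro conjI)
    show "\<exists>\<epsilon>. (\<forall>a\<in>TV d. \<forall>b\<in>TV d. \<epsilon> (a + b) = \<epsilon> a + \<epsilon> b) \<and> (\<forall>c. \<forall>a\<in>TV d. \<epsilon> (fscale c a) = c * \<epsilon> a) \<and>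
        (\<forall>x\<in>I. \<epsilon> x = 0) \<and>
        (\<forall>a\<in>TV d. (\<forall>b\<in>TV d. \<epsilon> (tmul a b) = 0) \<longrightarrow> a \<in> I) \<and>
        (\<forall>a\<in>TV d. (\<forall>b\<in>TV d. \<epsilon> (tmul b a) = 0) \<longrightarrow> a \<in> I)"
      using left right omega_vanishes_on_I
      by (intro exI[of _ ?\<epsilon>]) (simp add: pairing_add_right pairing_scale_right)
    show "0 \<in> I" "\<forall>a\<in>I. \<forall>b\<in>I. a + b \<in> I" "\<forall>c. \<forall>a\<in>I. fscale c a \<in> I"
      using subspace_I unfolding fs.subspace_def by blast+
    show "tone \<in> TV d" by (rule Tp_TV[OF tone_in_Tp])
    show "I \<subseteq> TV d" by (rule I_subset_TV)
    show "\<forall>a\<in>TV d. \<forall>x\<in>I. tmul a x \<in> I \<and> tmul x a \<in> I" using I_ideal by blast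
    show "\<exists>B. finite B \<and> B \<subseteq> TV d \<and> (\<forall>a\<in>TV d. \<exists>b\<in>fs.span B. a - b \<in> I)" by (rule basis)
  qed (simp_all add: TV_0 TV_add TV_scale tmul_in_TV tmul_add_left tmul_add_right tmul_scale_left
      tmul_scale_right tmul_assoc)
qed

end

theorem theorem2p5:
  fixes d :: nat and r :: "nat \<Rightarrow> nat \<Rightarrow> nat \<Rightarrow> nat \<Rightarrow> 'k::field" and q :: 'k and n :: nat
  assumes "hecke d r q" and "n > 0"
  shows "(vdim (Ups d r q n) = 1 \<and> Ups d r q (n + 1) = {0} \<longrightarrow>
            frobenius_quot (UpsAlg d r q) {0} (star d r q) tone \<and>
            frobenius_quot (TV d) (Sdual_ideal d r q) tmul tone)
       \<and> (d > 1 \<and> vdim (Ups d r q n) = 1 \<longrightarrow> Ups d r q (n + 1) = {0})"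
proof -
  interpret hecke_symmetry d r q by unfold_locales (rule assms(1))
  have top: "\<exists>\<omega>. hecke_top d r q n \<omega>" if dim: "vdim (Ups d r q n) = 1"
  proof -
    obtain \<omega> where "\<omega> \<noteq> 0" "Ups d r q n = range (\<lambda>c. fscale c \<omega>)"
      using dim_1_generator[OF subspace_Ups dim] .
    then have "hecke_top d r q n \<omega>" by unfold_locales (use assms(2) in auto)
    then show ?thesis by blast
  qed
  show ?thesis
  proof (intro conjI impI; elim conjE)
    assume dim: "vdim (Ups d r q n) = 1" and U0: "Ups d r q (n + 1) = {0}"
    obtain \<omega> where "hecke_top d r q n \<omega>" using top[OF dim] by blast
    then interpret hecke_top d r q n \<omega> .
    interpret hecke_frobenius d r q n \<omega> by unfold_locales (rule U0)
    show "frobenius_quot (UpsAlg d r q) {0} (star d r q) tone" by (rule frobenius_UpsAlg)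
    show "frobenius_quot (TV d) (Sdual_ideal d r q) tmul tone" by (rule frobenius_dual)
  next
    assume dim: "vdim (Ups d r q n) = 1" and d: "d > 1"
    obtain \<omega> where "hecke_top d r q n \<omega>" using top[OF dim] by blast
    then interpret hecke_top d r q n \<omega> .
    show "Ups d r q (n + 1) = {0}" by (rule U_Suc_n_trivial[OF d])
  qed
qed

end
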